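(* For $n\ge 0$ let $\eta_n^*=\lambda(\beta_n)/\beta_n$. Then the sequence $(\eta_n^* )_{n\geq0}$ is strictly increasing.
   Context: Let $\mathbb{D}$ be the open unit disk in $\mathbb{R}^2$ and $\mathbf{A}(x_1,x_2)=\frac12(-x_2,x_1)$. For $b\geq0$ let $H_b$ be the self-adjoint operator in $L^2(\mathbb{D})$ associated with the closed quadratic form $q_b[u]=\int_{\mathbb{D}}|(-i\nabla+b\mathbf{A})u|^2\,d\mathbf{x}$, $u\in H^1(\mathbb{D})$ (magnetic Neumann Laplacian), and let $\lambda(b)=\inf\operatorname{spec}H_b$. For an integer $n\ge0$, let $\lambda_n(b)$ be the lowest eigenvalue of the self-adjoint operator $H_{n,b}=-\frac{d^2}{dr^2}-\frac1r\frac{d}{dr}+\left(\frac nr-\frac b2r\right)^2$ in $L^2((0,1),r\,dr)$ with Neumann condition $f'(1)=0$, i.e. the operator associated with the quadratic form $q_{n,b}[f]=\int_0^1\bigl[|f'(r)|^2+(\frac nr-\frac b2r)^2|f(r)|^2\bigr]r\,dr$, whose domain consists of those $f\in L^2((0,1),r\,dr)$ for which the right-hand side is finite. Then $\lambda(b)=\min_{n\ge0}\lambda_n(b)$ for $b\ge 0$. Definition of $\beta_n$ (a known result of Helffer and Léna): there is a strictly increasing sequence $(\beta_n)_{n\geq0}$, with $\beta_n>2(n+1)$ for every $n$, such that the branches $\lambda_n$ and $\lambda_{n+1}$ meet exactly once on $(0,+\infty)$, at $b=\beta_n$; moreover $\lambda(b)=\lambda_0(b)$ for $0\leq b\leq\beta_0$,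 and $\lambda(b)=\lambda_n(b)$ for $\beta_{n-1}\leq b\leq\beta_n$, $n\geq1$. *)

theory Defs
  imports "HOL-Analysis.Analysis"
begin

section \<open>Square-integrable functions, form operators and spectra\<close>

text \<open>
  Elements of a complex \<open>L\<^sup>2\<close> space are represented by functions; equality in \<open>L\<^sup>2\<close> is equality
  almost everywhere, and only the values on \<open>space M\<close> matter.
\<close>

definition L2 :: "'a measure \<Rightarrow> ('a \<Rightarrow> complex) set" where
  "L2 M = {u \<in> borel_measurable M. integrable M (\<lambda>x. (cmod (u x))\<^sup>2)}"

definition L2_inner :: "'a measure \<Rightarrow> ('a \<Rightarrow> complex) \<Rightarrow> ('a \<Rightarrow> complex) \<Rightarrow> complex" where
  "L2_inner M u v = (LINT x|M. u x * cnj (v x))"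

definition L2_norm :: "'a measure \<Rightarrow> ('a \<Rightarrow> complex) \<Rightarrow> real" where
  "L2_norm M u = sqrt (LINT x|M. (cmod (u x))\<^sup>2)"

text \<open>
  An operator in \<open>L\<^sup>2\<close> is given by its graph, a set of pairs \<open>(u, T u)\<close>. The operator associated with
  a form \<open>q\<close> with domain \<open>Q\<close> (given as a sesquilinear form, linear in the first argument): \<open>u \<in> Q\<close> is
  in the operator domain, with image \<open>w \<in> L\<^sup>2\<close>, iff \<open>q u v = \<langle>w, v\<rangle>\<close> for every \<open>v \<in> Q\<close>.
\<close>

definition form_operator ::
  "'a measure \<Rightarrow> ('a \<Rightarrow> complex) set \<Rightarrow> (('a \<Rightarrow> complex) \<Rightarrow> ('a \<Rightarrow> complex) \<Rightarrow> complex)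
    \<Rightarrow> (('a \<Rightarrow> complex) \<times> ('a \<Rightarrow> complex)) set" where
  "form_operator M Q q =
     {(u, w). u \<in> Q \<and> w \<in> L2 M \<and> (\<forall>v\<in>Q. q u v = L2_inner M w v)}"

text \<open>
  \<open>z\<close> is in the resolvent set iff \<open>T - z\<close> maps its domain onto \<open>L\<^sup>2\<close> and has a bounded inverse; the
  estimate gives both the injectivity of \<open>T - z\<close> and the boundedness of the inverse.
\<close>

definition resolvent_set ::
  "'a measure \<Rightarrow> (('a \<Rightarrow> complex) \<times> ('a \<Rightarrow> complex)) set \<Rightarrow> complex set" where
  "resolvent_set M T =
     {z. (\<forall>f\<in>L2 M. \<exists>(u, w)\<in>T. AE x in M. w x - z * u x = f x) \<and>
         (\<exists>C. \<forall>(u, w)\<in>T. L2_norm M u \<le> C * L2_norm M (\<lambda>x. w x - z * u x))}"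

definition spectrum ::
  "'a measure \<Rightarrow> (('a \<Rightarrow> complex) \<times> ('a \<Rightarrow> complex)) set \<Rightarrow> complex set" where
  "spectrum M T = - resolvent_set M T"

definition is_eigenvalue ::
  "'a measure \<Rightarrow> (('a \<Rightarrow> complex) \<times> ('a \<Rightarrow> complex)) set \<Rightarrow> complex \<Rightarrow> bool" where
  "is_eigenvalue M T z \<longleftrightarrow>
     (\<exists>(u, w)\<in>T. \<not> (AE x in M. u x = 0) \<and> (AE x in M. w x = z * u x))"


section \<open>Weak derivatives\<close>

primrec C_k :: "nat \<Rightarrow> ('a::euclidean_space \<Rightarrow> real) \<Rightarrow> bool" where
  "C_k 0 \<phi> \<longleftrightarrow> continuous_on UNIV \<phi>"
| "C_k (Suc k) \<phi> \<longleftrightarrow>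
     (\<forall>x. \<phi> differentiable (at x)) \<and> (\<forall>e\<in>Basis. C_k k (\<lambda>x. frechet_derivative \<phi> (at x) e))"

definition test_functions :: "'a::euclidean_space set \<Rightarrow> ('a \<Rightarrow> real) set" where
  "test_functions \<Omega> =
     {\<phi>. (\<forall>k. C_k k \<phi>) \<and> compact (closure {x. \<phi> x \<noteq> 0}) \<and> closure {x. \<phi> x \<noteq> 0} \<subseteq> \<Omega>}"

definition locally_integrable :: "'a::euclidean_space set \<Rightarrow> ('a \<Rightarrow> complex) \<Rightarrow> bool" where
  "locally_integrable \<Omega> u \<longleftrightarrow> (\<forall>K. compact K \<and> K \<subseteq> \<Omega> \<longrightarrow> u absolutely_integrable_on K)"

definition has_weak_deriv ::
  "'a::euclidean_space set \<Rightarrow> 'a \<Rightarrow> ('a \<Rightarrow> complex) \<Rightarrow> ('a \<Rightarrow> complex) \<Rightarrow> bool" where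
  "has_weak_deriv \<Omega> e u g \<longleftrightarrow>
     locally_integrable \<Omega> u \<and> locally_integrable \<Omega> g \<and>
     (\<forall>\<phi>\<in>test_functions \<Omega>.
        (LINT x|lebesgue_on \<Omega>. u x * of_real (frechet_derivative \<phi> (at x) e)) =
        - (LINT x|lebesgue_on \<Omega>. g x * of_real (\<phi> x)))"

text \<open>
  For open \<open>\<Omega>\<close>, the weak derivative in direction \<open>e\<close> is determined up to null sets if it exists.
\<close>

definition weak_deriv ::
  "'a::euclidean_space set \<Rightarrow> 'a \<Rightarrow> ('a \<Rightarrow> complex) \<Rightarrow> ('a \<Rightarrow> complex)" where
  "weak_deriv \<Omega> e u = (SOME g. has_weak_deriv \<Omega> e u g)"

definition H1 :: "'a::euclidean_space set \<Rightarrow> ('a \<Rightarrow> complex) set" where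
  "H1 \<Omega> = {u \<in> L2 (lebesgue_on \<Omega>).
             \<forall>e\<in>Basis. \<exists>g\<in>L2 (lebesgue_on \<Omega>). has_weak_deriv \<Omega> e u g}"


section \<open>The magnetic Neumann Laplacian on the unit disk\<close>

abbreviation disk :: "(real^2) set" where
  "disk \<equiv> ball 0 1"

definition magA :: "real^2 \<Rightarrow> real^2" where
  "magA x = (1/2) *\<^sub>R vector [- (x $ 2), x $ 1]"

text \<open>The component of \<open>(-i\<nabla> + b A) u\<close> along the standard unit vector \<open>e\<close>.\<close>

definition mag_deriv ::
  "real \<Rightarrow> real^2 \<Rightarrow> (real^2 \<Rightarrow> complex) \<Rightarrow> (real^2 \<Rightarrow> complex)" where
  "mag_deriv b e u x =
     - \<i> * weak_deriv disk e u x + of_real (b * (magA x \<bullet> e)) * u x"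

text \<open>The sesquilinear form whose diagonal values are \<open>q\<^sub>b[u] = \<integral> |(-i\<nabla> + b A) u|\<^sup>2\<close>.\<close>

definition mag_form ::
  "real \<Rightarrow> (real^2 \<Rightarrow> complex) \<Rightarrow> (real^2 \<Rightarrow> complex) \<Rightarrow> complex" where
  "mag_form b u v =
     (LINT x|lebesgue_on disk. (\<Sum>e\<in>Basis. mag_deriv b e u x * cnj (mag_deriv b e v x)))"

definition mag_laplacian ::
  "real \<Rightarrow> ((real^2 \<Rightarrow> complex) \<times> (real^2 \<Rightarrow> complex)) set" where
  "mag_laplacian b = form_operator (lebesgue_on disk) (H1 disk) (mag_form b)"

definition ground_energy :: "real \<Rightarrow> real" where
  "ground_energy b =
     Inf {t::real. of_real t \<in> spectrum (lebesgue_on disk) (mag_laplacian b)}"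


section \<open>The radial operators\<close>

definition radial_measure :: "real measure" where
  "radial_measure = density (lebesgue_on {0<..<1}) (\<lambda>r. ennreal r)"

definition radial_potential :: "nat \<Rightarrow> real \<Rightarrow> real \<Rightarrow> real" where
  "radial_potential n b r = (real n / r - b / 2 * r)\<^sup>2"

text \<open>
  Both terms of \<open>q\<^sub>n\<^sub>,\<^sub>b[f]\<close> are nonnegative, so it is finite iff each of them is.
\<close>

definition radial_form_domain :: "nat \<Rightarrow> real \<Rightarrow> (real \<Rightarrow> complex) set" where
  "radial_form_domain n b =
     {f \<in> L2 radial_measure.
        (\<exists>g\<in>L2 radial_measure. has_weak_deriv {0<..<1} 1 f g) \<and>
        integrable radial_measure (\<lambda>r. radial_potential n b r * (cmod (f r))\<^sup>2)}"

definition radial_form ::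
  "nat \<Rightarrow> real \<Rightarrow> (real \<Rightarrow> complex) \<Rightarrow> (real \<Rightarrow> complex) \<Rightarrow> complex" where
  "radial_form n b f h =
     (LINT r|radial_measure.
        (weak_deriv {0<..<1} 1 f r * cnj (weak_deriv {0<..<1} 1 h r)
         + of_real (radial_potential n b r) * (f r * cnj (h r))))"

definition radial_operator ::
  "nat \<Rightarrow> real \<Rightarrow> ((real \<Rightarrow> complex) \<times> (real \<Rightarrow> complex)) set" where
  "radial_operator n b =
     form_operator radial_measure (radial_form_domain n b) (radial_form n b)"

definition radial_eigenvalue :: "nat \<Rightarrow> real \<Rightarrow> real" where
  "radial_eigenvalue n b =
     (LEAST t::real. is_eigenvalue radial_measure (radial_operator n b) (of_real t))"

end

theory Submission
  imports Defs
begin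

text \<open>
  Put \<open>x = b r\<^sup>2 / 2\<close> and \<open>\<lambda> = b \<eta>\<close>. The solution of the radial equation
  \<open>-(r f')' / r + (n/r - b r/2)\<^sup>2 f = \<lambda> f\<close> that is regular at \<open>0\<close> is
  \<open>f\<^sub>n(r) = r^n exp(-x/2) M((1 - \<eta>)/2, n + 1, x)\<close> with Kummer's series \<open>M\<close>. For \<open>\<eta> \<le> 1\<close> the
  coefficients of \<open>M\<close> are nonnegative, so \<open>f\<^sub>n > 0\<close>, and if moreover \<open>f\<^sub>n'(1) = 0\<close>, then \<open>f\<^sub>n\<close> is a
  ground state and \<open>b \<eta>\<close> is the lowest eigenvalue of the \<open>n\<close>-th radial operator
  (\<open>radial_eigenvalue_eqI\<close>).

  The first parameter of \<open>M\<close> does not depend on \<open>n\<close>, so the contiguous relations of Kummer's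
  function (\<open>kummer_raise\<close>, \<open>kummer_lower\<close>) express \<open>f\<^sub>n\<^sub>+\<^sub>1\<close> through \<open>f\<^sub>n\<close> and \<open>f\<^sub>n'\<close>. They show
  that on the curve \<open>2 x \<eta> = (x - n) (x - n - 1)\<close>, where \<open>x = b/2\<close>, the Neumann condition for
  \<open>f\<^sub>n\<close> implies that for \<open>f\<^sub>n\<^sub>+\<^sub>1\<close> (\<open>neumann_defect_ladder\<close>). Let \<open>x\<^sub>n(\<eta>)\<close> be the larger
  solution \<open>x\<close>. If \<open>f\<^sub>n\<close> satisfies the Neumann condition for \<open>0 \<le> \<eta> < 1\<close> and \<open>b = 2 x\<^sub>n(\<eta>)\<close>, then the
  branches \<open>n\<close> and \<open>n + 1\<close> meet at \<open>b\<close> with common value \<open>b \<eta>\<close>; as they meet only at \<open>\<beta>\<^sub>n\<close>, this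
  gives \<open>\<beta>\<^sub>n = 2 x\<^sub>n(\<eta>)\<close> and \<open>\<lambda>(\<beta>\<^sub>n) / \<beta>\<^sub>n = \<eta>\<close>.

  It remains to produce, from such an \<open>\<eta>\<close> for \<open>n\<close>, a larger one for \<open>m = n + 1\<close>. With \<open>\<eta>\<close> fixed,
  the logarithmic derivative \<open>z = r f\<^sub>m' / f\<^sub>m\<close> solves the Riccati equation
  \<open>2 x z' = (x - m)\<^sup>2 - 2 \<eta> x - z\<^sup>2\<close> in the variable \<open>x\<close>. It vanishes at \<open>x\<^sub>n(\<eta>)\<close> by the ladder, and
  the point is that it is positive at \<open>x\<^sub>m(\<eta>)\<close>. For large \<open>n\<close> the contributions of
  \<open>((x - m)\<^sup>2 - 2 \<eta> x) / (2 x)\<close> on this interval cancel to leading order, so the sign is a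
  second-order effect; it is captured by comparing \<open>z\<close> with the quadratic polynomial that vanishes
  at both points and has a suitable leading coefficient, which is a strict subsolution
  (\<open>subsolution_defect_pos\<close>, \<open>neumann_defect_pos_at_next_crossing\<close>). For \<open>\<eta> = 1\<close> the series \<open>M\<close> is
  constant and \<open>z = m - x < 0\<close> at \<open>x = x\<^sub>m(1)\<close>. The intermediate value theorem along the curve yields
  the larger \<open>\<eta>\<close>. For \<open>n = 0\<close> a first \<open>\<eta>\<close> is found in the same way, starting from \<open>\<eta> = 0\<close>.

  The identification of the lowest eigenvalue has to deal with an operator given by a form and by
  weak derivatives. Every pairing needed is a pairing of a form-domain element with an explicit
  \<open>C\<^sup>1\<close> function that satisfies the Neumann condition, and one integration by parts serves them all
  (\<open>neumann_regular_parts\<close>): cutting off the explicit function near both ends makes the boundary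
  terms vanish by dominated convergence, and boundary values of form-domain elements never enter. To
  exclude an eigenvalue \<open>s\<close> below \<open>t = b \<eta>\<close>, the inhomogeneous Neumann problem at \<open>s\<close> is solved for
  all bump functions; an eigenfunction would be orthogonal to all of them
  (\<open>not_eigenvalue_if_solvable\<close>, \<open>inhomogeneous_solution\<close>).
\<close>

section \<open>Kummer's series and its contiguous relations\<close>

lemma continuous_on_Icc_bounded:
  fixes f :: "real \<Rightarrow> real"
  assumes "continuous_on {a..b} f"
  obtains B where "\<And>x. x \<in> {a..b} \<Longrightarrow> \<bar>f x\<bar> \<le> B"
  using compact_imp_bounded[OF compact_continuous_image[OF assms compact_Icc]]
  unfolding bounded_iff real_norm_def by blast

definition kummer_coeff :: "real \<Rightarrow> real \<Rightarrow> nat \<Rightarrow> real" where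
  "kummer_coeff a c k = pochhammer a k / (pochhammer c k * fact k)"

definition kummer :: "real \<Rightarrow> real \<Rightarrow> real \<Rightarrow> real" where
  "kummer a c x = (\<Sum>k. kummer_coeff a c k * x ^ k)"

lemma pochhammer_ge_1_pos: "c \<ge> 1 \<Longrightarrow> pochhammer c k > (0::real)"
  by (rule pochhammer_pos) simp

lemma kummer_coeff_Suc:
  assumes "c \<ge> 1"
  shows "kummer_coeff a c (Suc k) = kummer_coeff a c k * ((a + k) / ((c + k) * (k + 1)))"
  using pochhammer_ge_1_pos[OF assms, of k]
  by (simp add: kummer_coeff_def pochhammer_Suc field_simps)

text \<open>
  Domination by the exponential series, uniformly for bounded \<open>a\<close>: this gives convergence
  everywhere as well as joint continuity in the parameter and the variable.
\<close>

lemma kummer_coeff_bound: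
  assumes "c \<ge> 1"
  shows "\<bar>kummer_coeff a c k\<bar> \<le> (\<bar>a\<bar> + 1) ^ k / fact k"
proof (induction k)
  case (Suc k)
  have "\<bar>a + k\<bar> \<le> (\<bar>a\<bar> + 1) * (c + k)"
  proof -
    have "\<bar>a\<bar> * 1 \<le> \<bar>a\<bar> * (c + k)" by (rule mult_left_mono) (use assms in auto)
    then show ?thesis using assms by (auto simp: algebra_simps)
  qed
  then have "\<bar>a + k\<bar> / (c + k) \<le> \<bar>a\<bar> + 1"
    using assms by (subst pos_divide_le_eq) auto
  then have "\<bar>a + k\<bar> / (c + k) / (k + 1) \<le> (\<bar>a\<bar> + 1) / (k + 1)"
    by (rule divide_right_mono) simp
  then have *: "\<bar>(a + k) / ((c + k) * (k + 1))\<bar> \<le> (\<bar>a\<bar> + 1) / (k + 1)"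
    using assms by (simp add: abs_mult)
  have "\<bar>kummer_coeff a c (Suc k)\<bar> = \<bar>kummer_coeff a c k\<bar> * \<bar>(a + k) / ((c + k) * (k + 1))\<bar>"
    by (simp only: kummer_coeff_Suc[OF assms] abs_mult)
  also have "\<dots> \<le> (\<bar>a\<bar> + 1) ^ k / fact k * ((\<bar>a\<bar> + 1) / (k + 1))"
    by (rule mult_mono[OF Suc *]) auto
  also have "\<dots> = (\<bar>a\<bar> + 1) ^ Suc k / fact (Suc k)"
    by (simp add: field_simps)
  finally show ?case .
qed (simp add: kummer_coeff_def)

lemma summable_exp_real: "summable (\<lambda>k. (y::real) ^ k / fact k)"
  using summable_exp[of y] by (simp add: field_simps)

lemma kummer_summable:
  assumes "c \<ge> 1"
  shows "summable (\<lambda>k. kummer_coeff a c k * x ^ k)"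
proof (rule summable_comparison_test'[OF summable_exp_real[of "(\<bar>a\<bar> + 1) * \<bar>x\<bar>"]])
  fix k
  show "norm (kummer_coeff a c k * x ^ k) \<le> ((\<bar>a\<bar> + 1) * \<bar>x\<bar>) ^ k / fact k"
    using mult_right_mono[OF kummer_coeff_bound[OF assms, of a k], of "\<bar>x\<bar> ^ k"]
    by (simp add: abs_mult power_abs power_mult_distrib)
qed

text \<open>
  The Neumann condition is followed along a curve on which \<open>a\<close> and \<open>x\<close> move together, so
  continuity in each variable separately would not be enough.
\<close>

lemma continuous_on_kummer:
  assumes "c \<ge> 1" and f: "continuous_on {s..t::real} f" and g: "continuous_on {s..t} g"
  shows "continuous_on {s..t} (\<lambda>x. kummer (f x) c (g x))"
proof -
  obtain A where A: "\<And>x. x \<in> {s..t} \<Longrightarrow> \<bar>f x\<bar> \<le> A"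
    using continuous_on_Icc_bounded[OF f] by blast
  obtain B where B: "\<And>x. x \<in> {s..t} \<Longrightarrow> \<bar>g x\<bar> \<le> B"
    using continuous_on_Icc_bounded[OF g] by blast
  have "uniform_limit {s..t} (\<lambda>n x. \<Sum>k<n. kummer_coeff (f x) c k * g x ^ k)
          (\<lambda>x. \<Sum>k. kummer_coeff (f x) c k * g x ^ k) sequentially"
  proof (rule Weierstrass_m_test[OF _ summable_exp_real[of "(A + 1) * B"]])
    fix k x assume x: "x \<in> {s..t}"
    have "norm (kummer_coeff (f x) c k * g x ^ k) = \<bar>kummer_coeff (f x) c k\<bar> * \<bar>g x\<bar> ^ k"
      by (simp add: abs_mult power_abs)
    also have "\<dots> \<le> (\<bar>f x\<bar> + 1) ^ k / fact k * \<bar>g x\<bar> ^ k"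
      by (rule mult_right_mono[OF kummer_coeff_bound[OF assms(1)]]) simp
    also have "\<dots> \<le> (A + 1) ^ k / fact k * B ^ k"
      using A[OF x] B[OF x] by (intro mult_mono divide_right_mono power_mono) auto
    finally show "norm (kummer_coeff (f x) c k * g x ^ k) \<le> ((A + 1) * B) ^ k / fact k"
      by (simp add: power_mult_distrib)
  qed
  then show ?thesis
    unfolding kummer_def
  proof (rule uniform_limit_theorem[rotated])
    have "pochhammer c k \<noteq> 0" for k using pochhammer_ge_1_pos[OF assms(1), of k] by simp
    then show "\<forall>\<^sub>F n in sequentially. continuous_on {s..t} (\<lambda>x. \<Sum>k<n. kummer_coeff (f x) c k * g x ^ k)"
      unfolding kummer_coeff_def pochhammer_prod
      by (intro always_eventually allI continuous_intros f g) (auto simp: pochhammer_prod)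
  qed simp
qed

lemma kummer_0_left [simp]: "kummer 0 c x = 1"
proof -
  have "(\<lambda>k. kummer_coeff 0 c k * x ^ k) = (\<lambda>k. if k = 0 then 1 else 0)"
    by (auto simp: kummer_coeff_def pochhammer_0_left)
  moreover have "(\<Sum>k. if k = 0 then 1 else 0) = (1::real)"
    by (subst suminf_finite[of "{0}"]) auto
  ultimately show ?thesis by (simp add: kummer_def)
qed

lemma kummer_pos:
  assumes "a \<ge> 0" "c \<ge> 1" "x \<ge> 0"
  shows "kummer a c x > 0"
  unfolding kummer_def
proof (rule suminf_pos2[where i = 0, OF kummer_summable[OF assms(2)]])
  show "0 \<le> kummer_coeff a c k * x ^ k" for k
    using assms pochhammer_ge_1_pos[OF assms(2), of k] pochhammer_nonneg[of a k]
    by (cases "a = 0") (auto simp: kummer_coeff_def pochhammer_0_left)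
qed (simp add: kummer_coeff_def)

lemma kummer_coeff_shift:
  assumes "c \<ge> 1"
  shows "real (Suc k) * kummer_coeff a c (Suc k) = a / c * kummer_coeff (a + 1) (c + 1) k"
proof -
  have "pochhammer (c + 1) k > 0" using pochhammer_ge_1_pos[of "c+1" k] assms by simp
  then have "real (Suc k) * (a * p / (c * pochhammer (c + 1) k * (real (Suc k) * fact k)))
      = a / c * (p / (pochhammer (c + 1) k * fact k))" for p
    using assms by (simp del: of_nat_Suc)
  then show ?thesis by (simp add: kummer_coeff_def pochhammer_rec del: of_nat_Suc)
qed

lemma kummer_deriv:
  assumes "c \<ge> 1"
  shows "(kummer a c has_real_derivative a / c * kummer (a + 1) (c + 1) x) (at x)"
proof -
  have "((\<lambda>x. \<Sum>k. kummer_coeff a c k * x ^ k) has_field_derivative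
          (\<Sum>k. diffs (kummer_coeff a c) k * x ^ k)) (at x)"
    using kummer_summable[OF assms] by (intro termdiffs_strong_converges_everywhere) auto
  also have "(\<Sum>k. diffs (kummer_coeff a c) k * x ^ k) = (\<Sum>k. a / c * (kummer_coeff (a + 1) (c + 1) k * x ^ k))"
    by (simp only: diffs_def kummer_coeff_shift[OF assms] mult.assoc)
  also have "\<dots> = a / c * kummer (a + 1) (c + 1) x"
    unfolding kummer_def by (rule suminf_mult) (use kummer_summable assms in auto)
  finally show ?thesis by (simp add: kummer_def[abs_def])
qed

text \<open>
  The derivative of Kummer's series, in its closed form.
\<close>

definition kummer' :: "real \<Rightarrow> real \<Rightarrow> real \<Rightarrow> real" where
  "kummer' a c x = a / c * kummer (a + 1) (c + 1) x"

lemma kummer_has_deriv: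
  assumes "c \<ge> 1"
  shows "(kummer a c has_real_derivative kummer' a c x) (at x)"
  using kummer_deriv[OF assms] by (simp add: kummer'_def)

text \<open>
  Equality of coefficients. Together with \<open>kummer_lower\<close> this is a first-order system for
  \<open>M(a, c, x)\<close> and \<open>M(a, c + 1, x)\<close>: the ladder that connects angular momentum \<open>n\<close> with \<open>n + 1\<close> at
  the same energy.
\<close>

lemma kummer_raise:
  assumes "c \<ge> 1"
  shows "c * (kummer a c x - kummer' a c x) = (c - a) * kummer a (c + 1) x"
proof -
  have c: "c * kummer_coeff a c k - a * kummer_coeff (a + 1) (c + 1) k = (c - a) * kummer_coeff a (c + 1) k" for k
  proof -
    have p: "pochhammer (c + 1) k > 0" "pochhammer c k > 0"
      using assms by (auto intro: pochhammer_pos)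
    have 1: "c * pochhammer (c + 1) k = pochhammer c k * (c + k)"
      by (simp flip: pochhammer_rec add: pochhammer_Suc)
    have 2: "a * pochhammer (a + 1) k = pochhammer a k * (a + k)"
      by (simp flip: pochhammer_rec add: pochhammer_Suc)
    have 3: "c / pochhammer c k = (c + k) / pochhammer (c + 1) k"
      using 1 p by (simp add: field_simps)
    have "c * kummer_coeff a c k - a * kummer_coeff (a + 1) (c + 1) k
       = (pochhammer a k * (c / pochhammer c k) - a * pochhammer (a + 1) k / pochhammer (c + 1) k) / fact k"
      by (simp add: kummer_coeff_def diff_divide_distrib mult_ac)
    also have "\<dots> = ((c + k) - (a + k)) * pochhammer a k / pochhammer (c + 1) k / fact k"
      unfolding 2 3 by (simp only: diff_divide_distrib left_diff_distrib) (simp add: mult_ac)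
    also have "\<dots> = (c - a) * kummer_coeff a (c + 1) k"
      by (simp add: kummer_coeff_def)
    finally show ?thesis .
  qed
  have "(\<lambda>k. c * (kummer_coeff a c k * x ^ k) - a * (kummer_coeff (a + 1) (c + 1) k * x ^ k))
     sums (c * kummer a c x - a * kummer (a + 1) (c + 1) x)"
    unfolding kummer_def using assms
    by (intro sums_diff sums_mult summable_sums kummer_summable) auto
  also have "(\<lambda>k. c * (kummer_coeff a c k * x ^ k) - a * (kummer_coeff (a + 1) (c + 1) k * x ^ k))
     = (\<lambda>k. (c - a) * (kummer_coeff a (c + 1) k * x ^ k))"
  proof
    fix k
    have "c * (kummer_coeff a c k * x ^ k) - a * (kummer_coeff (a + 1) (c + 1) k * x ^ k)
        = (c * kummer_coeff a c k - a * kummer_coeff (a + 1) (c + 1) k) * x ^ k" by (simp add: left_diff_distrib)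
    then show "c * (kummer_coeff a c k * x ^ k) - a * (kummer_coeff (a + 1) (c + 1) k * x ^ k)
        = (c - a) * (kummer_coeff a (c + 1) k * x ^ k)" unfolding c by simp
  qed
  finally have "(\<lambda>k. (c - a) * (kummer_coeff a (c + 1) k * x ^ k)) sums (c * kummer a c x - a * kummer (a + 1) (c + 1) x)" .
  moreover have "(\<lambda>k. (c - a) * (kummer_coeff a (c + 1) k * x ^ k)) sums ((c - a) * kummer a (c + 1) x)"
    unfolding kummer_def using assms by (intro sums_mult summable_sums kummer_summable) auto
  ultimately have "c * kummer a c x - a * kummer (a + 1) (c + 1) x = (c - a) * kummer a (c + 1) x"
    by (rule sums_unique2)
  then show ?thesis using assms by (simp add: kummer'_def right_diff_distrib)
qed

lemma kummer_lower:
  assumes "c \<ge> 1"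
  shows "x * kummer' a (c + 1) x + c * kummer a (c + 1) x = c * kummer a c x"
proof -
  have cf: "(real k + c) * kummer_coeff a (c + 1) k = c * kummer_coeff a c k" for k
  proof -
    have p: "pochhammer (c + 1) k > 0" "pochhammer c k > 0"
      using assms by (auto intro: pochhammer_pos)
    have 1: "c * pochhammer (c + 1) k = pochhammer c k * (c + k)"
      by (simp flip: pochhammer_rec add: pochhammer_Suc)
    have 3: "c / pochhammer c k = (c + k) / pochhammer (c + 1) k"
      using 1 p by (simp add: field_simps)
    have "c * kummer_coeff a c k = pochhammer a k * (c / pochhammer c k) / fact k"
      by (simp add: kummer_coeff_def)
    then show ?thesis unfolding 3 by (simp add: kummer_coeff_def field_simps)
  qed
  have c1: "c + 1 \<ge> 1" using assms by simp
  have "(\<lambda>k. a / (c + 1) * (kummer_coeff (a + 1) (c + 1 + 1) k * x ^ k)) sums kummer' a (c + 1) x"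
    unfolding kummer'_def kummer_def using assms
    by (intro sums_mult summable_sums kummer_summable) auto
  then have "(\<lambda>k. x * (a / (c + 1) * (kummer_coeff (a + 1) (c + 1 + 1) k * x ^ k))) sums (x * kummer' a (c + 1) x)"
    by (rule sums_mult)
  then have "(\<lambda>k. real (Suc k) * kummer_coeff a (c + 1) (Suc k) * x ^ Suc k) sums (x * kummer' a (c + 1) x)"
    by (simp only: kummer_coeff_shift[OF c1]) (simp add: mult_ac)
  then have 1: "(\<lambda>k. real k * kummer_coeff a (c + 1) k * x ^ k) sums (x * kummer' a (c + 1) x)"
    by (subst (asm) sums_Suc_iff) simp
  have 2: "(\<lambda>k. c * (kummer_coeff a (c + 1) k * x ^ k)) sums (c * kummer a (c + 1) x)"
    unfolding kummer_def using assms by (intro sums_mult summable_sums kummer_summable) auto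
  have "(\<lambda>k. (real k + c) * kummer_coeff a (c + 1) k * x ^ k)
     sums (x * kummer' a (c + 1) x + c * kummer a (c + 1) x)"
    using sums_add[OF 1 2] by (simp add: algebra_simps)
  moreover have "(\<lambda>k. (c * kummer_coeff a c k) * x ^ k) sums (c * kummer a c x)"
    unfolding kummer_def mult.assoc using assms by (intro sums_mult summable_sums kummer_summable) auto
  ultimately show ?thesis unfolding cf by (rule sums_unique2)
qed

text \<open>
  Kummer's differential equation is obtained by eliminating \<open>M(a, c + 1, x)\<close> from the two
  contiguous relations.
\<close>

lemma kummer'_has_deriv:
  assumes "c \<ge> 1"
  shows "\<exists>K''. (kummer' a c has_real_derivative K'') (at x) \<and>
           x * K'' = a * kummer a c x - (c - x) * kummer' a c x"
proof -
  define K'' where "K'' = a / c * kummer' (a + 1) (c + 1) x"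
  have d: "(kummer' a c has_real_derivative K'') (at x)"
    unfolding kummer'_def[abs_def] K''_def using kummer_has_deriv[of "c + 1" "a + 1" x] assms
    by (intro DERIV_cmult) (simp add: kummer'_def)
  have "((\<lambda>x. c * (kummer a c x - kummer' a c x)) has_real_derivative c * (kummer' a c x - K'')) (at x)"
    by (intro DERIV_cmult DERIV_diff d kummer_has_deriv assms)
  moreover have "((\<lambda>x. (c - a) * kummer a (c + 1) x) has_real_derivative (c - a) * kummer' a (c + 1) x) (at x)"
    using assms by (intro DERIV_cmult kummer_has_deriv) auto
  ultimately have e: "c * (kummer' a c x - K'') = (c - a) * kummer' a (c + 1) x"
    unfolding kummer_raise[OF assms] by (rule DERIV_unique)
  have "c * (x * K'') = c * (a * kummer a c x - (c - x) * kummer' a c x)"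
    using e kummer_raise[OF assms, of a x] kummer_lower[OF assms, of x a] by algebra
  then have "x * K'' = a * kummer a c x - (c - x) * kummer' a c x" using assms by simp
  with d show ?thesis by blast
qed

section \<open>The regular solution and its Neumann condition\<close>

text \<open>
  The factor of the regular solution that remains after \<open>r^n exp(-x/2)\<close> has been split off, as a
  function of \<open>x = b r\<^sup>2 / 2\<close>.
\<close>

definition branch :: "nat \<Rightarrow> real \<Rightarrow> real \<Rightarrow> real" where
  "branch n \<eta> = kummer ((1 - \<eta>) / 2) (real n + 1)"

definition branch' :: "nat \<Rightarrow> real \<Rightarrow> real \<Rightarrow> real" where
  "branch' n \<eta> = kummer' ((1 - \<eta>) / 2) (real n + 1)"

text \<open>
  For \<open>f(r) = r^n exp(-x/2) branch n \<eta> x\<close> with \<open>x = b r\<^sup>2 / 2\<close>, one has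
  \<open>r f'(r) = r^n exp(-x/2) neumann_defect n \<eta> x\<close>; so the Neumann condition at \<open>r = 1\<close> is the vanishing
  of this function at \<open>x = b/2\<close>.
\<close>

definition neumann_defect :: "nat \<Rightarrow> real \<Rightarrow> real \<Rightarrow> real" where
  "neumann_defect n \<eta> x = (real n - x) * branch n \<eta> x + 2 * x * branch' n \<eta> x"

lemma branch_pos: "\<eta> \<le> 1 \<Longrightarrow> x \<ge> 0 \<Longrightarrow> branch n \<eta> x > 0"
  unfolding branch_def by (rule kummer_pos) auto

lemma branch_deriv: "(branch n \<eta> has_real_derivative branch' n \<eta> x) (at x)"
  unfolding branch_def branch'_def by (rule kummer_has_deriv) auto

lemma neumann_defect_deriv:
  "(neumann_defect n \<eta> has_real_derivative (x - n) * branch' n \<eta> x - \<eta> * branch n \<eta> x) (at x)"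
proof -
  let ?a = "(1 - \<eta>) / 2" and ?c = "real n + 1"
  obtain K'' where d: "(branch' n \<eta> has_real_derivative K'') (at x)"
    and e: "x * K'' = ?a * branch n \<eta> x - (?c - x) * branch' n \<eta> x"
    using kummer'_has_deriv[of ?c ?a x] unfolding branch_def branch'_def by auto
  have "((\<lambda>x. (real n - x) * branch n \<eta> x + 2 * x * branch' n \<eta> x) has_real_derivative
     (- branch n \<eta> x + (real n - x) * branch' n \<eta> x + (2 * branch' n \<eta> x + 2 * (x * K'')))) (at x)"
    by (auto intro!: derivative_eq_intros branch_deriv d simp: algebra_simps)
  then show ?thesis unfolding neumann_defect_def[abs_def] e
    by (rule DERIV_cong) (simp add: field_simps)
qed

lemma continuous_on_neumann_defect:
  assumes "continuous_on {s..t::real} g" "continuous_on {s..t} f"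
  shows "continuous_on {s..t} (\<lambda>x. neumann_defect n (f x) (g x))"
  unfolding neumann_defect_def branch_def branch'_def kummer'_def
  by (intro continuous_intros continuous_on_kummer assms) auto

text \<open>
  The two contiguous relations give \<open>f\<^sub>n\<^sub>+\<^sub>1\<close> and \<open>f\<^sub>n\<^sub>+\<^sub>1'\<close> at \<open>x\<close> as multiples of \<open>f\<^sub>n\<close> once \<open>f\<^sub>n' = 0\<close>
  there; the equation of the curve says exactly that the multiple for \<open>f\<^sub>n\<^sub>+\<^sub>1'\<close> is zero.
\<close>

lemma neumann_defect_ladder:
  assumes "neumann_defect n \<eta> x = 0" "2 * x * \<eta> = (x - n) * (x - n - 1)" "x > 0" "\<eta> \<le> 1"
  shows "neumann_defect (Suc n) \<eta> x = 0"
proof -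
  let ?a = "(1 - \<eta>) / 2" and ?c = "real n + 1"
  have K1: "kummer ?a (?c + 1) x = branch (Suc n) \<eta> x" "kummer' ?a (?c + 1) x = branch' (Suc n) \<eta> x"
    by (simp_all add: branch_def branch'_def add_ac)
  have r: "?c * (branch n \<eta> x - branch' n \<eta> x) = (?c - ?a) * branch (Suc n) \<eta> x"
    using kummer_raise[of ?c ?a x] K1 by (simp add: branch_def branch'_def)
  have l: "x * branch' (Suc n) \<eta> x + ?c * branch (Suc n) \<eta> x = ?c * branch n \<eta> x"
    using kummer_lower[of ?c x ?a] K1 by (simp add: branch_def branch'_def)
  have n: "(real n - x) * branch n \<eta> x + 2 * x * branch' n \<eta> x = 0"
    using assms(1) by (simp add: neumann_defect_def)
  have m: "neumann_defect (Suc n) \<eta> x = 2 * ?c * branch n \<eta> x - (?c + x) * branch (Suc n) \<eta> x"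
    using l by (simp add: neumann_defect_def algebra_simps)
  have 1: "2 * x * (?c - ?a) * branch (Suc n) \<eta> x = ?c * ((x + n) * branch n \<eta> x)"
    using r n by algebra
  have 2: "4 * x * (?c - ?a) = (x + n) * (?c + x)"
    using assms(2) by (simp add: field_simps)
  have "(x + n) * neumann_defect (Suc n) \<eta> x = 0"
    unfolding m using 1 2 by algebra
  then show ?thesis using assms(3) by auto
qed

section \<open>Crossings of consecutive branches\<close>

text \<open>
  The larger root \<open>x\<close> of \<open>2 x \<eta> = (x - n) (x - n - 1)\<close>.
\<close>

definition crossing :: "nat \<Rightarrow> real \<Rightarrow> real" where
  "crossing n \<eta> = real n + 1/2 + \<eta> + sqrt (1/4 + (2 * real n + 1) * \<eta> + \<eta>\<^sup>2)"

lemma crossing_eq: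
  assumes "\<eta> \<ge> 0"
  shows "2 * crossing n \<eta> * \<eta> = (crossing n \<eta> - n) * (crossing n \<eta> - n - 1)"
proof -
  have "(crossing n \<eta> - real n - 1/2 - \<eta>)\<^sup>2 = 1/4 + (2 * real n + 1) * \<eta> + \<eta>\<^sup>2"
    using assms by (simp add: crossing_def)
  then show ?thesis by (simp add: power2_eq_square algebra_simps)
qed

lemma crossing_ge:
  assumes "\<eta> \<ge> 0"
  shows "crossing n \<eta> \<ge> real n + 1 + 2 * \<eta>"
proof -
  have "1/2 + \<eta> \<le> sqrt (1/4 + (2 * real n + 1) * \<eta> + \<eta>\<^sup>2)"
    using assms by (intro real_le_rsqrt) (simp add: power2_eq_square algebra_simps)
  then show ?thesis by (simp add: crossing_def)
qed

lemma crossing_Suc_gt: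
  assumes "\<eta> \<ge> 0"
  shows "crossing n \<eta> < crossing (Suc n) \<eta>"
proof -
  have "sqrt (1/4 + (2 * real n + 1) * \<eta> + \<eta>\<^sup>2) \<le> sqrt (1/4 + (2 * real (Suc n) + 1) * \<eta> + \<eta>\<^sup>2)"
    using assms by (intro real_sqrt_le_mono) (simp add: algebra_simps)
  then show ?thesis unfolding crossing_def by linarith
qed

text \<open>
  The polynomial \<open>w(x) = l (x - x0) (x - x1)\<close> is a strict subsolution of
  \<open>2 x z' = (x - m)\<^sup>2 - 2 \<eta> x - z\<^sup>2\<close> between two consecutive crossings. The value of \<open>l\<close> is chosen to
  make the defect even in \<open>v = x - s\<close>, where \<open>s\<close> is the midpoint; it then depends only on
  \<open>p = d\<^sup>2/4 - v\<^sup>2\<close>, and it is concave in \<open>p\<close>.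
\<close>

lemma subsolution_defect_pos:
  fixes x0 x1 m \<eta> s d l x :: real
  assumes eta: "0 \<le> \<eta>" "\<eta> \<le> 1" and m: "m \<ge> 1"
    and x0: "2 * x0 * \<eta> = (x0 - m) * (x0 - m + 1)" "x0 \<ge> m + 2 * \<eta>"
    and x1: "2 * x1 * \<eta> = (x1 - m) * (x1 - m - 1)" "x1 \<ge> m + 1 + 2 * \<eta>"
    and less: "x0 < x1"
    and s: "s = (x0 + x1) / 2" and d: "d = x1 - x0" and l: "l = (s - m) / (2 * s * d)"
    and x: "x0 \<le> x" "x \<le> x1"
  shows "(x - m)\<^sup>2 - 2 * \<eta> * x - 2 * x * (l * (2 * x - x0 - x1))
           - (l * (x - x0) * (x - x1))\<^sup>2 > 0"
proof -
  have xs: "x0 = s - d / 2" "x1 = s + d / 2" using s d by (auto simp: field_simps)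
  define v where "v = x - s"
  define p where "p = d\<^sup>2 / 4 - v\<^sup>2"
  have dpos: "d > 0" using less d by simp
  have spos: "s > 0" using x0 x1 s m eta by auto
  have sm: "s - m \<ge> 1/2 + 2 * \<eta>" using x0 x1 s by auto
  \<comment> \<open>Difference and sum of the two crossing equations.\<close>
  have rel1: "d * (s - m - \<eta>) = s - m"
    using x0(1) x1(1) unfolding xs by (simp add: field_simps)
  have rel2: "(s - m)\<^sup>2 - 2 * \<eta> * s = d / 2 - d\<^sup>2 / 4"
    using x0(1) x1(1) unfolding xs by (simp add: field_simps power2_eq_square)
  have d53: "d \<le> 5/3"
  proof -
    \<comment> \<open>Here \<open>s - m \<ge> 1/2 + 2 \<eta> \<ge> 5/2 \<eta>\<close>, where the last inequality is \<open>\<eta> \<le> 1\<close>.\<close>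
    have "d * (s - m - \<eta>) \<le> 5/3 * (s - m - \<eta>)" unfolding rel1 using sm eta by simp
    then show ?thesis using sm eta by (subst (asm) mult_le_cancel_right) auto
  qed
  have ld: "l * d = (s - m) / (2 * s)" using dpos l by simp
  have ld2: "0 \<le> l * d" "l * d < 1/2"
    unfolding ld using sm spos m eta by (auto simp: field_simps)
  have lsd: "2 * l * s * d = s - m" using ld spos by (simp add: field_simps)
  have pr: "0 \<le> p" "p \<le> d\<^sup>2 / 4"
  proof -
    have "(d/2 - v) * (d/2 + v) \<ge> 0" using x unfolding xs v_def by (intro mult_nonneg_nonneg) auto
    then show "0 \<le> p" by (simp add: p_def power2_eq_square algebra_simps)
    show "p \<le> d\<^sup>2 / 4" by (simp add: p_def)
  qed
  have lin: "(s - m - \<eta>) - 2 * l * s = 0"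
  proof -
    have "d * ((s - m - \<eta>) - 2 * l * s) = 0" using rel1 lsd by (simp add: algebra_simps)
    then show ?thesis using dpos by simp
  qed
  have "(x - m)\<^sup>2 - 2 * \<eta> * x - 2 * x * (l * (2 * x - x0 - x1)) - (l * (x - x0) * (x - x1))\<^sup>2
      = ((s - m)\<^sup>2 - 2 * \<eta> * s) + 2 * ((s - m - \<eta>) - 2 * l * s) * v + (1 - 4 * l) * v\<^sup>2 - (l * p)\<^sup>2"
    unfolding p_def v_def xs by (simp add: power2_eq_square field_simps)
  also have "\<dots> = d / 2 - d * (l * d) - (1 - 4 * l) * p - (l * p)\<^sup>2"
    unfolding rel2 lin p_def by (simp add: power2_eq_square field_simps)
  also have "\<dots> > 0"
  proof -
    define q where "q = 4 * p / d\<^sup>2"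
    have q: "0 \<le> q" "q \<le> 1" using pr dpos by (auto simp: q_def field_simps)
    have p: "p = q * d\<^sup>2 / 4" using dpos by (simp add: q_def)
    define \<mu> where "\<mu> = l * d"
    have mu: "0 \<le> \<mu>" "\<mu> < 1/2" using ld2 by (auto simp: \<mu>_def)
    \<comment> \<open>Concavity of the defect in \<open>p\<close>: it dominates the interpolation between its values at
      \<open>p = 0\<close> and \<open>p = d\<^sup>2 / 4\<close>, and both are positive because \<open>l * d < 1/2\<close> and \<open>d \<le> 5/3\<close>.\<close>
    have eq: "d / 2 - d * (l * d) - (1 - 4 * l) * p - (l * p)\<^sup>2
       = d * ((1 - q) * (1/2 - \<mu>) + q * (1/2 - d / 4 - q * (\<mu>\<^sup>2 * d) / 16))"
      unfolding p \<mu>_def by (simp add: power2_eq_square field_simps)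
    have "\<mu>\<^sup>2 \<le> (1/2)\<^sup>2" using mu by (intro power_mono) auto
    then have "\<mu>\<^sup>2 * d \<le> (1/4) * (5/3)" using d53 dpos by (intro mult_mono) (auto simp: power2_eq_square)
    moreover have "q * (\<mu>\<^sup>2 * d) \<le> 1 * (\<mu>\<^sup>2 * d)" using q dpos by (intro mult_right_mono) auto
    ultimately have "1/2 - d / 4 - q * (\<mu>\<^sup>2 * d) / 16 > 0" using d53 by simp
    then have "(1 - q) * (1/2 - \<mu>) + q * (1/2 - d / 4 - q * (\<mu>\<^sup>2 * d) / 16) > 0"
      using q mu by (cases "q = 0") (auto intro!: add_nonneg_pos)
    then show ?thesis unfolding eq using dpos by simp
  qed
  finally show ?thesis .
qed

text \<open>
  The comparison of \<open>z = neumann_defect / branch\<close> with the subsolution \<open>w\<close>, written without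
  division: \<open>Y = neumann_defect - w * branch\<close> satisfies the linear equation
  \<open>2 x Y' = (x - m - w) Y + S * branch\<close> with \<open>S > 0\<close>, so \<open>E * Y\<close> increases for the integrating factor
  \<open>E\<close>. As \<open>w\<close> vanishes at both crossings, \<open>Y\<close> agrees there with \<open>neumann_defect\<close>.
\<close>

lemma neumann_defect_pos_at_next_crossing:
  assumes eta: "0 \<le> \<eta>" "\<eta> < 1" and z: "neumann_defect (Suc n) \<eta> (crossing n \<eta>) = 0"
  shows "neumann_defect (Suc n) \<eta> (crossing (Suc n) \<eta>) > 0"
proof -
  define m where "m = real (Suc n)"
  define x0 where "x0 = crossing n \<eta>"
  define x1 where "x1 = crossing (Suc n) \<eta>"
  define s where "s = (x0 + x1) / 2"
  define d where "d = x1 - x0"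
  define l where "l = (s - m) / (2 * s * d)"
  let ?K = "branch (Suc n) \<eta>" and ?K' = "branch' (Suc n) \<eta>" and ?N = "neumann_defect (Suc n) \<eta>"
  define w where "w = (\<lambda>x. l * (x - x0) * (x - x1))"
  define S where "S = (\<lambda>x. (x - m)\<^sup>2 - 2 * \<eta> * x - 2 * x * (l * (2 * x - x0 - x1)) - (w x)\<^sup>2)"
  have m1: "m \<ge> 1" by (simp add: m_def)
  have less: "x0 < x1" unfolding x0_def x1_def using crossing_Suc_gt eta by simp
  have x0ge: "x0 \<ge> m + 2 * \<eta>" using crossing_ge[of \<eta> n] eta by (simp add: x0_def m_def)
  have Spos: "S x > 0" if "x0 \<le> x" "x \<le> x1" for x
    unfolding S_def w_def
    using crossing_eq[of \<eta> n] crossing_ge[of \<eta> n] crossing_eq[of \<eta> "Suc n"] crossing_ge[of \<eta> "Suc n"] eta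
    by (intro subsolution_defect_pos[OF _ _ m1 _ x0ge _ _ less s_def d_def l_def that])
       (auto simp: x0_def x1_def m_def algebra_simps)
  define E where "E = (\<lambda>x. exp (- x / 2 + (m + l * x0 * x1) / 2 * ln x + l * (x\<^sup>2 / 2 - (x0 + x1) * x) / 2))"
  define Y where "Y = (\<lambda>x. ?N x - w x * ?K x)"
  have "E x0 * Y x0 < E x1 * Y x1"
  proof (rule DERIV_pos_imp_increasing[OF less])
    fix x assume x: "x0 \<le> x" "x \<le> x1"
    have xp: "x > 0" using x x0ge m1 eta by auto
    have dE: "(E has_real_derivative E x * (- (x - m - w x) / (2 * x))) (at x)"
      unfolding E_def w_def using xp
      by (auto intro!: derivative_eq_intros simp: field_simps power2_eq_square)
    have dY: "(Y has_real_derivative ((x - m) * ?K' x - \<eta> * ?K x)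
                - (l * (2 * x - x0 - x1) * ?K x + w x * ?K' x)) (at x)"
      unfolding Y_def w_def m_def
      by (auto intro!: derivative_eq_intros neumann_defect_deriv branch_deriv simp: algebra_simps)
    have dY2: "2 * x * (((x - m) * ?K' x - \<eta> * ?K x) - (l * (2 * x - x0 - x1) * ?K x + w x * ?K' x))
       = (x - m - w x) * Y x + S x * ?K x"
      unfolding Y_def S_def neumann_defect_def m_def by (simp add: power2_eq_square algebra_simps)
    have "((\<lambda>x. E x * Y x) has_real_derivative E x * (S x * ?K x) / (2 * x)) (at x)"
    proof (rule DERIV_cong[OF DERIV_mult[OF dE dY]])
      let ?D = "((x - m) * ?K' x - \<eta> * ?K x) - (l * (2 * x - x0 - x1) * ?K x + w x * ?K' x)"
      have D: "?D = ((x - m - w x) * Y x + S x * ?K x) / (2 * x)"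
        using dY2 xp by (simp only: dY2[symmetric]) simp
      show "E x * (- (x - m - w x) / (2 * x)) * Y x + ?D * E x = E x * (S x * ?K x) / (2 * x)"
        unfolding D using xp by (simp add: divide_simps) (simp add: algebra_simps)
    qed
    moreover have "E x * (S x * ?K x) / (2 * x) > 0"
      using Spos[OF x] xp branch_pos[of \<eta> x "Suc n"] eta by (simp add: E_def)
    ultimately show "\<exists>y. ((\<lambda>x. E x * Y x) has_real_derivative y) (at x) \<and> y > 0" by blast
  qed
  moreover have "Y x0 = 0" using z by (simp add: Y_def w_def x0_def)
  moreover have "Y x1 = ?N x1" by (simp add: Y_def w_def)
  ultimately show ?thesis by (simp add: E_def x1_def zero_less_mult_iff)
qed

text \<open>
  At \<open>\<eta> = 1\<close> the series is the constant \<open>1\<close>, and the crossing lies to the right of \<open>n\<close>.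
\<close>

lemma neumann_defect_crossing_1_neg: "neumann_defect n 1 (crossing n 1) < 0"
  using crossing_ge[of 1 n] by (simp add: neumann_defect_def branch_def branch'_def kummer'_def)

lemma neumann_defect_crossing_continuous: "continuous_on {s..t} (\<lambda>\<eta>. neumann_defect n \<eta> (crossing n \<eta>))"
  unfolding crossing_def by (intro continuous_on_neumann_defect continuous_intros)

lemma crossing_root:
  assumes "0 \<le> \<eta>0" "\<eta>0 < 1" "neumann_defect n \<eta>0 (crossing n \<eta>0) \<ge> 0"
  shows "\<exists>\<eta>\<ge>\<eta>0. \<eta> < 1 \<and> neumann_defect n \<eta> (crossing n \<eta>) = 0"
proof -
  obtain \<eta> where "\<eta>0 \<le> \<eta>" "\<eta> \<le> 1" "neumann_defect n \<eta> (crossing n \<eta>) = 0"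
    using IVT2'[of "\<lambda>\<eta>. neumann_defect n \<eta> (crossing n \<eta>)" 1 0 \<eta>0] neumann_defect_crossing_1_neg[of n] assms
      neumann_defect_crossing_continuous by (auto simp: less_imp_le)
  moreover have "\<eta> \<noteq> 1" using calculation neumann_defect_crossing_1_neg[of n] by auto
  ultimately show ?thesis by force
qed

text \<open>
  The induction over \<open>n\<close> starts at \<open>\<eta> = 0\<close>, \<open>x = 1\<close>, where the inequality
  \<open>M(1/2, 1, 1) \<le> 2 M'(1/2, 1, 1)\<close> holds coefficient by coefficient.
\<close>

lemma neumann_defect_0_nonneg: "neumann_defect 0 0 (crossing 0 0) \<ge> 0"
proof -
  have x: "crossing 0 0 = 1" by (simp add: crossing_def real_sqrt_divide)
  have "kummer_coeff (1/2) 1 k \<le> 2 * (1/2 * kummer_coeff (1/2 + 1) (1 + 1) k)" for k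
  proof -
    have "2 * (1/2 * kummer_coeff (1/2 + 1) (1 + 1) k) = 2 * (real (Suc k) * kummer_coeff (1/2) 1 (Suc k))"
      by (subst kummer_coeff_shift) auto
    also have "\<dots> = kummer_coeff (1/2) 1 k * ((2 * real k + 1) / (k + 1))"
    proof -
      have "2 * (real (Suc k) * (y * ((1/2 + real k) / ((1 + real k) * (real k + 1)))))
          = y * ((2 * real k + 1) / (real k + 1))" for y
        by (simp add: divide_simps) (simp add: algebra_simps)
      then show ?thesis by (simp add: kummer_coeff_Suc)
    qed
    also have "\<dots> \<ge> kummer_coeff (1/2) 1 k * 1"
      by (rule mult_left_mono) (auto simp: kummer_coeff_def intro!: divide_nonneg_nonneg mult_nonneg_nonneg pochhammer_nonneg)
    finally show ?thesis by simp
  qed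
  then have "kummer (1/2) 1 1 \<le> (\<Sum>k. 2 * (1/2 * kummer_coeff (1/2 + 1) (1 + 1) k) * 1 ^ k)"
    unfolding kummer_def using kummer_summable[of 1 "1/2" 1] kummer_summable[of 2 "3/2" 1]
    by (intro suminf_le) auto
  also have "\<dots> = 2 * kummer' (1/2) 1 1"
    using kummer_summable[of 2 "3/2" 1] by (simp add: kummer'_def kummer_def)
  finally show ?thesis unfolding x by (simp add: neumann_defect_def branch_def branch'_def)
qed

text \<open>
  By the ladder, a root for \<open>n\<close> makes the defect for \<open>n + 1\<close> vanish at the crossing of the branches
  \<open>n\<close> and \<open>n + 1\<close>, hence positive at the next crossing for the same \<open>\<eta>\<close>; at the end
  \<open>\<eta> = 1\<close> of the curve it is negative.
\<close>

lemma crossing_root_exists: "\<exists>\<eta>\<ge>0. \<eta> < 1 \<and> neumann_defect n \<eta> (crossing n \<eta>) = 0"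
  and crossing_root_increase:
    "0 \<le> \<eta> \<Longrightarrow> \<eta> < 1 \<Longrightarrow> neumann_defect n \<eta> (crossing n \<eta>) = 0 \<Longrightarrow>
     \<exists>\<eta>'>\<eta>. \<eta>' < 1 \<and> neumann_defect (Suc n) \<eta>' (crossing (Suc n) \<eta>') = 0"
proof -
  have step: "\<exists>\<eta>'>\<eta>. \<eta>' < 1 \<and> neumann_defect (Suc n) \<eta>' (crossing (Suc n) \<eta>') = 0"
    if a: "0 \<le> \<eta>" "\<eta> < 1" "neumann_defect n \<eta> (crossing n \<eta>) = 0" for \<eta> n
  proof -
    have "neumann_defect (Suc n) \<eta> (crossing n \<eta>) = 0"
      using neumann_defect_ladder[OF a(3) crossing_eq[OF a(1)]] crossing_ge[OF a(1), of n] a by simp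
    then have p: "neumann_defect (Suc n) \<eta> (crossing (Suc n) \<eta>) > 0"
      using neumann_defect_pos_at_next_crossing a by blast
    then obtain \<eta>' where "\<eta>' \<ge> \<eta>" "\<eta>' < 1" "neumann_defect (Suc n) \<eta>' (crossing (Suc n) \<eta>') = 0"
      using crossing_root[of \<eta> "Suc n"] a by auto
    with p show ?thesis by (intro exI[of _ \<eta>']) (auto simp: less_le)
  qed
  then show "0 \<le> \<eta> \<Longrightarrow> \<eta> < 1 \<Longrightarrow> neumann_defect n \<eta> (crossing n \<eta>) = 0 \<Longrightarrow>
     \<exists>\<eta>'>\<eta>. \<eta>' < 1 \<and> neumann_defect (Suc n) \<eta>' (crossing (Suc n) \<eta>') = 0" .
  show "\<exists>\<eta>\<ge>0. \<eta> < 1 \<and> neumann_defect n \<eta> (crossing n \<eta>) = 0"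
  proof (induction n)
    case 0
    then show ?case using crossing_root[of 0 0] neumann_defect_0_nonneg by simp
  next
    case (Suc n)
    then show ?case using step by (meson less_imp_le order_trans)
  qed
qed
section \<open>Smooth bump functions\<close>

text \<open>
  The powers of \<open>t\<close> in the denominator make the family closed under differentiation, which is what
  an induction over the order of smoothness needs.
\<close>

definition flat :: "nat \<Rightarrow> real \<Rightarrow> real" where
  "flat j t = (if t > 0 then exp (- 1 / t) / t ^ j else 0)"

lemma flat_pos: "t > 0 \<Longrightarrow> flat j t > 0"
  by (simp add: flat_def)

lemma flat_nonpos [simp]: "t \<le> 0 \<Longrightarrow> flat j t = 0"
  by (simp add: flat_def)

lemma flat_bounds: "0 \<le> flat 0 t" "flat 0 t \<le> 1"
  by (auto simp: flat_def)

lemma flat_tendsto_0: "(flat j \<longlongrightarrow> 0) (at_right 0)"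
proof -
  have "((\<lambda>t::real. inverse t ^ j / exp (inverse t)) \<longlongrightarrow> 0) (at_right 0)"
    using filterlim_compose[OF tendsto_power_div_exp_0 filterlim_inverse_at_top_right] .
  then show ?thesis
    by (rule Lim_transform_eventually)
       (auto simp: eventually_at_filter flat_def exp_minus field_simps)
qed

lemma flat_deriv: "(flat j has_real_derivative flat (j + 2) t - real j * flat (j + 1) t) (at t)"
proof -
  consider "t > 0" | "t < 0" | "t = 0" by linarith
  then show ?thesis
  proof cases
    case 1
    have d: "((\<lambda>t. exp (- 1 / t) / t ^ j) has_real_derivative
            exp (- 1 / t) / t ^ (j + 2) - real j * (exp (- 1 / t) / t ^ (j + 1))) (at t)"
    proof (cases j)
      case 0
      show ?thesis unfolding 0 using 1
        by (auto intro!: derivative_eq_intros simp: power2_eq_square)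
    next
      case (Suc i)
      have "((\<lambda>t. exp (- 1 / t) / t ^ Suc i) has_real_derivative
           (exp (- 1 / t) * (1 / t\<^sup>2) * t ^ Suc i - exp (- 1 / t) * (real (Suc i) * t ^ i)) / (t ^ Suc i * t ^ Suc i)) (at t)"
      proof (rule DERIV_divide)
        show "((\<lambda>t. exp (- 1 / t)) has_real_derivative exp (- 1 / t) * (1 / t\<^sup>2)) (at t)"
          using 1 by (auto intro!: derivative_eq_intros simp: power2_eq_square)
        show "((\<lambda>t. t ^ Suc i) has_real_derivative real (Suc i) * t ^ i) (at t)"
          using DERIV_pow[of "Suc i" t UNIV] by simp
      qed (use 1 in simp)
      then show ?thesis unfolding Suc
        by (rule DERIV_cong) (use 1 in \<open>simp add: divide_simps power2_eq_square del: of_nat_Suc\<close>,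
            simp add: algebra_simps del: of_nat_Suc)
    qed
    have "(flat j has_real_derivative exp (- 1 / t) / t ^ (j + 2) - real j * (exp (- 1 / t) / t ^ (j + 1))) (at t)"
      by (rule has_field_derivative_transform_within_open[OF d open_greaterThan[of 0]])
         (use 1 in \<open>auto simp: flat_def\<close>)
    then show ?thesis using 1 by (simp add: flat_def)
  next
    case 2
    have "(flat j has_real_derivative 0) (at t)"
      by (rule has_field_derivative_transform_within_open[OF DERIV_const open_lessThan[of 0]])
         (use 2 in auto)
    then show ?thesis using 2 by simp
  next
    case 3
    have "((\<lambda>h. (flat j (0 + h) - flat j 0) / h) \<longlongrightarrow> 0) (at 0)"
    proof (rule filterlim_split_at)
      show "((\<lambda>h. (flat j (0 + h) - flat j 0) / h) \<longlongrightarrow> 0) (at_left 0)"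
        by (rule Lim_transform_eventually[OF tendsto_const]) (auto simp: eventually_at_filter)
      show "((\<lambda>h. (flat j (0 + h) - flat j 0) / h) \<longlongrightarrow> 0) (at_right 0)"
        by (rule Lim_transform_eventually[OF flat_tendsto_0[of "Suc j"]])
           (auto simp: eventually_at_filter flat_def mult_ac)
    qed
    then show ?thesis using 3 by (simp add: DERIV_def del: add_0_left)
  qed
qed

lemma C_k_Suc_real:
  fixes f :: "real \<Rightarrow> real"
  assumes "\<And>x. (f has_real_derivative f' x) (at x)"
  shows "C_k (Suc k) f \<longleftrightarrow> C_k k f'"
proof -
  have "frechet_derivative f (at x) = (*) (f' x)" for x
    using frechet_derivative_at[of f "(*) (f' x)" x] assms[of x]
    by (simp add: has_field_derivative_def)
  moreover have "f differentiable at x" for x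
    using assms real_differentiable_def by blast
  ultimately show ?thesis by simp
qed

lemma C_k_real_cases:
  fixes f :: "real \<Rightarrow> real"
  assumes "C_k (Suc k) f"
  obtains f' where "\<And>x. (f has_real_derivative f' x) (at x)" "C_k k f'"
proof -
  have "\<exists>d. (f has_real_derivative d) (at x)" for x
    using assms by (auto simp: real_differentiable_def)
  then obtain f' where f': "\<And>x. (f has_real_derivative f' x) (at x)" by metis
  with assms C_k_Suc_real[OF f'] show ?thesis using that by blast
qed

lemma C_k_add:
  fixes f g :: "real \<Rightarrow> real"
  shows "C_k k f \<Longrightarrow> C_k k g \<Longrightarrow> C_k k (\<lambda>x. f x + g x)"
proof (induction k arbitrary: f g)
  case 0
  then show ?case by (simp add: continuous_on_add)
next
  case (Suc k)
  obtain f' where f: "\<And>x. (f has_real_derivative f' x) (at x)" "C_k k f'"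
    using C_k_real_cases[OF Suc.prems(1)] by blast
  obtain g' where g: "\<And>x. (g has_real_derivative g' x) (at x)" "C_k k g'"
    using C_k_real_cases[OF Suc.prems(2)] by blast
  have "C_k k (\<lambda>x. f' x + g' x)" using Suc.IH f(2) g(2) by blast
  moreover have "((\<lambda>x. f x + g x) has_real_derivative f' x + g' x) (at x)" for x
    by (rule DERIV_add[OF f(1) g(1)])
  ultimately show ?case using C_k_Suc_real[of "\<lambda>x. f x + g x" "\<lambda>x. f' x + g' x"] by blast
qed

lemma poly_flat_deriv:
  fixes p q :: "real \<Rightarrow> real"
  assumes "(p has_real_derivative p') (at x)" "(q has_real_derivative q') (at x)"
  shows "((\<lambda>x. p x * flat j (q x)) has_real_derivative
           p' * flat j (q x) + (p x * q' * flat (j + 2) (q x) + - real j * p x * q' * flat (j + 1) (q x))) (at x)"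
proof -
  have "((\<lambda>x. flat j (q x)) has_real_derivative (flat (j + 2) (q x) - real j * flat (j + 1) (q x)) * q') (at x)"
    by (rule DERIV_chain2[OF flat_deriv assms(2)])
  then show ?thesis
    by (rule DERIV_cong[OF DERIV_mult[OF assms(1)]]) (simp add: algebra_simps)
qed

text \<open>
  The derivative of such a product is a sum of three products of the same kind.
\<close>

lemma C_k_poly_flat:
  fixes p q :: "real \<Rightarrow> real"
  assumes q: "real_polynomial_function q"
  shows "real_polynomial_function p \<Longrightarrow> C_k k (\<lambda>x. p x * flat j (q x))"
proof (induction k arbitrary: p j)
  case 0
  obtain p' where p': "\<And>x. (p has_real_derivative p' x) (at x)"
    using has_real_derivative_polynomial_function[OF 0] by blast
  obtain q' where q': "\<And>x. (q has_real_derivative q' x) (at x)"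
    using has_real_derivative_polynomial_function[OF q] by blast
  show ?case
    using DERIV_isCont[OF poly_flat_deriv[OF p' q']]
    by (simp add: continuous_at_imp_continuous_on)
next
  case (Suc k)
  obtain p' where p': "\<And>x. (p has_real_derivative p' x) (at x)" "real_polynomial_function p'"
    using has_real_derivative_polynomial_function[OF Suc.prems] by blast
  obtain q' where q': "\<And>x. (q has_real_derivative q' x) (at x)" "real_polynomial_function q'"
    using has_real_derivative_polynomial_function[OF q] by blast
  show ?case
    unfolding C_k_Suc_real[OF poly_flat_deriv[OF p'(1) q'(1)]]
    by (intro C_k_add Suc.IH p' real_polynomial_function.intros Suc.prems q'(2))
qed

text \<open>
  For \<open>c > 0\<close> a smooth function that is positive exactly on \<open>{a<..<b}\<close>. Letting \<open>c\<close> grow makes it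
  converge to the indicator function of this interval.
\<close>

definition bump :: "real \<Rightarrow> real \<Rightarrow> real \<Rightarrow> real \<Rightarrow> real" where
  "bump c a b x = flat 0 (c * ((x - a) * (b - x)))"

lemma bump_poly: "real_polynomial_function (\<lambda>x. c * ((x - a) * (b - x)))"
proof -
  have "real_polynomial_function (\<lambda>x::real. x)" by (rule real_polynomial_function.intros(1)) simp
  then show ?thesis
    by (intro real_polynomial_function.intros(3,4) real_polynomial_function_diff
          real_polynomial_function.intros(2) real_polynomial_function.intros(4))
qed

lemma bump_deriv:
  "(bump c a b has_real_derivative
      c * (a + b - 2 * x) * flat 2 (c * ((x - a) * (b - x)))) (at x)"
proof -
  have "((\<lambda>x. 1 * flat 0 (c * ((x - a) * (b - x)))) has_real_derivative
     0 * flat 0 (c * ((x - a) * (b - x))) + (1 * (c * (a + b - 2 * x)) * flat (0 + 2) (c * ((x - a) * (b - x)))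
      + - real 0 * 1 * (c * (a + b - 2 * x)) * flat (0 + 1) (c * ((x - a) * (b - x))))) (at x)"
    by (rule poly_flat_deriv) (auto intro!: derivative_eq_intros simp: algebra_simps)
  then show ?thesis by (simp add: bump_def[abs_def] numeral_2_eq_2)
qed

lemma continuous_on_bump: "continuous_on S (bump c a b)"
  using DERIV_isCont[OF bump_deriv] by (simp add: continuous_at_imp_continuous_on)

lemma bump_outside: "c \<ge> 0 \<Longrightarrow> x \<notin> {a<..<b} \<Longrightarrow> a < b \<Longrightarrow> bump c a b x = 0"
proof -
  assume c: "c \<ge> 0" and x: "x \<notin> {a<..<b}" and ab: "a < b"
  have "(x - a) * (b - x) \<le> 0" using x ab by (auto simp: not_less mult_le_0_iff)
  then show ?thesis
    unfolding bump_def using c by (intro flat_nonpos) (simp add: mult_le_0_iff)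
qed

lemma bump_pos: "c > 0 \<Longrightarrow> x \<in> {a<..<b} \<Longrightarrow> bump c a b x > 0"
  unfolding bump_def by (rule flat_pos) auto

lemma bump_test_function:
  assumes "real_polynomial_function p" "c \<ge> 0" "0 < a" "a < b" "b < 1"
  shows "(\<lambda>x. p x * bump c a b x) \<in> test_functions {0<..<1}"
proof -
  have s: "closure {x. p x * bump c a b x \<noteq> 0} \<subseteq> {a..b}"
  proof (rule closure_minimal)
    show "{x. p x * bump c a b x \<noteq> 0} \<subseteq> {a..b}"
    proof safe
      fix x assume "p x * bump c a b x \<noteq> 0"
      then have "x \<in> {a<..<b}" using bump_outside[OF assms(2) _ assms(4), of x] by auto
      then show "x \<in> {a..b}" by auto
    qed
  qed simp
  then have "compact (closure {x. p x * bump c a b x \<noteq> 0})"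
    by (meson bounded_subset bounded_closed_interval compact_eq_bounded_closed closed_closure)
  moreover have "{a..b} \<subseteq> {0<..<1}" using assms by auto
  moreover have "C_k k (\<lambda>x. p x * bump c a b x)" for k
    unfolding bump_def by (rule C_k_poly_flat[OF bump_poly assms(1)])
  ultimately show ?thesis using s by (auto simp: test_functions_def)
qed

section \<open>Weak derivatives on the unit interval\<close>

lemma weak_deriv_test:
  assumes "has_weak_deriv {0<..<1} 1 u g" "\<phi> \<in> test_functions {0<..<1::real}"
    "\<And>x. (\<phi> has_real_derivative \<phi>' x) (at x)"
  shows "(LINT x|lebesgue_on {0<..<1}. u x * of_real (\<phi>' x)) =
         - (LINT x|lebesgue_on {0<..<1}. g x * of_real (\<phi> x))"
proof -
  have fd: "frechet_derivative \<phi> (at x) 1 = \<phi>' x" for x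
    using fun_cong[OF frechet_derivative_at[of \<phi> "(*) (\<phi>' x)" x], of 1] assms(3)[of x]
    by (simp add: has_field_derivative_def)
  have "\<forall>\<phi>\<in>test_functions {0<..<1}. (LINT x|lebesgue_on {0<..<1}. u x * of_real (frechet_derivative \<phi> (at x) 1)) =
        - (LINT x|lebesgue_on {0<..<1}. g x * of_real (\<phi> x))"
    using assms(1) unfolding has_weak_deriv_def by blast
  from bspec[OF this assms(2)] show ?thesis unfolding fd .
qed

lemma real_polynomial_antiderivative:
  assumes "real_polynomial_function (q::real \<Rightarrow> real)"
  obtains P where "real_polynomial_function P" "\<And>x. (P has_real_derivative q x) (at x)" "P a = 0"
proof -
  obtain c n where q: "q = (\<lambda>x. \<Sum>i\<le>n. c i * x ^ i)"
    using assms by (auto simp: real_polynomial_function_iff_sum)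
  define Q where "Q = (\<lambda>x::real. \<Sum>i\<le>n. c i / (real i + 1) * x ^ (Suc i))"
  have "real_polynomial_function (\<lambda>x::real. x)" by (rule real_polynomial_function.intros(1)) simp
  then have 1: "real_polynomial_function (\<lambda>x. Q x - Q a)"
    unfolding Q_def
    by (intro real_polynomial_function_diff real_polynomial_function_sum
         real_polynomial_function.intros(4) real_polynomial_function_power real_polynomial_function.intros(2)) auto
  have 2: "((\<lambda>x. Q x - Q a) has_real_derivative q x) (at x)" for x
  proof -
    have "((\<lambda>x. Q x - Q a) has_real_derivative (\<Sum>i\<le>n. c i / (real i + 1) * (real (Suc i) * x ^ i)) - 0) (at x)"
      unfolding Q_def
      by (intro DERIV_diff DERIV_const DERIV_sum DERIV_cmult DERIV_cong[OF DERIV_pow]) auto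
    then show ?thesis unfolding q by (simp add: add_ac)
  qed
  show ?thesis using that[OF 1 2] by simp
qed

lemma locally_integrable_indicator:
  fixes u :: "real \<Rightarrow> complex"
  assumes "locally_integrable {0<..<1} u" "0 < a" "b < 1"
  shows "integrable (lebesgue_on {0<..<1}) (\<lambda>x. indicator {a..b} x *\<^sub>R u x)"
proof -
  have s: "{a..b} \<subseteq> {0<..<1}" using assms by auto
  then have "u absolutely_integrable_on {a..b}" using assms(1) by (simp add: locally_integrable_def)
  then have "integrable lebesgue (\<lambda>x. indicator {a..b} x *\<^sub>R u x)" by (simp add: set_integrable_def)
  also have "(\<lambda>x. indicator {a..b} x *\<^sub>R u x) = (\<lambda>x. indicator {0<..<1} x *\<^sub>R (indicator {a..b} x *\<^sub>R u x))"
    using s by (auto simp: fun_eq_iff of_bool_def indicator_def)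
  finally show ?thesis by (subst integrable_restrict_space) auto
qed

lemma integral_limit_uniform:
  fixes u :: "real \<Rightarrow> complex"
  assumes u: "integrable M u"
    and m: "\<And>n. \<phi> n \<in> borel_measurable M" "\<psi> \<in> borel_measurable M"
    and C: "\<And>n x. x \<in> space M \<Longrightarrow> \<bar>\<phi> n x - \<psi> x\<bar> \<le> C / Suc n"
    and B: "\<And>x. x \<in> space M \<Longrightarrow> \<bar>\<psi> x\<bar> \<le> B"
  shows "(\<lambda>n. LINT x|M. u x * of_real (\<phi> n x)) \<longlonglongrightarrow> (LINT x|M. u x * of_real (\<psi> x))"
proof (rule integral_dominated_convergence[where w = "\<lambda>x. (B + \<bar>C\<bar>) * cmod (u x)"])
  have [measurable]: "u \<in> borel_measurable M" using u by auto
  note [measurable] = m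
  show "(\<lambda>x. u x * of_real (\<psi> x)) \<in> borel_measurable M" by measurable
  show "(\<lambda>x. u x * of_real (\<phi> n x)) \<in> borel_measurable M" for n by measurable
  show "integrable M (\<lambda>x. (B + \<bar>C\<bar>) * cmod (u x))" using u by auto
  have lim: "(\<lambda>n. \<phi> n x) \<longlonglongrightarrow> \<psi> x" if "x \<in> space M" for x
  proof -
    have "(\<lambda>n. C / Suc n) \<longlonglongrightarrow> 0" by (rule lim_const_over_n[THEN LIMSEQ_Suc])
    then have "(\<lambda>n. \<phi> n x - \<psi> x) \<longlonglongrightarrow> 0"
      by (rule Lim_null_comparison[rotated]) (use C[OF that] in auto)
    then show ?thesis by (simp add: LIM_zero_iff)
  qed
  show "AE x in M. (\<lambda>n. u x * of_real (\<phi> n x)) \<longlonglongrightarrow> u x * of_real (\<psi> x)"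
    by (rule AE_I2) (intro tendsto_intros lim)
  show "AE x in M. cmod (u x * of_real (\<phi> n x)) \<le> (B + \<bar>C\<bar>) * cmod (u x)" for n
  proof (rule AE_I2)
    fix x assume x: "x \<in> space M"
    have "C / Suc n \<le> \<bar>C\<bar> / 1" by (rule frac_le) auto
    then have "\<bar>\<phi> n x\<bar> \<le> B + \<bar>C\<bar>" using C[OF x, of n] B[OF x] by simp
    then show "cmod (u x * of_real (\<phi> n x)) \<le> (B + \<bar>C\<bar>) * cmod (u x)"
      using mult_right_mono[of "\<bar>\<phi> n x\<bar>" "B + \<bar>C\<bar>" "cmod (u x)"] by (simp add: norm_mult mult.commute)
  qed
qed

text \<open>
  The defining identity of the weak derivative extends from smooth to \<open>C\<^sup>1\<close> functions \<open>\<psi>\<close> of compact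
  support. With a bump function \<open>\<omega>\<close> that is positive on the support of \<open>\<psi>\<close>, the quotient \<open>\<psi> / \<omega>\<close> is
  again \<open>C\<^sup>1\<close>; polynomials \<open>P\<close> approximate it together with its derivative by the theorem of
  Weierstrass, and the products \<open>P * \<omega>\<close> are test functions that converge to \<open>\<psi>\<close> in \<open>C\<^sup>1\<close>.
\<close>

lemma weak_deriv_C1:
  assumes w: "has_weak_deriv {0<..<1} 1 u g" and cd: "0 < c" "c < d" "d < (1::real)"
    and der: "\<And>x. x \<in> {0<..<1} \<Longrightarrow> (\<psi> has_real_derivative \<psi>' x) (at x)"
    and cont: "continuous_on {0<..<1} \<psi>'"
    and zero: "\<And>x. x \<in> {0<..<1} \<Longrightarrow> x \<notin> {c..d} \<Longrightarrow> \<psi> x = 0 \<and> \<psi>' x = 0"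
  shows "(LINT x|lebesgue_on {0<..<1}. u x * of_real (\<psi>' x)) =
         - (LINT x|lebesgue_on {0<..<1}. g x * of_real (\<psi> x))"
proof -
  define a where "a = c / 2"
  define b where "b = (1 + d) / 2"
  have ab: "0 < a" "a < c" "d < b" "b < 1" "a < b" using cd by (auto simp: a_def b_def)
  have sub: "{a..b} \<subseteq> {0<..<1}" using ab by auto
  define \<omega> where "\<omega> = bump 1 a b"
  define \<omega>' where "\<omega>' = (\<lambda>x. 1 * (a + b - 2 * x) * flat 2 (1 * ((x - a) * (b - x))))"
  have d\<omega>: "(\<omega> has_real_derivative \<omega>' x) (at x)" for x
    unfolding \<omega>_def \<omega>'_def by (rule bump_deriv)
  have c\<omega>: "continuous_on S \<omega>" for S
    unfolding \<omega>_def by (rule continuous_on_bump)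
  have isCont_flat: "isCont (flat j) t" for j t
    using DERIV_isCont[OF flat_deriv] .
  have c\<omega>': "continuous_on S \<omega>'" for S
    unfolding \<omega>'_def
    by (intro continuous_at_imp_continuous_on ballI continuous_intros isCont_o2[OF _ isCont_flat]) 
  have zout: "\<omega> x = 0" "\<omega>' x = 0" if "x \<notin> {a<..<b}" for x
  proof -
    show "\<omega> x = 0" unfolding \<omega>_def using bump_outside[OF _ that ab(5)] by simp
    have "(x - a) * (b - x) \<le> 0" using that ab by (auto simp: not_less mult_le_0_iff)
    then show "\<omega>' x = 0" by (simp add: \<omega>'_def)
  qed
  have pos: "\<omega> x > 0" if "x \<in> {a<..<b}" for x
    unfolding \<omega>_def using bump_pos[OF _ that] by simp
  obtain x0 where x0: "x0 \<in> {c..d}" "\<And>x. x \<in> {c..d} \<Longrightarrow> \<omega> x0 \<le> \<omega> x"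
    using continuous_attains_inf[OF compact_Icc _ c\<omega>[of "{c..d}"]] cd by auto
  \<comment> \<open>Replacing \<open>\<omega>\<close> by \<open>max \<omega> \<delta>\<close> in denominators changes nothing on the support of \<open>\<psi>\<close>
    and makes \<open>F\<close> and \<open>F'\<close> continuous up to the zeros \<open>a\<close> and \<open>b\<close> of \<open>\<omega>\<close>.\<close>
  define \<delta> where "\<delta> = \<omega> x0"
  have \<delta>: "\<delta> > 0" unfolding \<delta>_def using x0(1) ab by (intro pos) auto
  have \<delta>le: "\<delta> \<le> \<omega> x" if "x \<in> {c..d}" for x using x0(2)[OF that] by (simp add: \<delta>_def)
  define m where "m = (\<lambda>x. max (\<omega> x) \<delta>)"
  have m: "m x > 0" for x using \<delta> by (simp add: m_def less_max_iff_disj)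
  have cm: "continuous_on S m" for S unfolding m_def by (intro continuous_intros c\<omega>)
  have c\<psi>: "continuous_on {0<..<1} \<psi>"
    using der by (meson DERIV_isCont continuous_at_imp_continuous_on)
  define F where "F = (\<lambda>x. \<psi> x / m x)"
  define F' where "F' = (\<lambda>x. (\<psi>' x * \<omega> x - \<psi> x * \<omega>' x) / (m x)\<^sup>2)"
  have cF': "continuous_on {a..b} F'" unfolding F'_def
    by (intro continuous_intros continuous_on_subset[OF cont sub] continuous_on_subset[OF c\<psi> sub] c\<omega> c\<omega>' cm)
       (use m in \<open>force simp: less_le\<close>)
  have cF: "continuous_on {a..b} F" unfolding F_def
    by (intro continuous_intros continuous_on_subset[OF c\<psi> sub] cm) (use m in \<open>force simp: less_le\<close>)
  have FF: "F x = \<psi> x / \<omega> x" "F' x = (\<psi>' x * \<omega> x - \<psi> x * \<omega>' x) / (\<omega> x)\<^sup>2" if "x \<in> {a<..<b}" for x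
  proof -
    have "m x = \<omega> x \<or> \<psi> x = 0 \<and> \<psi>' x = 0" using \<delta>le[of x] zero[of x] that ab by (force simp: m_def)
    then show "F x = \<psi> x / \<omega> x" "F' x = (\<psi>' x * \<omega> x - \<psi> x * \<omega>' x) / (\<omega> x)\<^sup>2"
      by (auto simp: F_def F'_def)
  qed
  have dF: "(F has_real_derivative F' x) (at x)" if x: "x \<in> {a<..<b}" for x
  proof -
    have "((\<lambda>x. \<psi> x / \<omega> x) has_real_derivative (\<psi>' x * \<omega> x - \<psi> x * \<omega>' x) / (\<omega> x * \<omega> x)) (at x)"
      using pos[OF x] x ab by (intro DERIV_divide der d\<omega>) auto
    then have "((\<lambda>x. \<psi> x / \<omega> x) has_real_derivative F' x) (at x)"
      by (simp add: FF(2)[OF x] power2_eq_square)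
    then show ?thesis
      by (rule has_field_derivative_transform_within_open[OF _ open_greaterThanLessThan x])
         (simp add: FF(1))
  qed
  have psi: "\<psi> x = \<omega> x * F x" "\<psi>' x = \<omega>' x * F x + \<omega> x * F' x" if x: "x \<in> {0<..<1}" for x
  proof -
    have "\<psi> x = \<omega> x * F x \<and> \<psi>' x = \<omega>' x * F x + \<omega> x * F' x"
    proof (cases "x \<in> {a<..<b}")
      case True
      then show ?thesis using pos[OF True] by (simp add: FF[OF True] field_simps power2_eq_square)
    next
      case False
      then have "x \<notin> {c..d}" using ab by auto
      then show ?thesis using zout[OF False] zero[OF x] by simp
    qed
    then show "\<psi> x = \<omega> x * F x" "\<psi>' x = \<omega>' x * F x + \<omega> x * F' x" by auto
  qed
  have Fa: "F a = 0" using zero[of a] ab cd by (simp add: F_def)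
  have "\<exists>q. real_polynomial_function q \<and> (\<forall>x\<in>{a..b}. \<bar>F' x - q x\<bar> < 1 / Suc n)" for n
    using Stone_Weierstrass_real_polynomial_function[OF compact_Icc cF', of "1 / Suc n"] by (metis of_nat_0_less_iff zero_less_Suc zero_less_divide_1_iff)
  then obtain q where q: "\<And>n. real_polynomial_function (q n)" "\<And>n x. x \<in> {a..b} \<Longrightarrow> \<bar>F' x - q n x\<bar> < 1 / Suc n"
    by metis
  have "\<exists>P. real_polynomial_function P \<and> (\<forall>x. (P has_real_derivative q n x) (at x)) \<and> P a = 0" for n
    using real_polynomial_antiderivative[OF q(1)[of n], of a] by metis
  then obtain P where P: "\<And>n. real_polynomial_function (P n)"
      "\<And>n x. (P n has_real_derivative q n x) (at x)" "\<And>n. P n a = 0" by metis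
  have PF: "\<bar>P n x - F x\<bar> \<le> 1 / Suc n" if x: "x \<in> {a..b}" for n x
  proof (cases "x = a")
    case True then show ?thesis using P(3) Fa by simp
  next
    case False
    have cP: "continuous_on S (P n)" for S
      using DERIV_isCont[OF P(2)] by (simp add: continuous_at_imp_continuous_on)
    have ax: "a < x" using False x by simp
    have "\<exists>l z. a < z \<and> z < x \<and> ((\<lambda>x. P n x - F x) has_real_derivative l) (at z) \<and>
             (P n x - F x) - (P n a - F a) = (x - a) * l"
    proof (rule MVT[OF ax])
      show "continuous_on {a..x} (\<lambda>x. P n x - F x)"
        by (intro continuous_intros cP continuous_on_subset[OF cF]) (use x in auto)
      show "(\<lambda>x. P n x - F x) differentiable at y" if "a < y" "y < x" for y
        using DERIV_diff[OF P(2) dF[of y]] that x real_differentiable_def by auto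
    qed
    then obtain l z where z: "a < z" "z < x" "((\<lambda>x. P n x - F x) has_real_derivative l) (at z)"
       and e: "P n x - F x = (x - a) * l" using P(3) Fa by auto
    have "((\<lambda>x. P n x - F x) has_real_derivative q n z - F' z) (at z)"
      using z x by (intro DERIV_diff[OF P(2) dF]) auto
    then have "l = q n z - F' z" using z(3) DERIV_unique by blast
    then have "\<bar>l\<bar> \<le> 1 / Suc n" using q(2)[of z n] z x by auto
    moreover have "\<bar>x - a\<bar> \<le> 1" using x ab by auto
    ultimately have "\<bar>x - a\<bar> * \<bar>l\<bar> \<le> 1 * (1 / Suc n)" by (intro mult_mono) auto
    then show ?thesis by (simp add: e abs_mult)
  qed
  obtain B1 where B1: "\<And>x. x \<in> {a..b} \<Longrightarrow> \<bar>\<omega>' x\<bar> \<le> B1"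
    using continuous_on_Icc_bounded[OF c\<omega>'] by blast
  have B10: "B1 \<ge> 0" using B1[of a] ab by auto
  have \<omega>1: "\<bar>\<omega> x\<bar> \<le> 1" for x using flat_bounds[of "1 * ((x - a) * (b - x))"] by (simp add: \<omega>_def bump_def)
  define \<phi> where "\<phi> = (\<lambda>n x. P n x * \<omega> x)"
  define \<phi>' where "\<phi>' = (\<lambda>n x. q n x * \<omega> x + \<omega>' x * P n x)"
  have d\<phi>: "(\<phi> n has_real_derivative \<phi>' n x) (at x)" for n x
    unfolding \<phi>_def \<phi>'_def by (rule DERIV_mult[OF P(2) d\<omega>])
  have err: "\<bar>\<phi> n x - \<psi> x\<bar> \<le> (B1 + 1) / Suc n" "\<bar>\<phi>' n x - \<psi>' x\<bar> \<le> (B1 + 1) / Suc n"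
    if x: "x \<in> {0<..<1}" for n x
  proof -
    have n0: "(0::real) \<le> 1 / Suc n" by simp
    have "\<bar>\<phi> n x - \<psi> x\<bar> \<le> (B1 + 1) * (1 / Suc n) \<and> \<bar>\<phi>' n x - \<psi>' x\<bar> \<le> (B1 + 1) * (1 / Suc n)"
    proof (cases "x \<in> {a<..<b}")
      case True
      then have xab: "x \<in> {a..b}" by auto
      have "\<phi> n x - \<psi> x = (P n x - F x) * \<omega> x" unfolding \<phi>_def psi(1)[OF x] by (simp add: algebra_simps)
      then have "\<bar>\<phi> n x - \<psi> x\<bar> \<le> 1 / Suc n * 1"
        unfolding \<open>\<phi> n x - \<psi> x = (P n x - F x) * \<omega> x\<close> abs_mult
        using PF[OF xab, of n] \<omega>1[of x] by (intro mult_mono) auto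
      also have "\<dots> \<le> (B1 + 1) * (1 / Suc n)" using B10 by (simp add: field_simps)
      finally have 1: "\<bar>\<phi> n x - \<psi> x\<bar> \<le> (B1 + 1) * (1 / Suc n)" .
      have "\<phi>' n x - \<psi>' x = (q n x - F' x) * \<omega> x + \<omega>' x * (P n x - F x)"
        unfolding \<phi>'_def psi(2)[OF x] by (simp add: algebra_simps)
      also have "\<bar>\<dots>\<bar> \<le> \<bar>q n x - F' x\<bar> * \<bar>\<omega> x\<bar> + \<bar>\<omega>' x\<bar> * \<bar>P n x - F x\<bar>"
        by (metis abs_mult abs_triangle_ineq)
      also have "\<dots> \<le> 1 / Suc n * 1 + B1 * (1 / Suc n)"
        using PF[OF xab, of n] \<omega>1[of x] q(2)[OF xab, of n] B1[OF xab] B10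
        by (intro add_mono mult_mono) (auto simp: abs_minus_commute)
      finally have "\<bar>\<phi>' n x - \<psi>' x\<bar> \<le> (B1 + 1) * (1 / Suc n)" by (simp add: add_divide_distrib add.commute)
      with 1 show ?thesis by blast
    next
      case False
      then have "x \<notin> {c..d}" using ab by auto
      then show ?thesis using zout[OF False] zero[OF x] B10 by (simp add: \<phi>_def \<phi>'_def)
    qed
    then show "\<bar>\<phi> n x - \<psi> x\<bar> \<le> (B1 + 1) / Suc n" "\<bar>\<phi>' n x - \<psi>' x\<bar> \<le> (B1 + 1) / Suc n" by auto
  qed
  let ?N = "lebesgue_on {0<..<1::real}"
  have bd: "\<exists>B. \<forall>x\<in>{0<..<1}. \<bar>f x\<bar> \<le> B" if "continuous_on {0<..<1} f" "\<And>x. x \<in> {0<..<1} \<Longrightarrow> x \<notin> {c..d} \<Longrightarrow> f x = 0" for f :: "real \<Rightarrow> real"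
  proof -
    have cf: "continuous_on {c..d} f" by (rule continuous_on_subset[OF that(1)]) (use cd in auto)
    obtain B where B: "\<And>x. x \<in> {c..d} \<Longrightarrow> \<bar>f x\<bar> \<le> B"
      using continuous_on_Icc_bounded[OF cf] by blast
    show ?thesis
    proof (intro exI[of _ "\<bar>B\<bar>"] ballI)
      fix x :: real assume x: "x \<in> {0<..<1}"
      show "\<bar>f x\<bar> \<le> \<bar>B\<bar>"
      proof (cases "x \<in> {c..d}")
        case True
        then show ?thesis using B[OF True] by linarith
      next
        case False
        then show ?thesis using that(2)[OF x False] by simp
      qed
    qed
  qed
  obtain B2 where B2: "\<And>x. x \<in> {0<..<1} \<Longrightarrow> \<bar>\<psi>' x\<bar> \<le> B2" using bd[OF cont] zero by blast
  obtain B3 where B3: "\<And>x. x \<in> {0<..<1} \<Longrightarrow> \<bar>\<psi> x\<bar> \<le> B3" using bd[OF c\<psi>] zero by blast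
  have meas: "f \<in> borel_measurable ?N" if "continuous_on {0<..<1} f" for f :: "real \<Rightarrow> real"
    by (rule continuous_imp_measurable_on_sets_lebesgue[OF that]) simp
  have c\<phi>: "continuous_on {0<..<1} (\<phi> n)" for n
    using DERIV_isCont[OF d\<phi>] by (simp add: continuous_at_imp_continuous_on)
  have c\<phi>': "continuous_on {0<..<1} (\<phi>' n)" for n
    unfolding \<phi>'_def using continuous_on_polymonial_function[of "q n"] continuous_on_polymonial_function[of "P n"] q(1) P(1)
    by (intro continuous_intros c\<omega> c\<omega>') (auto simp: real_polynomial_function_eq)
  have restrict: "(LINT x|?N. (indicator {a..b} x *\<^sub>R v x) * of_real (f x)) = (LINT x|?N. v x * of_real (f x))"
    if "\<And>x. x \<in> {0<..<1} \<Longrightarrow> x \<notin> {a..b} \<Longrightarrow> f x = 0" for f and v :: "real \<Rightarrow> complex"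
    by (rule Bochner_Integration.integral_cong) (use that in \<open>auto simp: indicator_def\<close>)
  have zab: "\<psi> x = 0" "\<psi>' x = 0" "\<phi> n x = 0" "\<phi>' n x = 0" if "x \<in> {0<..<1}" "x \<notin> {a..b}" for x n
    using zero[OF that(1)] zout[of x] that(2) ab by (auto simp: \<phi>_def \<phi>'_def)
  have iu: "integrable ?N (\<lambda>x. indicator {a..b} x *\<^sub>R u x)" "integrable ?N (\<lambda>x. indicator {a..b} x *\<^sub>R g x)"
    using w ab by (auto simp: has_weak_deriv_def intro!: locally_integrable_indicator)
  have *: "(\<lambda>n. LINT x|?N. (indicator {a..b} x *\<^sub>R u x) * of_real (\<phi>' n x)) \<longlonglongrightarrow>
          (LINT x|?N. (indicator {a..b} x *\<^sub>R u x) * of_real (\<psi>' x))"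
    by (rule integral_limit_uniform[where C = "B1 + 1" and B = B2, OF iu(1) meas[OF c\<phi>'] meas[OF cont]])
       (use err B2 in auto)
  have L1: "(\<lambda>n. LINT x|?N. u x * of_real (\<phi>' n x)) \<longlonglongrightarrow> (LINT x|?N. u x * of_real (\<psi>' x))"
  proof -
    have "(LINT x|?N. (indicator {a..b} x *\<^sub>R u x) * of_real (\<phi>' n x)) = (LINT x|?N. u x * of_real (\<phi>' n x))" for n
      by (rule restrict) (rule zab)
    moreover have "(LINT x|?N. (indicator {a..b} x *\<^sub>R u x) * of_real (\<psi>' x)) = (LINT x|?N. u x * of_real (\<psi>' x))"
      by (rule restrict) (rule zab)
    ultimately show ?thesis using * by (simp only:)
  qed
  have **: "(\<lambda>n. LINT x|?N. (indicator {a..b} x *\<^sub>R g x) * of_real (\<phi> n x)) \<longlonglongrightarrow>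
          (LINT x|?N. (indicator {a..b} x *\<^sub>R g x) * of_real (\<psi> x))"
    by (rule integral_limit_uniform[where C = "B1 + 1" and B = B3, OF iu(2) meas[OF c\<phi>] meas[OF c\<psi>]])
       (use err B3 in auto)
  have L2: "(\<lambda>n. LINT x|?N. g x * of_real (\<phi> n x)) \<longlonglongrightarrow> (LINT x|?N. g x * of_real (\<psi> x))"
  proof -
    have "(LINT x|?N. (indicator {a..b} x *\<^sub>R g x) * of_real (\<phi> n x)) = (LINT x|?N. g x * of_real (\<phi> n x))" for n
      by (rule restrict) (rule zab)
    moreover have "(LINT x|?N. (indicator {a..b} x *\<^sub>R g x) * of_real (\<psi> x)) = (LINT x|?N. g x * of_real (\<psi> x))"
      by (rule restrict) (rule zab)
    ultimately show ?thesis using ** by (simp only:)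
  qed
  have "(LINT x|?N. u x * of_real (\<phi>' n x)) = - (LINT x|?N. g x * of_real (\<phi> n x))" for n
  proof (rule weak_deriv_test[OF w _ d\<phi>])
    show "\<phi> n \<in> test_functions {0<..<1}"
      unfolding \<phi>_def \<omega>_def using ab by (intro bump_test_function P(1)) auto
  qed
  then have "(\<lambda>n. LINT x|?N. u x * of_real (\<phi>' n x)) \<longlonglongrightarrow> - (LINT x|?N. g x * of_real (\<psi> x))"
    using tendsto_minus[OF L2] by simp
  with L1 show ?thesis using LIMSEQ_unique by blast
qed

text \<open>
  The open intervals generate the Borel sets and are stable under intersection, so the integral
  over every Borel set vanishes; a Lebesgue set differs from a Borel set by a null set.
\<close>

lemma AE_zero_if_interval_integrals_zero:
  fixes f :: "real \<Rightarrow> 'a::{banach, second_countable_topology}"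
  assumes f: "integrable lebesgue f"
    and z: "\<And>x y. (LINT t:{x<..<y}|lebesgue. f t) = 0" and zU: "integral\<^sup>L lebesgue f = 0"
  shows "AE x in lebesgue. f x = 0"
proof (rule sigma_finite_measure.density_zero[OF _ f])
  show "sigma_finite_measure (lebesgue :: real measure)"
  proof
    obtain A where "countable A" "A \<subseteq> sets lborel" "\<Union>A = (UNIV::real set)" "\<forall>a\<in>A. emeasure lborel a \<noteq> \<infinity>"
      using lborel.sigma_finite_countable by auto
    then show "\<exists>A. countable A \<and> A \<subseteq> sets lebesgue \<and> \<Union> A = space (lebesgue :: real measure) \<and> (\<forall>a\<in>A. emeasure lebesgue a \<noteq> \<infinity>)"
      by (intro exI[of _ A]) (auto simp: subset_iff)
  qed
  have si: "set_integrable lebesgue A f" if "A \<in> sets lebesgue" for A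
    using f that by (simp add: set_integrable_def integrable_mult_indicator)
  have borel: "(LINT t:A|lebesgue. f t) = 0" if "A \<in> sets borel" for A
  proof -
    let ?G = "range (\<lambda>(a, b). {a<..<b::real})"
    have gen: "sets (borel :: real measure) = sigma_sets UNIV ?G"
      unfolding borel_eq_box box_real by (subst sets_measure_of) auto
    have "Int_stable ?G"
    proof (rule Int_stableI)
      fix A B assume "A \<in> ?G" "B \<in> ?G"
      then obtain a b c d where "A = {a<..<b}" "B = {c<..<d}" by auto
      then have "A \<inter> B = {max a c<..<min b d}" by auto
      then show "A \<inter> B \<in> ?G" by auto
    qed
    moreover have "?G \<subseteq> Pow UNIV" by simp
    ultimately show ?thesis using that unfolding gen
    proof (induction A rule: sigma_sets_induct_disjoint[consumes 3])
      case (basic A)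
      then show ?case using z by auto
    next
      case empty
      then show ?case by (simp add: set_lebesgue_integral_def)
    next
      case (compl A)
      then have A: "A \<in> sets lebesgue"
        using gen by simp
      have "(LINT t:UNIV|lebesgue. f t) = (LINT t:A \<union> (UNIV - A)|lebesgue. f t)" by simp
      also have "\<dots> = (LINT t:A|lebesgue. f t) + (LINT t:UNIV - A|lebesgue. f t)"
        using A by (intro set_integral_Un si) auto
      finally show ?case using compl zU by (simp add: set_lebesgue_integral_def)
    next
      case (union A)
      have A: "A i \<in> sets lebesgue" for i
      proof -
        have "A i \<in> sets borel" using union(2) gen by auto
        then show ?thesis by simp
      qed
      have "(LINT x:(\<Union>i. A i)|lebesgue. f x) = (\<Sum>i. (LINT x:(A i)|lebesgue. f x))"
        using A union(1) by (intro lebesgue_integral_countable_add si) (auto simp: disjoint_family_on_def)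
      then show ?case using union(3) by simp
    qed
  qed
  fix A assume A: "A \<in> sets (lebesgue::real measure)"
  then obtain S N N' where S: "A = S \<union> N" "N \<subseteq> N'" "N' \<in> null_sets lborel" "S \<in> sets lborel"
    by (rule sets_completionE)
  have "N' \<in> null_sets lebesgue" using S(3) by (rule null_sets_completionI)
  then have "AE x in lebesgue. x \<notin> N'" by (rule AE_not_in)
  then have "AE x in lebesgue. x \<in> A \<longleftrightarrow> x \<in> S" using S by (auto elim!: eventually_mono)
  then have "(LINT t:A|lebesgue. f t) = (LINT t:S|lebesgue. f t)"
    using A S(4) borel_measurable_integrable[OF f]
    by (intro set_integral_cong_set)
       (auto simp: set_borel_measurable_def intro!: borel_measurable_scaleR borel_measurable_indicator)
  then show "(LINT t:A|lebesgue. f t) = 0" using borel[of S] S(4) by simp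
qed

lemma bump_tendsto_indicator:
  assumes "a < b"
  shows "(\<lambda>n. bump (Suc n) a b x) \<longlonglongrightarrow> indicator {a<..<b} x"
proof (cases "x \<in> {a<..<b}")
  case True
  define q where "q = (x - a) * (b - x)"
  have q: "q > 0" using True by (simp add: q_def)
  have "(\<lambda>n. - (1 / q) * (1 / real (Suc n))) \<longlonglongrightarrow> - (1 / q) * 0"
    by (intro tendsto_intros lim_1_over_n[THEN LIMSEQ_Suc])
  then have "(\<lambda>n. exp (- (1 / q) * (1 / real (Suc n)))) \<longlonglongrightarrow> exp 0"
    by (intro tendsto_intros) simp
  moreover have "bump (Suc n) a b x = exp (- (1 / q) * (1 / real (Suc n)))" for n
    unfolding bump_def q_def[symmetric] flat_def using q by (simp add: mult_ac del: of_nat_Suc)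
  ultimately show ?thesis using True by simp
next
  case False
  then show ?thesis using bump_outside[OF _ False assms] by simp
qed

lemma AE_zero_if_bump_integrals_zero:
  fixes h :: "real \<Rightarrow> complex"
  assumes li: "locally_integrable {0<..<1} h"
    and z: "\<And>n a b. 0 < a \<Longrightarrow> a < b \<Longrightarrow> b < 1 \<Longrightarrow>
             (LINT x|lebesgue_on {0<..<1}. h x * of_real (bump (Suc n) a b x)) = 0"
  shows "AE x in lebesgue_on {0<..<1}. h x = 0"
proof -
  have si: "set_integrable lebesgue {a..b} h" if "0 < a" "b < 1" for a b
  proof -
    have "{a..b} \<subseteq> {0<..<1}" using that by auto
    then show ?thesis using li by (simp add: locally_integrable_def)
  qed
  have I: "(LINT t:{a<..<b}|lebesgue. h t) = 0" if ab: "0 < a" "b < 1" for a b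
  proof (cases "a < b")
    case False
    then show ?thesis by (simp add: set_lebesgue_integral_def)
  next
    case True
    let ?h = "\<lambda>x. indicator {a..b} x *\<^sub>R h x"
    have ih: "integrable lebesgue ?h" using si[OF ab] by (simp add: set_integrable_def)
    then have hm: "?h \<in> borel_measurable lebesgue" by auto
    have bm: "bump (Suc n) a b \<in> borel_measurable lebesgue" for n
      using borel_measurable_continuous_onI[OF continuous_on_bump] by (simp add: measurable_completion)
    have "(\<lambda>n. LINT x|lebesgue. ?h x * of_real (bump (Suc n) a b x)) \<longlonglongrightarrow>
        (LINT x|lebesgue. ?h x * of_real (indicator {a<..<b} x))"
    proof (rule integral_dominated_convergence[where w = "\<lambda>x. cmod (?h x)"])
      show "(\<lambda>x. ?h x * of_real (indicator {a<..<b} x)) \<in> borel_measurable lebesgue"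
        by (rule borel_measurable_times[OF hm measurable_compose[OF borel_measurable_indicator borel_measurable_of_real]]) simp
      show "(\<lambda>x. ?h x * of_real (bump (Suc n) a b x)) \<in> borel_measurable lebesgue" for n
        by (rule borel_measurable_times[OF hm measurable_compose[OF bm borel_measurable_of_real]])
      show "integrable lebesgue (\<lambda>x. cmod (?h x))" by (rule integrable_norm[OF ih])
      show "AE x in lebesgue. (\<lambda>n. ?h x * of_real (bump (Suc n) a b x)) \<longlonglongrightarrow> ?h x * of_real (indicator {a<..<b} x)"
        by (intro AE_I2 tendsto_intros bump_tendsto_indicator True)
      show "AE x in lebesgue. cmod (?h x * of_real (bump (Suc n) a b x)) \<le> cmod (?h x)" for n
      proof (rule AE_I2)
        fix x
        have "cmod (of_real (bump (Suc n) a b x)) \<le> 1" using flat_bounds by (simp add: bump_def)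
        then show "cmod (?h x * of_real (bump (Suc n) a b x)) \<le> cmod (?h x)"
          unfolding norm_mult[of "?h x"] by (rule mult_right_le_one_le[OF norm_ge_zero norm_ge_zero])
      qed
    qed
    moreover have "(LINT x|lebesgue. ?h x * of_real (bump (Suc n) a b x)) = 0" for n
    proof -
      have "(LINT x|lebesgue. ?h x * of_real (bump (Suc n) a b x))
          = (LINT x|lebesgue. indicator {0<..<1} x *\<^sub>R (h x * of_real (bump (Suc n) a b x)))"
      proof (rule Bochner_Integration.integral_cong[OF refl])
        fix x
        show "?h x * of_real (bump (Suc n) a b x) = indicator {0<..<1} x *\<^sub>R (h x * of_real (bump (Suc n) a b x))"
        proof (cases "x \<in> {a<..<b}")
          case False
          then show ?thesis using bump_outside[OF _ False True] by simp
        next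
          case True
          then show ?thesis using ab by (simp add: indicator_def)
        qed
      qed
      also have "\<dots> = (LINT x|lebesgue_on {0<..<1}. h x * of_real (bump (Suc n) a b x))"
        by (subst integral_restrict_space) auto
      finally show ?thesis using z ab True by simp
    qed
    ultimately have "(LINT x|lebesgue. ?h x * of_real (indicator {a<..<b} x)) = 0"
      by (simp add: LIMSEQ_const_iff)
    also have "(\<lambda>x. ?h x * of_real (indicator {a<..<b} x)) = (\<lambda>x. indicator {a<..<b} x *\<^sub>R h x)"
      by (auto simp: indicator_def)
    finally show ?thesis by (simp add: set_lebesgue_integral_def)
  qed
  have "AE x in lebesgue. x \<in> {1 / (real n + 3)<..<1 - 1 / (real n + 3)} \<longrightarrow> h x = 0" for n
  proof -
    define \<alpha> where "\<alpha> = 1 / (real n + 3)"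
    have \<alpha>: "0 < \<alpha>" "1 - \<alpha> < 1" by (auto simp: \<alpha>_def)
    let ?f = "\<lambda>x. indicator {\<alpha><..<1 - \<alpha>} x *\<^sub>R h x"
    have "set_integrable lebesgue {\<alpha><..<1 - \<alpha>} h"
      by (rule set_integrable_subset[OF si[OF \<alpha>]]) auto
    then have f: "integrable lebesgue ?f" by (simp add: set_integrable_def)
    have 1: "(LINT t:{x<..<y}|lebesgue. ?f t) = 0" for x y
    proof -
      have "(LINT t:{x<..<y}|lebesgue. ?f t) = (LINT t:{max x \<alpha><..<min y (1 - \<alpha>)}|lebesgue. h t)"
        unfolding set_lebesgue_integral_def
        by (rule Bochner_Integration.integral_cong) (auto simp: indicator_def)
      also have "\<dots> = 0" by (rule I) (use \<alpha> in auto)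
      finally show ?thesis .
    qed
    have "AE x in lebesgue. ?f x = 0"
      by (rule AE_zero_if_interval_integrals_zero[OF f 1])
         (use I[OF \<alpha>] in \<open>simp add: set_lebesgue_integral_def\<close>)
    then show ?thesis unfolding \<alpha>_def[symmetric] by (auto elim!: eventually_mono simp: indicator_def)
  qed
  then have "AE x in lebesgue. \<forall>n. x \<in> {1 / (real n + 3)<..<1 - 1 / (real n + 3)} \<longrightarrow> h x = 0"
    by (subst AE_all_countable) blast
  then have "AE x in lebesgue. x \<in> {0<..<1} \<longrightarrow> h x = 0"
  proof (rule AE_mp, intro AE_I2 impI)
    fix x :: real assume a: "\<forall>n. x \<in> {1 / (real n + 3)<..<1 - 1 / (real n + 3)} \<longrightarrow> h x = 0" and x: "x \<in> {0<..<1}"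
    define e where "e = min x (1 - x)"
    have e: "e > 0" using x by (simp add: e_def)
    obtain n where n: "1 / real (Suc n) < e" using nat_approx_posE[OF e] by auto
    have "1 / (real n + 3) \<le> 1 / real (Suc n)" by (rule divide_left_mono) auto
    then have "1 / (real n + 3) < x" "x < 1 - 1 / (real n + 3)" using n by (auto simp: e_def)
    then show "h x = 0" using a by auto
  qed
  then show ?thesis by (subst AE_restrict_space_iff) auto
qed

text \<open>
  The weak derivative is specified only by a choice operator; uniqueness up to null sets allows it
  to be replaced by a known derivative inside integrals.
\<close>

lemma weak_deriv_unique:
  assumes "has_weak_deriv {0<..<1::real} 1 u g1" "has_weak_deriv {0<..<1} 1 u g2"
  shows "AE x in lebesgue_on {0<..<1}. g1 x = g2 x"
proof -
  let ?N = "lebesgue_on {0<..<1::real}"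
  have li: "locally_integrable {0<..<1} g1" "locally_integrable {0<..<1} g2"
    using assms by (auto simp: has_weak_deriv_def)
  then have "locally_integrable {0<..<1} (\<lambda>x. g1 x - g2 x)"
    by (auto simp: locally_integrable_def intro: set_integral_diff)
  moreover have "(LINT x|?N. (g1 x - g2 x) * of_real (bump (Suc n) a b x)) = 0"
    if ab: "0 < a" "a < b" "b < 1" for n a b
  proof -
    have t: "(\<lambda>x. 1 * bump (Suc n) a b x) \<in> test_functions {0<..<1}"
      using ab by (intro bump_test_function real_polynomial_function.intros(2)) auto
    then have t: "bump (Suc n) a b \<in> test_functions {0<..<1}" by simp
    have e: "(LINT x|?N. g1 x * of_real (bump (Suc n) a b x)) = (LINT x|?N. g2 x * of_real (bump (Suc n) a b x))"
      using weak_deriv_test[OF assms(1) t bump_deriv] weak_deriv_test[OF assms(2) t bump_deriv] by simp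
    have i: "integrable ?N (\<lambda>x. v x * of_real (bump (Suc n) a b x))" if "locally_integrable {0<..<1} v" for v
    proof -
      have iv: "integrable ?N (\<lambda>x. indicator {a..b} x *\<^sub>R v x)"
        using that ab by (intro locally_integrable_indicator) auto
      have bm: "bump (Suc n) a b \<in> borel_measurable ?N"
        by (rule continuous_imp_measurable_on_sets_lebesgue[OF continuous_on_bump]) auto
      have "integrable ?N (\<lambda>x. (indicator {a..b} x *\<^sub>R v x) * of_real (bump (Suc n) a b x))"
      proof (rule Bochner_Integration.integrable_bound[OF iv])
        show "(\<lambda>x. (indicator {a..b} x *\<^sub>R v x) * of_real (bump (Suc n) a b x)) \<in> borel_measurable ?N"
          using iv bm by (intro borel_measurable_times borel_measurable_of_real) auto
        show "AE x in ?N. cmod (indicator {a..b} x *\<^sub>R v x * of_real (bump (Suc n) a b x)) \<le> cmod (indicator {a..b} x *\<^sub>R v x)"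
          unfolding norm_mult[of "indicator {a..b} _ *\<^sub>R v _"]
          by (intro AE_I2 mult_right_le_one_le) (use flat_bounds in \<open>auto simp: bump_def\<close>)
      qed
      also have "(\<lambda>x. (indicator {a..b} x *\<^sub>R v x) * of_real (bump (Suc n) a b x)) = (\<lambda>x. v x * of_real (bump (Suc n) a b x))"
        using bump_outside[of "Suc n" _ a b] ab by (force simp: indicator_def)
      finally show ?thesis .
    qed
    show ?thesis
      by (simp only: left_diff_distrib Bochner_Integration.integral_diff[OF i[OF li(1)] i[OF li(2)]] e) simp
  qed
  ultimately have "AE x in ?N. g1 x - g2 x = 0" by (rule AE_zero_if_bump_integrals_zero)
  then show ?thesis by simp
qed
section \<open>Green's formula for the radial form\<close>

abbreviation unit_lebesgue :: "real measure" where
  "unit_lebesgue \<equiv> lebesgue_on {0<..<1}"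

lemma continuous_measurable_unit:
  fixes f :: "real \<Rightarrow> 'a::euclidean_space"
  shows "continuous_on {0<..<1} f \<Longrightarrow> f \<in> borel_measurable unit_lebesgue"
  by (rule continuous_imp_measurable_on_sets_lebesgue) auto

lemma ident_measurable_unit [measurable]: "(\<lambda>r. r) \<in> borel_measurable unit_lebesgue"
  by (intro continuous_measurable_unit continuous_intros)

lemma finite_unit_lebesgue: "finite_measure unit_lebesgue"
  by (rule finite_measure_lebesgue_on) (metis box_real(1) lmeasurable_box)

lemma integrable_unit_bounded:
  fixes f :: "real \<Rightarrow> 'a::{banach, second_countable_topology}"
  assumes "f \<in> borel_measurable unit_lebesgue" "\<And>r. r \<in> {0<..<1} \<Longrightarrow> norm (f r) \<le> B"
  shows "integrable unit_lebesgue f"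
  by (rule finite_measure.integrable_const_bound[OF finite_unit_lebesgue, of _ B])
     (use assms in \<open>auto intro!: AE_I2\<close>)

lemma locally_integrable_measurable:
  fixes g :: "real \<Rightarrow> complex"
  assumes "locally_integrable {0<..<1} g"
  shows "g \<in> borel_measurable unit_lebesgue"
proof (rule borel_measurable_LIMSEQ_metric)
  let ?f = "\<lambda>n x. indicator {1 / (real n + 3)..1 - 1 / (real n + 3)} x *\<^sub>R g x"
  show "?f n \<in> borel_measurable unit_lebesgue" for n
    by (rule borel_measurable_integrable[OF locally_integrable_indicator[OF assms]]) auto
  fix x assume "x \<in> space unit_lebesgue"
  then have x: "0 < x" "x < 1" by auto
  define e where "e = min x (1 - x)"
  have e: "e > 0" using x by (simp add: e_def)
  obtain m where m: "1 / real (Suc m) < e" using nat_approx_posE[OF e] by auto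
  have "eventually (\<lambda>n. ?f n x = g x) sequentially"
  proof (rule eventually_sequentiallyI[of m])
    fix n assume n: "m \<le> n"
    have "1 / (real n + 3) \<le> 1 / real (Suc m)" using n by (intro divide_left_mono) auto
    then have "1 / (real n + 3) \<le> x" "x \<le> 1 - 1 / (real n + 3)" using m by (auto simp: e_def)
    then show "?f n x = g x" by (simp add: indicator_def)
  qed
  then show "(\<lambda>n. ?f n x) \<longlonglongrightarrow> g x" by (rule tendsto_eventually)
qed

lemma measurable_radial [simp]: "borel_measurable radial_measure = borel_measurable unit_lebesgue"
  by (rule measurable_cong_sets) (auto simp: radial_measure_def)

lemma integrable_radial:
  fixes f :: "real \<Rightarrow> 'a::{banach, second_countable_topology}"
  assumes "f \<in> borel_measurable unit_lebesgue"
  shows "integrable radial_measure f \<longleftrightarrow> integrable unit_lebesgue (\<lambda>r. r *\<^sub>R f r)"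
  unfolding radial_measure_def by (rule integrable_density[OF assms]) (auto intro!: AE_I2)

lemma integral_radial:
  fixes f :: "real \<Rightarrow> 'a::{banach, second_countable_topology}"
  assumes "f \<in> borel_measurable unit_lebesgue"
  shows "integral\<^sup>L radial_measure f = integral\<^sup>L unit_lebesgue (\<lambda>r. r *\<^sub>R f r)"
  unfolding radial_measure_def by (rule integral_density[OF assms]) (auto intro!: AE_I2)

lemma AE_radial: "(AE r in radial_measure. P r) \<longleftrightarrow> (AE r in unit_lebesgue. P r)"
proof -
  have "(AE r in radial_measure. P r) \<longleftrightarrow> (AE r in unit_lebesgue. 0 < ennreal r \<longrightarrow> P r)"
    unfolding radial_measure_def by (rule AE_density) simp
  also have "\<dots> \<longleftrightarrow> (AE r in unit_lebesgue. P r)"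
    by (rule AE_cong) simp
  finally show ?thesis .
qed

lemma L2_radial:
  "u \<in> L2 radial_measure \<longleftrightarrow>
     u \<in> borel_measurable unit_lebesgue \<and> integrable unit_lebesgue (\<lambda>r. r * (cmod (u r))\<^sup>2)"
proof -
  have "integrable radial_measure (\<lambda>r. (cmod (u r))\<^sup>2) \<longleftrightarrow> integrable unit_lebesgue (\<lambda>r. r * (cmod (u r))\<^sup>2)"
    if "u \<in> borel_measurable unit_lebesgue"
    using that by (subst integrable_radial) auto
  then show ?thesis by (auto simp: L2_def)
qed

lemma L2_radial_integrable:
  assumes "u \<in> L2 radial_measure"
  shows "integrable unit_lebesgue (\<lambda>r. r *\<^sub>R u r)"
proof (rule Bochner_Integration.integrable_bound)
  have u: "u \<in> borel_measurable unit_lebesgue" "integrable unit_lebesgue (\<lambda>r. r * (cmod (u r))\<^sup>2)"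
    using assms by (auto simp: L2_radial)
  have "integrable unit_lebesgue (\<lambda>r. r)" by (rule integrable_unit_bounded[of _ 1]) auto
  then show "integrable unit_lebesgue (\<lambda>r. r + r * (cmod (u r))\<^sup>2)" using u by auto
  show "(\<lambda>r. r *\<^sub>R u r) \<in> borel_measurable unit_lebesgue" using u by measurable
  show "AE r in unit_lebesgue. norm (r *\<^sub>R u r) \<le> norm (r + r * (cmod (u r))\<^sup>2)"
  proof (rule AE_I2)
    fix r assume "r \<in> space unit_lebesgue"
    then have r: "0 < r" by simp
    have "2 * cmod (u r) \<le> 1 + (cmod (u r))\<^sup>2" using sum_squares_bound[of 1 "cmod (u r)"] by simp
    then have "cmod (u r) \<le> 1 + (cmod (u r))\<^sup>2" using norm_ge_zero[of "u r"] by linarith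
    then have "r * cmod (u r) \<le> r * (1 + (cmod (u r))\<^sup>2)" using r by (intro mult_left_mono) auto
    then show "norm (r *\<^sub>R u r) \<le> norm (r + r * (cmod (u r))\<^sup>2)"
      using r by (simp add: distrib_left)
  qed
qed

lemma form_domain_weak_deriv:
  assumes "v \<in> radial_form_domain n b"
  shows "has_weak_deriv {0<..<1} 1 v (weak_deriv {0<..<1} 1 v)"
    "weak_deriv {0<..<1} 1 v \<in> L2 radial_measure" "v \<in> L2 radial_measure"
proof -
  obtain g where g: "g \<in> L2 radial_measure" "has_weak_deriv {0<..<1} 1 v g"
    using assms by (auto simp: radial_form_domain_def)
  let ?g = "weak_deriv {0<..<1} 1 v"
  show w: "has_weak_deriv {0<..<1} 1 v ?g"
    unfolding weak_deriv_def by (rule someI[of _ g]) (rule g)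
  have m: "?g \<in> borel_measurable unit_lebesgue"
    by (rule locally_integrable_measurable) (use w in \<open>simp add: has_weak_deriv_def\<close>)
  have m': "g \<in> borel_measurable unit_lebesgue" using g by (simp add: L2_radial)
  have ae: "AE r in unit_lebesgue. g r = ?g r" using weak_deriv_unique[OF g(2) w] .
  have "integrable unit_lebesgue (\<lambda>r. r * (cmod (g r))\<^sup>2) \<longleftrightarrow> integrable unit_lebesgue (\<lambda>r. r * (cmod (?g r))\<^sup>2)"
  proof (rule integrable_cong_AE)
    show "AE r in unit_lebesgue. r * (cmod (g r))\<^sup>2 = r * (cmod (?g r))\<^sup>2"
      using ae by eventually_elim simp
  qed (use m m' in measurable)
  then show "?g \<in> L2 radial_measure" using m g by (auto simp: L2_radial)
  show "v \<in> L2 radial_measure" using assms by (simp add: radial_form_domain_def)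
qed

lemma potential_measurable [measurable]: "radial_potential n b \<in> borel_measurable unit_lebesgue"
  unfolding radial_potential_def[abs_def]
  by (intro continuous_measurable_unit continuous_intros) auto

text \<open>
  The two exponents treat \<open>n = 0\<close> and \<open>n > 0\<close> at once. Near \<open>0\<close> a regular function behaves like
  \<open>r ^ min n 1\<close> at worst if \<open>n > 0\<close>, which tames the singularity of the potential; for \<open>n = 0\<close> the
  potential is bounded, and a factor \<open>r ^ (1 - n) = r\<close> is left over.
\<close>

lemma radial_potential_weight_bound:
  assumes r: "r \<in> {0<..<1}"
  shows "r ^ min n 1 * (r * radial_potential n b r) \<le> (real n + \<bar>b\<bar>)\<^sup>2 * r ^ (1 - n)"
proof (cases n)
  case 0
  have "\<bar>b / 2 * r\<bar> \<le> \<bar>b\<bar> * 1" unfolding abs_mult using r by (intro mult_mono) auto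
  then have "(b / 2 * r)\<^sup>2 \<le> (real n + \<bar>b\<bar>)\<^sup>2" by (intro abs_le_square_iff[THEN iffD1]) simp
  then have "r * (b / 2 * r)\<^sup>2 \<le> r * (real n + \<bar>b\<bar>)\<^sup>2" using r by (intro mult_left_mono) auto
  then show ?thesis by (simp add: 0 radial_potential_def mult.commute)
next
  case (Suc m)
  have "r * (r * radial_potential n b r) = (r * (real n / r - b / 2 * r))\<^sup>2"
    by (simp add: radial_potential_def power2_eq_square)
  also have "r * (real n / r - b / 2 * r) = real n - b / 2 * r\<^sup>2"
    using r by (simp add: field_simps power2_eq_square)
  also have "(real n - b / 2 * r\<^sup>2)\<^sup>2 \<le> (real n + \<bar>b\<bar>)\<^sup>2"
  proof (rule abs_le_square_iff[THEN iffD1])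
    have "\<bar>b / 2 * r\<^sup>2\<bar> \<le> \<bar>b\<bar> * 1" unfolding abs_mult using r by (intro mult_mono) (auto simp: power_le_one)
    then show "\<bar>real n - b / 2 * r\<^sup>2\<bar> \<le> \<bar>real n + \<bar>b\<bar>\<bar>" by linarith
  qed
  finally show ?thesis by (simp add: Suc)
qed

text \<open>
  An element of the form domain is better than integrable with respect to \<open>r dr\<close> if \<open>n > 0\<close>: then
  the potential term controls \<open>|v|\<^sup>2 / r\<close>, and \<open>|v| \<le> r + |v|\<^sup>2 / r\<close>.
\<close>

lemma form_domain_weighted_integrable:
  assumes "v \<in> radial_form_domain n b"
  shows "integrable unit_lebesgue (\<lambda>r. r ^ (1 - n) *\<^sub>R v r)"
proof (cases n)
  case 0
  then show ?thesis using L2_radial_integrable form_domain_weak_deriv(3)[OF assms] by simp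
next
  case (Suc m)
  have v: "v \<in> borel_measurable unit_lebesgue" "integrable unit_lebesgue (\<lambda>r. r * (cmod (v r))\<^sup>2)"
    using form_domain_weak_deriv(3)[OF assms] by (auto simp: L2_radial)
  note [measurable] = v(1)
  have "integrable radial_measure (\<lambda>r. radial_potential n b r * (cmod (v r))\<^sup>2)"
    using assms by (simp add: radial_form_domain_def)
  then have V: "integrable unit_lebesgue (\<lambda>r. r * (radial_potential n b r * (cmod (v r))\<^sup>2))"
    by (subst (asm) integrable_radial) simp_all
  have I: "integrable unit_lebesgue (\<lambda>r. r)" by (rule integrable_unit_bounded[of _ 1]) auto
  have "integrable unit_lebesgue v"
  proof (rule Bochner_Integration.integrable_bound)
    let ?w = "\<lambda>r. r + (2 * (r * (radial_potential n b r * (cmod (v r))\<^sup>2)) + b\<^sup>2 / 2 * (r * (cmod (v r))\<^sup>2))"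
    show "integrable unit_lebesgue ?w" using I V v by auto
    show "AE r in unit_lebesgue. norm (v r) \<le> norm (?w r)"
    proof (rule AE_I2)
      fix r assume "r \<in> space unit_lebesgue"
      then have r: "0 < r" "r < 1" by auto
      define c where "c = cmod (v r)"
      have c: "c \<ge> 0" by (simp add: c_def)
      have "2 * (r * c) \<le> r\<^sup>2 + c\<^sup>2" using sum_squares_bound[of r c] by simp
      then have "r * c \<le> r\<^sup>2 + c\<^sup>2" using mult_nonneg_nonneg[of r c] r c by linarith
      then have 1: "c \<le> r + c\<^sup>2 / r" using r by (simp add: field_simps power2_eq_square)
      have s: "(1 / r)\<^sup>2 \<le> (real n / r)\<^sup>2"
        using r Suc by (intro power_mono divide_right_mono) auto
      have "x\<^sup>2 \<le> 2 * (x - b / 2 * r)\<^sup>2 + b\<^sup>2 / 2 * r\<^sup>2" for x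
      proof -
        have "2 * (x - b / 2 * r)\<^sup>2 + b\<^sup>2 / 2 * r\<^sup>2 - x\<^sup>2 = (x - b * r)\<^sup>2"
          by (simp add: power2_eq_square field_simps)
        then show ?thesis using zero_le_power2[of "x - b * r"] by linarith
      qed
      then have "(real n / r)\<^sup>2 \<le> 2 * radial_potential n b r + b\<^sup>2 / 2 * r\<^sup>2"
        unfolding radial_potential_def .
      also have "\<dots> \<le> 2 * radial_potential n b r + b\<^sup>2 / 2 * 1"
        using r by (intro add_left_mono mult_left_mono) (auto simp: power_le_one)
      finally have "(1 / r)\<^sup>2 \<le> 2 * radial_potential n b r + b\<^sup>2 / 2" using s by simp
      then have "r * c\<^sup>2 * (1 / r)\<^sup>2 \<le> r * c\<^sup>2 * (2 * radial_potential n b r + b\<^sup>2 / 2)"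
        using r by (intro mult_left_mono) auto
      also have "r * c\<^sup>2 * (1 / r)\<^sup>2 = c\<^sup>2 / r" using r by (simp add: power2_eq_square field_simps)
      finally have "c \<le> ?w r" using 1 unfolding c_def[symmetric] by (simp add: algebra_simps)
      then show "norm (v r) \<le> norm (?w r)" unfolding c_def by simp
    qed
  qed measurable
  then show ?thesis using Suc by simp
qed

text \<open>
  The functions against which form-domain elements are tested: \<open>\<psi>\<close> has derivative \<open>D\<close>, and \<open>E\<close> is
  the derivative of the flux \<open>r D\<close>. The bound by \<open>1 - r\<close> is the Neumann condition at \<open>1\<close>; the
  bounds by powers of \<open>r\<close> express regularity at \<open>0\<close>, where \<open>D\<close> of order \<open>r\<close> is required only for \<open>n = 0\<close>.
\<close>

definition neumann_regular ::
  "nat \<Rightarrow> (real \<Rightarrow> real) \<Rightarrow> (real \<Rightarrow> real) \<Rightarrow> (real \<Rightarrow> real) \<Rightarrow> bool" where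
  "neumann_regular n \<psi> D E \<longleftrightarrow>
     (\<forall>r\<in>{0<..<1}. (\<psi> has_real_derivative D r) (at r) \<and>
                   ((\<lambda>s. s * D s) has_real_derivative E r) (at r)) \<and>
     continuous_on {0<..<1} E \<and>
     (\<exists>C. \<forall>r\<in>{0<..<1}. \<bar>\<psi> r\<bar> \<le> C * r ^ min n 1 \<and> \<bar>D r\<bar> \<le> C * r ^ (1 - n) \<and>
                     \<bar>D r\<bar> \<le> C * (1 - r) \<and> \<bar>E r\<bar> \<le> C * r ^ (1 - n))"

lemma neumann_regular_continuous:
  assumes "neumann_regular n \<psi> D E"
  shows "continuous_on {0<..<1} \<psi>" "continuous_on {0<..<1} D" "continuous_on {0<..<1} E"
proof -
  show "continuous_on {0<..<1} \<psi>"
    using assms by (auto simp: neumann_regular_def intro!: continuous_at_imp_continuous_on dest!: DERIV_isCont)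
  have "continuous_on {0<..<1} (\<lambda>s. s * D s)"
  proof (intro continuous_at_imp_continuous_on ballI)
    fix r :: real assume "r \<in> {0<..<1}"
    then have "((\<lambda>s. s * D s) has_real_derivative E r) (at r)" using assms by (auto simp: neumann_regular_def)
    then show "isCont (\<lambda>s. s * D s) r" by (rule DERIV_isCont)
  qed
  then have "continuous_on {0<..<1} (\<lambda>s. s * D s / s)"
    by (rule continuous_on_divide[OF _ continuous_on_id]) auto
  then show "continuous_on {0<..<1} D" by (rule continuous_on_eq) simp
  show "continuous_on {0<..<1} E" using assms by (auto simp: neumann_regular_def)
qed

lemma sq_pos_part_deriv: "((\<lambda>x::real. (max 0 x)\<^sup>2) has_real_derivative 2 * max 0 x) (at x)"
proof -
  consider "x > 0" | "x < 0" | "x = 0" by linarith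
  then show ?thesis
  proof cases
    case 1
    have "((\<lambda>x::real. x\<^sup>2) has_real_derivative 2 * max 0 x) (at x)"
      using 1 by (auto intro!: derivative_eq_intros)
    then show ?thesis
      by (rule has_field_derivative_transform_within_open[OF _ open_greaterThan[of 0]]) (use 1 in auto)
  next
    case 2
    have "((\<lambda>x::real. 0) has_real_derivative 2 * max 0 x) (at x)" using 2 by simp
    then show ?thesis
      by (rule has_field_derivative_transform_within_open[OF _ open_lessThan[of 0]]) (use 2 in auto)
  next
    case 3
    have "((\<lambda>h::real. ((max 0 (0 + h))\<^sup>2 - (max 0 0)\<^sup>2) / h) \<longlongrightarrow> 0) (at 0)"
    proof (rule Lim_null_comparison)
      show "eventually (\<lambda>h. norm (((max 0 (0 + h))\<^sup>2 - (max 0 0)\<^sup>2) / h) \<le> \<bar>h\<bar>) (at (0::real))"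
        by (rule always_eventually) (auto simp: max_def power2_eq_square)
      show "((\<lambda>h::real. \<bar>h\<bar>) \<longlongrightarrow> 0) (at 0)" by (rule tendsto_rabs_zero[OF tendsto_ident_at])
    qed
    then show ?thesis using 3 by (simp add: DERIV_def del: add_0_left)
  qed
qed

text \<open>
  A \<open>C\<^sup>1\<close> cutoff at both ends of the unit interval. Its support is contained in \<open>{e..1 - e}\<close>, and its
  derivative is bounded by \<open>2 / (r (1 - r))\<close> uniformly in \<open>e\<close>.
\<close>

definition cutoff :: "real \<Rightarrow> real \<Rightarrow> real" where
  "cutoff e r = (max 0 (1 - e / (r * (1 - r))))\<^sup>2"

definition cutoff' :: "real \<Rightarrow> real \<Rightarrow> real" where
  "cutoff' e r = 2 * max 0 (1 - e / (r * (1 - r))) * (e * (1 - 2 * r) / (r * (1 - r))\<^sup>2)"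

lemma cutoff_deriv:
  assumes "r \<in> {0<..<1}"
  shows "(cutoff e has_real_derivative cutoff' e r) (at r)"
proof -
  have "((\<lambda>r. 1 - e / (r * (1 - r))) has_real_derivative e * (1 - 2 * r) / (r * (1 - r))\<^sup>2) (at r)"
    using assms by (auto intro!: derivative_eq_intros simp: power2_eq_square)
  then show ?thesis
    unfolding cutoff_def[abs_def] cutoff'_def by (rule DERIV_chain2[OF sq_pos_part_deriv])
qed

lemma cutoff_bounds:
  assumes "r \<in> {0<..<1}" "e > 0"
  shows "\<bar>cutoff e r\<bar> \<le> 1" "\<bar>cutoff' e r\<bar> \<le> 2 / (r * (1 - r))"
proof -
  define j where "j = r * (1 - r)"
  have j: "j > 0" using assms by (simp add: j_def)
  have m: "0 \<le> max 0 (1 - e / j)" "max 0 (1 - e / j) \<le> 1" using j assms by auto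
  show "\<bar>cutoff e r\<bar> \<le> 1"
    unfolding cutoff_def j_def[symmetric] using m by (simp add: power_le_one)
  show "\<bar>cutoff' e r\<bar> \<le> 2 / (r * (1 - r))"
  proof (cases "e \<le> j")
    case True
    have "\<bar>cutoff' e r\<bar> = 2 * max 0 (1 - e / j) * (e / j * \<bar>1 - 2 * r\<bar> / j)"
      unfolding cutoff'_def j_def[symmetric] using j assms m by (simp add: abs_mult power2_eq_square)
    also have "\<dots> \<le> 2 * 1 * (1 * 1 / j)"
      using m True j assms by (intro mult_mono divide_right_mono) auto
    finally show ?thesis by (simp add: j_def)
  next
    case False
    then have "1 - e / j \<le> 0" using j by simp
    then show ?thesis using j unfolding cutoff'_def j_def[symmetric] by simp
  qed
qed

lemma cutoff_limits:
  assumes "r \<in> {0<..<1}"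
  shows "(\<lambda>k. cutoff (1 / (real k + 5)) r) \<longlonglongrightarrow> 1" "(\<lambda>k. cutoff' (1 / (real k + 5)) r) \<longlonglongrightarrow> 0"
proof -
  have e: "(\<lambda>k. 1 / (real k + 5)) \<longlonglongrightarrow> 0" 
    by (rule Lim_null_comparison[OF _ lim_1_over_n]) (auto intro!: eventually_sequentiallyI[of 1] divide_left_mono)
  have "(\<lambda>k. (max 0 (1 - 1 / (real k + 5) / (r * (1 - r))))\<^sup>2) \<longlonglongrightarrow> (max 0 (1 - 0 / (r * (1 - r))))\<^sup>2"
    using assms by (intro tendsto_intros e) auto
  then show "(\<lambda>k. cutoff (1 / (real k + 5)) r) \<longlonglongrightarrow> 1" by (simp add: cutoff_def)
  have "(\<lambda>k. 2 * max 0 (1 - 1 / (real k + 5) / (r * (1 - r))) * (1 / (real k + 5) * (1 - 2 * r) / (r * (1 - r))\<^sup>2))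
        \<longlonglongrightarrow> 2 * max 0 (1 - 0 / (r * (1 - r))) * (0 * (1 - 2 * r) / (r * (1 - r))\<^sup>2)"
    using assms by (intro tendsto_intros e) auto
  then show "(\<lambda>k. cutoff' (1 / (real k + 5)) r) \<longlonglongrightarrow> 0" unfolding cutoff'_def by simp
qed

lemma cutoff_zero:
  assumes r: "r \<in> {0<..<1}" "r \<notin> {e..1 - e}" and e: "e > 0"
  shows "cutoff e r = 0" "cutoff' e r = 0"
proof -
  have "r * (1 - r) \<le> r * 1" "r * (1 - r) \<le> 1 * (1 - r)" using r by (auto intro!: mult_mono)
  then have "r * (1 - r) < e" using r(2) by auto
  then have "1 - e / (r * (1 - r)) \<le> 0" using r(1) by simp
  then have "max 0 (1 - e / (r * (1 - r))) = 0" by simp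
  then show "cutoff e r = 0" "cutoff' e r = 0" by (auto simp: cutoff_def cutoff'_def)
qed

text \<open>
  Integration by parts holds for the flux times a cutoff, which has compact support. The flux is
  of order \<open>r (1 - r)\<close>, up to a weight against which \<open>v\<close> is integrable, so it absorbs the bound
  \<open>2 / (r (1 - r))\<close> on the derivative of the cutoff, and dominated convergence removes the cutoff.
\<close>

lemma neumann_regular_parts:
  assumes reg: "neumann_regular n \<psi> D E" and v: "v \<in> radial_form_domain n b"
    and g: "has_weak_deriv {0<..<1} 1 v g" "g \<in> L2 radial_measure"
  shows "integrable unit_lebesgue (\<lambda>r. v r * of_real (E r))"
    "integrable unit_lebesgue (\<lambda>r. g r * of_real (r * D r))"
    "(LINT r|unit_lebesgue. v r * of_real (E r)) = - (LINT r|unit_lebesgue. g r * of_real (r * D r))"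
proof -
  note cont = neumann_regular_continuous[OF reg]
  obtain C where C: "\<And>r. r \<in> {0<..<1} \<Longrightarrow> \<bar>D r\<bar> \<le> C * r ^ (1 - n) \<and> \<bar>D r\<bar> \<le> C * (1 - r) \<and> \<bar>E r\<bar> \<le> C * r ^ (1 - n)"
    using reg unfolding neumann_regular_def by blast
  have C0: "C \<ge> 0"
  proof -
    have "\<bar>D (1/2)\<bar> \<le> C * (1 - 1/2)" using C[of "1/2"] by simp
    then show ?thesis by simp
  qed
  \<comment> \<open>The weight against which \<open>v\<close> is integrable.\<close>
  define \<kappa> where "\<kappa> = (\<lambda>r::real. r ^ (1 - n))"
  have k: "\<kappa> r \<ge> 0" "\<kappa> r \<ge> r" "\<kappa> r \<le> 1" if "r \<in> {0<..<1}" for r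
    using that by (cases n; simp add: \<kappa>_def)+
  have mv: "v \<in> borel_measurable unit_lebesgue" and mg: "g \<in> borel_measurable unit_lebesgue"
    using form_domain_weak_deriv(3)[OF v] g by (auto simp: L2_radial)
  note [measurable] = mv mg
  have mD: "D \<in> borel_measurable unit_lebesgue" and mE: "E \<in> borel_measurable unit_lebesgue"
    using cont by (auto intro: continuous_measurable_unit)
  note [measurable] = mD mE
  have iv: "integrable unit_lebesgue (\<lambda>r. 5 * C * norm (\<kappa> r *\<^sub>R v r))"
    unfolding \<kappa>_def by (intro integrable_mult_right integrable_norm form_domain_weighted_integrable[OF v])
  have ig: "integrable unit_lebesgue (\<lambda>r. C * norm (r *\<^sub>R g r))"
    by (intro integrable_mult_right integrable_norm L2_radial_integrable[OF g(2)])
  \<comment> \<open>The offset ensures \<open>e k < 1 - e k\<close>.\<close>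
  define e where "e = (\<lambda>k::nat. 1 / (real k + 5))"
  have e: "e k > 0" "e k < 1 - e k" for k by (auto simp: e_def field_simps)
  define \<psi>' where "\<psi>' = (\<lambda>k r. r * D r * cutoff' (e k) r + E r * cutoff (e k) r)"
  have d: "((\<lambda>r. r * D r * cutoff (e k) r) has_real_derivative \<psi>' k r) (at r)" if r: "r \<in> {0<..<1}" for k r
  proof -
    have "((\<lambda>s. s * D s) has_real_derivative E r) (at r)" using reg r by (auto simp: neumann_regular_def)
    from DERIV_mult[OF this cutoff_deriv[OF r]] show ?thesis unfolding \<psi>'_def
      by (rule DERIV_cong) (simp add: algebra_simps)
  qed
  have cc: "continuous_on {0<..<1} (cutoff (e k))" for k
    using cutoff_deriv by (meson DERIV_isCont continuous_at_imp_continuous_on)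
  have cc': "continuous_on {0<..<1} (cutoff' (e k))" for k
    unfolding cutoff'_def by (intro continuous_intros) auto
  have c\<psi>': "continuous_on {0<..<1} (\<psi>' k)" for k
    unfolding \<psi>'_def by (intro continuous_intros cont cc cc')
  have eq: "(LINT r|unit_lebesgue. v r * of_real (\<psi>' k r)) = - (LINT r|unit_lebesgue. g r * of_real (r * D r * cutoff (e k) r))" for k
    by (rule weak_deriv_C1[OF g(1), of "e k" "1 - e k", OF _ _ _ d c\<psi>'])
       (use e[of k] cutoff_zero[of _ "e k"] in \<open>auto simp: \<psi>'_def\<close>)
  have bE: "norm (v r * of_real (E r)) \<le> 5 * C * norm (\<kappa> r *\<^sub>R v r)" if r: "r \<in> {0<..<1}" for r
  proof -
    have "\<bar>E r\<bar> \<le> 5 * (C * \<kappa> r)" using C[OF r] mult_nonneg_nonneg[OF C0 k(1)[OF r]] unfolding \<kappa>_def by linarith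
    then have "cmod (v r) * \<bar>E r\<bar> \<le> cmod (v r) * (5 * (C * \<kappa> r))" by (intro mult_left_mono) auto
    then show ?thesis using k[OF r] by (simp add: norm_mult mult_ac)
  qed
  have b\<psi>': "norm (v r * of_real (\<psi>' k r)) \<le> 5 * C * norm (\<kappa> r *\<^sub>R v r)" if r: "r \<in> {0<..<1}" for r k
  proof -
    have "\<bar>D r\<bar> / (1 - r) \<le> 2 * (C * \<kappa> r)"
    proof (cases "r \<le> 1/2")
      case True
      have "\<bar>D r\<bar> / (1 - r) \<le> C * \<kappa> r / (1 / 2)"
        using C[OF r] True r mult_nonneg_nonneg[OF C0 k(1)[OF r]] unfolding \<kappa>_def by (intro frac_le) auto
      then show ?thesis by simp
    next
      case False
      have "\<bar>D r\<bar> / (1 - r) \<le> C" using C[OF r] r by (subst pos_divide_le_eq) auto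
      also have "\<dots> \<le> C * (2 * \<kappa> r)" using C0 k(2)[OF r] False by (simp add: mult_le_cancel_left1)
      finally show ?thesis by simp
    qed
    moreover have "\<bar>r * D r * cutoff' (e k) r\<bar> \<le> 2 * (\<bar>D r\<bar> / (1 - r))"
    proof -
      have "\<bar>r * D r * cutoff' (e k) r\<bar> \<le> r * \<bar>D r\<bar> * (2 / (r * (1 - r)))"
        unfolding abs_mult using cutoff_bounds(2)[OF r e(1)] r by (intro mult_mono) auto
      also have "\<dots> = 2 * (\<bar>D r\<bar> / (1 - r))" using r by simp
      finally show ?thesis .
    qed
    moreover have "\<bar>E r * cutoff (e k) r\<bar> \<le> C * \<kappa> r * 1"
      unfolding abs_mult using C[OF r] cutoff_bounds(1)[OF r e(1)[of k]] unfolding \<kappa>_def by (intro mult_mono) auto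
    ultimately have "\<bar>\<psi>' k r\<bar> \<le> 5 * (C * \<kappa> r)" unfolding \<psi>'_def by linarith
    then have "cmod (v r) * \<bar>\<psi>' k r\<bar> \<le> cmod (v r) * (5 * (C * \<kappa> r))" by (intro mult_left_mono) auto
    then show ?thesis using k[OF r] by (simp add: norm_mult mult_ac)
  qed
  have D1: "\<bar>D r\<bar> \<le> C" if r: "r \<in> {0<..<1}" for r
    using C[OF r] mult_left_mono[OF k(3)[OF r] C0] by (simp add: \<kappa>_def)
  have bg: "norm (g r * of_real (r * D r * c)) \<le> C * norm (r *\<^sub>R g r)" if r: "r \<in> {0<..<1}" and c: "\<bar>c\<bar> \<le> 1" for r c
  proof -
    have "\<bar>D r\<bar> * \<bar>c\<bar> \<le> C * 1" using D1[OF r] c C0 by (intro mult_mono) auto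
    then have "(cmod (g r) * r) * (\<bar>D r\<bar> * \<bar>c\<bar>) \<le> (cmod (g r) * r) * C" using r by (intro mult_left_mono) auto
    then show ?thesis using r by (simp add: norm_mult abs_mult mult_ac)
  qed
  have mc: "cutoff (e k) \<in> borel_measurable unit_lebesgue" "\<psi>' k \<in> borel_measurable unit_lebesgue" for k
    using cc c\<psi>' by (auto intro: continuous_measurable_unit)
  note [measurable] = mc
  show I1: "integrable unit_lebesgue (\<lambda>r. v r * of_real (E r))"
    by (rule Bochner_Integration.integrable_bound[OF iv]) (measurable, auto intro!: AE_I2 bE order_trans[OF bE])
  show I2: "integrable unit_lebesgue (\<lambda>r. g r * of_real (r * D r))"
    by (rule Bochner_Integration.integrable_bound[OF ig])
       (measurable, auto intro!: AE_I2 order_trans[OF bg[where c = 1, simplified]])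
  have L1: "(\<lambda>k. LINT r|unit_lebesgue. v r * of_real (\<psi>' k r)) \<longlonglongrightarrow> (LINT r|unit_lebesgue. v r * of_real (E r))"
  proof (rule integral_dominated_convergence[OF _ _ iv])
    show "AE r in unit_lebesgue. (\<lambda>k. v r * of_real (\<psi>' k r)) \<longlonglongrightarrow> v r * of_real (E r)"
    proof (rule AE_I2)
      fix r assume "r \<in> space unit_lebesgue"
      then have r: "r \<in> {0<..<1}" by simp
      have "(\<lambda>k. \<psi>' k r) \<longlonglongrightarrow> r * D r * 0 + E r * 1"
        unfolding \<psi>'_def e_def by (intro tendsto_intros cutoff_limits r)
      then have "(\<lambda>k. \<psi>' k r) \<longlonglongrightarrow> E r" by simp
      then show "(\<lambda>k. v r * of_real (\<psi>' k r)) \<longlonglongrightarrow> v r * of_real (E r)" by (intro tendsto_intros)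
    qed
    show "AE r in unit_lebesgue. norm (v r * of_real (\<psi>' k r)) \<le> 5 * C * norm (\<kappa> r *\<^sub>R v r)" for k
      by (rule AE_I2) (rule b\<psi>', simp)
  qed measurable
  have L2: "(\<lambda>k. LINT r|unit_lebesgue. g r * of_real (r * D r * cutoff (e k) r)) \<longlonglongrightarrow> (LINT r|unit_lebesgue. g r * of_real (r * D r))"
  proof (rule integral_dominated_convergence[OF _ _ ig])
    show "AE r in unit_lebesgue. (\<lambda>k. g r * of_real (r * D r * cutoff (e k) r)) \<longlonglongrightarrow> g r * of_real (r * D r)"
    proof (rule AE_I2)
      fix r assume "r \<in> space unit_lebesgue"
      then have r: "r \<in> {0<..<1}" by simp
      have "(\<lambda>k. r * D r * cutoff (e k) r) \<longlonglongrightarrow> r * D r * 1"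
        unfolding e_def by (intro tendsto_intros cutoff_limits r)
      then have "(\<lambda>k. r * D r * cutoff (e k) r) \<longlonglongrightarrow> r * D r" by simp
      then show "(\<lambda>k. g r * of_real (r * D r * cutoff (e k) r)) \<longlonglongrightarrow> g r * of_real (r * D r)"
        by (rule tendsto_mult[OF tendsto_const tendsto_of_real])
    qed
    show "AE r in unit_lebesgue. norm (g r * of_real (r * D r * cutoff (e k) r)) \<le> C * norm (r *\<^sub>R g r)" for k
      by (rule AE_I2) (rule bg, use cutoff_bounds(1)[OF _ e(1)] in auto)
  qed measurable
  show "(LINT r|unit_lebesgue. v r * of_real (E r)) = - (LINT r|unit_lebesgue. g r * of_real (r * D r))"
    by (rule LIMSEQ_unique[OF L1]) (simp only: eq, rule tendsto_minus[OF L2])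
qed

lemma compact_subset_Icc:
  fixes K :: "real set"
  assumes "compact K" "K \<subseteq> {0<..<1}"
  obtains a b where "0 < a" "a < b" "b < 1" "K \<subseteq> {a<..<b}"
proof (cases "K = {}")
  case True
  then show ?thesis using that[of "1/3" "1/2"] by simp
next
  case False
  obtain x where x: "x \<in> K" "\<And>y. y \<in> K \<Longrightarrow> x \<le> y" using compact_attains_inf[OF assms(1) False] by blast
  obtain z where z: "z \<in> K" "\<And>y. y \<in> K \<Longrightarrow> y \<le> z" using compact_attains_sup[OF assms(1) False] by blast
  have "0 < x" "z < 1" "x \<le> z" using x z assms(2) by auto
  then show ?thesis using that[of "x / 2" "(z + 1) / 2"] x(2) z(2) by force
qed

lemma continuous_locally_integrable:
  fixes f :: "real \<Rightarrow> complex"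
  assumes "continuous_on {0<..<1} f"
  shows "locally_integrable {0<..<1} f"
  unfolding locally_integrable_def
proof (intro allI impI)
  fix K :: "real set" assume K: "compact K \<and> K \<subseteq> {0<..<1}"
  then obtain a b where ab: "0 < a" "a < b" "b < 1" "K \<subseteq> {a<..<b}" using compact_subset_Icc by metis
  have "f absolutely_integrable_on {a..b}"
    using ab by (intro absolutely_integrable_continuous_real continuous_on_subset[OF assms]) auto
  then show "f absolutely_integrable_on K"
    by (rule set_integrable_subset) (use K ab in \<open>auto simp: lmeasurable_compact fmeasurableD\<close>)
qed

text \<open>
  The fundamental theorem of calculus for \<open>\<psi> * \<phi>\<close> on a compact interval that contains the support
  of the test function \<open>\<phi>\<close>.
\<close>

lemma C1_has_weak_deriv:
  assumes der: "\<And>x. x \<in> {0<..<1} \<Longrightarrow> (\<psi> has_real_derivative D x) (at x)"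
    and cont: "continuous_on {0<..<1} D"
  shows "has_weak_deriv {0<..<1} 1 (\<lambda>x. of_real (\<psi> x)) (\<lambda>x. of_real (D x))"
  unfolding has_weak_deriv_def
proof (intro conjI ballI)
  have c\<psi>: "continuous_on {0<..<1} \<psi>"
    using der by (meson DERIV_isCont continuous_at_imp_continuous_on)
  show "locally_integrable {0<..<1} (\<lambda>x. complex_of_real (\<psi> x))"
    "locally_integrable {0<..<1} (\<lambda>x. complex_of_real (D x))"
    by (intro continuous_locally_integrable continuous_intros cont c\<psi>)+
  fix \<phi> :: "real \<Rightarrow> real" assume t: "\<phi> \<in> test_functions {0<..<1}"
  then have "C_k (Suc 1) \<phi>" by (simp add: test_functions_def)
  then obtain \<phi>' where \<phi>': "\<And>x. (\<phi> has_real_derivative \<phi>' x) (at x)" "C_k 1 \<phi>'"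
    using C_k_real_cases by blast
  have fd: "frechet_derivative \<phi> (at x) 1 = \<phi>' x" for x
    using fun_cong[OF frechet_derivative_at[of \<phi> "(*) (\<phi>' x)" x], of 1] \<phi>'(1)[of x]
    by (simp add: has_field_derivative_def)
  have "C_k (Suc 0) \<phi>'" using \<phi>'(2) by simp
  then obtain \<phi>'' where "\<And>x. (\<phi>' has_real_derivative \<phi>'' x) (at x)" using C_k_real_cases by blast
  then have c\<phi>': "continuous_on S \<phi>'" for S by (meson DERIV_isCont continuous_at_imp_continuous_on)
  have c\<phi>: "continuous_on S \<phi>" for S using \<phi>'(1) by (meson DERIV_isCont continuous_at_imp_continuous_on)
  obtain a b where ab: "0 < a" "a < b" "b < 1" and sub: "closure {x. \<phi> x \<noteq> 0} \<subseteq> {a<..<b}"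
    using t compact_subset_Icc unfolding test_functions_def by blast
  have z: "\<phi> x = 0" if "x \<notin> {a<..<b}" for x
    using sub closure_subset[of "{x. \<phi> x \<noteq> 0}"] that by blast
  have z': "\<phi>' x = 0" if "x \<notin> {a<..<b}" for x
  proof -
    have "x \<in> - closure {x. \<phi> x \<noteq> 0}" using sub that by auto
    have "((\<lambda>x. 0) has_real_derivative \<phi>' x) (at x)"
      by (rule has_field_derivative_transform_within_open[OF \<phi>'(1) _ \<open>x \<in> _\<close>])
         (use closure_subset[of "{x. \<phi> x \<noteq> 0}"] in auto)
    then show ?thesis using DERIV_unique[OF _ DERIV_const] by blast
  qed
  have sub1: "{a..b} \<subseteq> {0<..<1}" using ab by auto
  have ai: "(\<lambda>x. f x) absolutely_integrable_on {a..b}" if "continuous_on {0<..<1} f" for f :: "real \<Rightarrow> real"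
    by (intro absolutely_integrable_continuous_real continuous_on_subset[OF that sub1])
  have unit: "(LINT x|unit_lebesgue. f x) = integral {a..b} f"
    if c: "continuous_on {0<..<1} f" and "\<And>x. x \<notin> {a<..<b} \<Longrightarrow> f x = 0" for f :: "real \<Rightarrow> real"
  proof -
    have "(LINT x|unit_lebesgue. f x) = (LINT x|lebesgue. indicator {0<..<1} x *\<^sub>R f x)"
      by (rule integral_restrict_space) auto
    also have "\<dots> = (LINT x:{a..b}|lebesgue. f x)"
      unfolding set_lebesgue_integral_def
      by (rule Bochner_Integration.integral_cong) (use that(2) ab in \<open>force simp: indicator_def\<close>)+
    also have "\<dots> = integral {a..b} f" by (rule set_lebesgue_integral_eq_integral(2)[OF ai[OF c]])
    finally show ?thesis .
  qed
  have "((\<lambda>x. \<psi> x * \<phi>' x + D x * \<phi> x) has_integral (\<psi> b * \<phi> b - \<psi> a * \<phi> a)) {a..b}"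
  proof (rule fundamental_theorem_of_calculus)
    fix x assume "x \<in> {a..b}"
    then have "x \<in> {0<..<1}" using sub1 by blast
    then have "((\<lambda>x. \<psi> x * \<phi> x) has_real_derivative \<psi> x * \<phi>' x + D x * \<phi> x) (at x)"
      using DERIV_mult[OF der \<phi>'(1)] by (simp add: add.commute mult.commute)
    then show "((\<lambda>x. \<psi> x * \<phi> x) has_vector_derivative \<psi> x * \<phi>' x + D x * \<phi> x) (at x within {a..b})"
      by (meson has_real_derivative_iff_has_vector_derivative has_vector_derivative_at_within)
  qed (use ab in simp)
  then have "integral {a..b} (\<lambda>x. \<psi> x * \<phi>' x + D x * \<phi> x) = 0"
    using z[of a] z[of b] by (simp add: integral_unique)
  moreover have "integral {a..b} (\<lambda>x. \<psi> x * \<phi>' x + D x * \<phi> x) = integral {a..b} (\<lambda>x. \<psi> x * \<phi>' x) + integral {a..b} (\<lambda>x. D x * \<phi> x)"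
    by (intro Henstock_Kurzweil_Integration.integral_add integrable_continuous_real continuous_intros
          continuous_on_subset[OF c\<psi> sub1] continuous_on_subset[OF cont sub1] c\<phi> c\<phi>')
  ultimately have e: "(LINT x|unit_lebesgue. \<psi> x * \<phi>' x) = - (LINT x|unit_lebesgue. D x * \<phi> x)"
    using z z' by (subst (1 2) unit) (auto intro!: continuous_intros c\<psi> cont c\<phi> c\<phi>')
  have "complex_of_real (LINT x|unit_lebesgue. \<psi> x * \<phi>' x) = - complex_of_real (LINT x|unit_lebesgue. D x * \<phi> x)"
    using e by simp
  then show "(LINT x|unit_lebesgue. of_real (\<psi> x) * of_real (frechet_derivative \<phi> (at x) 1)) =
         - (LINT x|unit_lebesgue. of_real (D x) * complex_of_real (\<phi> x))"
    unfolding fd of_real_mult[symmetric] integral_complex_of_real .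
qed

text \<open>
  The bound in the third part is the one under which the potential term can be paired with an
  arbitrary element of the form domain.
\<close>

lemma neumann_regular_domain:
  assumes reg: "neumann_regular n \<psi> D E"
  shows "has_weak_deriv {0<..<1} 1 (\<lambda>r. of_real (\<psi> r)) (\<lambda>r. of_real (D r))"
    "(\<lambda>r. of_real (\<psi> r)) \<in> radial_form_domain n b"
    "\<exists>C. \<forall>r\<in>{0<..<1}. \<bar>r * radial_potential n b r * \<psi> r\<bar> \<le> C * r ^ (1 - n)"
proof -
  note cont = neumann_regular_continuous[OF reg]
  show w: "has_weak_deriv {0<..<1} 1 (\<lambda>r. of_real (\<psi> r)) (\<lambda>r. of_real (D r))"
    by (rule C1_has_weak_deriv[OF _ cont(2)]) (use reg in \<open>auto simp: neumann_regular_def\<close>)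
  obtain C where C: "\<And>r. r \<in> {0<..<1} \<Longrightarrow> \<bar>\<psi> r\<bar> \<le> C * r ^ min n 1 \<and> \<bar>D r\<bar> \<le> C * (1 - r)"
    using reg unfolding neumann_regular_def by blast
  have C0: "C \<ge> 0"
  proof -
    have "\<bar>D (1/2)\<bar> \<le> C * (1 - 1/2)" using C[of "1/2"] by simp
    then show ?thesis by simp
  qed
  have mp: "\<psi> \<in> borel_measurable unit_lebesgue" and mD: "D \<in> borel_measurable unit_lebesgue"
    using cont by (auto intro: continuous_measurable_unit)
  note [measurable] = mp mD
  have L2I: "(\<lambda>r. complex_of_real (f r)) \<in> L2 radial_measure"
    if m: "f \<in> borel_measurable unit_lebesgue" and b: "\<And>r. r \<in> {0<..<1} \<Longrightarrow> \<bar>f r\<bar> \<le> C" for f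
  proof -
    note [measurable] = m
    have "integrable unit_lebesgue (\<lambda>r. r * (cmod (complex_of_real (f r)))\<^sup>2)"
    proof (rule integrable_unit_bounded)
      fix r :: real assume r: "r \<in> {0<..<1}"
      have "r * \<bar>f r\<bar>\<^sup>2 \<le> 1 * C\<^sup>2" using r b[OF r] by (intro mult_mono power_mono) auto
      then show "norm (r * (cmod (complex_of_real (f r)))\<^sup>2) \<le> C\<^sup>2" using r by (simp add: abs_mult)
    qed measurable
    then show ?thesis by (simp add: L2_radial)
  qed
  have b1: "\<bar>\<psi> r\<bar> \<le> C" if r: "r \<in> {0<..<1}" for r
    using C[OF r] C0 r power_le_one[of r "min n 1"] by (smt (verit) greaterThanLessThan_iff mult_left_le)
  have b2: "\<bar>D r\<bar> \<le> C" if r: "r \<in> {0<..<1}" for r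
    using C[OF r] C0 r by (smt (verit) greaterThanLessThan_iff mult_left_le)
  define B where "B = (real n + \<bar>b\<bar>)\<^sup>2"
  have pot: "r ^ min n 1 * (r * radial_potential n b r) \<le> B * r ^ (1 - n)" if "r \<in> {0<..<1}" for r
    unfolding B_def by (rule radial_potential_weight_bound[OF that])
  have V0: "radial_potential n b r \<ge> 0" for r by (simp add: radial_potential_def)
  have bV: "\<bar>r * radial_potential n b r * \<psi> r\<bar> \<le> C * (B * r ^ (1 - n))" if r: "r \<in> {0<..<1}" for r
  proof -
    have "\<bar>r * radial_potential n b r * \<psi> r\<bar> = (r * radial_potential n b r) * \<bar>\<psi> r\<bar>"
      using r V0[of r] by (simp add: abs_mult)
    also have "\<dots> \<le> (r * radial_potential n b r) * (C * r ^ min n 1)"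
      using r V0[of r] C[OF r] by (intro mult_left_mono) auto
    also have "\<dots> = C * (r ^ min n 1 * (r * radial_potential n b r))" by (simp add: mult_ac)
    also have "\<dots> \<le> C * (B * r ^ (1 - n))" by (rule mult_left_mono[OF pot[OF r] C0])
    finally show ?thesis .
  qed
  then show "\<exists>C. \<forall>r\<in>{0<..<1}. \<bar>r * radial_potential n b r * \<psi> r\<bar> \<le> C * r ^ (1 - n)"
    by (intro exI[of _ "C * B"]) (simp add: mult.assoc)
  have bV1: "\<bar>r * radial_potential n b r * \<psi> r\<bar> \<le> C * B" if r: "r \<in> {0<..<1}" for r
  proof -
    have "B * r ^ (1 - n) \<le> B * 1" using r by (intro mult_left_mono) (auto simp: B_def power_le_one)
    then have "C * (B * r ^ (1 - n)) \<le> C * B" using C0 by (intro mult_left_mono) auto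
    then show ?thesis using bV[OF r] by linarith
  qed
  have "integrable radial_measure (\<lambda>r. radial_potential n b r * (cmod (complex_of_real (\<psi> r)))\<^sup>2)"
  proof (subst integrable_radial)
    show "integrable unit_lebesgue (\<lambda>r. r *\<^sub>R (radial_potential n b r * (cmod (complex_of_real (\<psi> r)))\<^sup>2))"
    proof (rule integrable_unit_bounded[of _ "C * B * C"])
      fix r :: real assume r: "r \<in> {0<..<1}"
      have "norm (r *\<^sub>R (radial_potential n b r * (cmod (complex_of_real (\<psi> r)))\<^sup>2))
          = \<bar>r * radial_potential n b r * \<psi> r\<bar> * \<bar>\<psi> r\<bar>"
        by (simp add: abs_mult power2_eq_square)
      also have "\<dots> \<le> C * B * C" using bV1[OF r] b1[OF r] order_trans[OF abs_ge_zero bV1[OF r]] by (intro mult_mono) auto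
      finally show "norm (r *\<^sub>R (radial_potential n b r * (cmod (complex_of_real (\<psi> r)))\<^sup>2)) \<le> C * B * C" .
    qed measurable
  qed measurable
  then show "(\<lambda>r. of_real (\<psi> r)) \<in> radial_form_domain n b"
    unfolding radial_form_domain_def using w L2I[OF mp b1] L2I[OF mD b2] by auto
qed

text \<open>
  The function \<open>f\<close> plays the role of the radial differential operator applied to \<open>\<psi>\<close>.
\<close>

lemma radial_form_Green:
  assumes reg: "neumann_regular n \<psi> D E" and v: "v \<in> radial_form_domain n b"
    and eqn: "\<And>r. r \<in> {0<..<1} \<Longrightarrow> E r = r * radial_potential n b r * \<psi> r - r * f r"
    and f: "f \<in> borel_measurable unit_lebesgue"
  shows "integrable unit_lebesgue (\<lambda>r. of_real (r * f r) * cnj (v r))"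
    "radial_form n b (\<lambda>r. of_real (\<psi> r)) v = (LINT r|unit_lebesgue. of_real (r * f r) * cnj (v r))"
proof -
  let ?\<psi> = "\<lambda>r. complex_of_real (\<psi> r)"
  let ?g = "weak_deriv {0<..<1} 1 v" and ?G = "weak_deriv {0<..<1} 1 ?\<psi>"
  note cont = neumann_regular_continuous[OF reg]
  note dom = neumann_regular_domain(1)[OF reg] neumann_regular_domain(2)[OF reg, of b]
  obtain C where C: "\<And>r. r \<in> {0<..<1} \<Longrightarrow> \<bar>r * radial_potential n b r * \<psi> r\<bar> \<le> C * r ^ (1 - n)"
    using neumann_regular_domain(3)[OF reg, of b] by blast
  note wv = form_domain_weak_deriv[OF v]
  note w\<psi> = form_domain_weak_deriv[OF dom(2)]
  note parts = neumann_regular_parts[OF reg v wv(1,2)]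
  have mp: "\<psi> \<in> borel_measurable unit_lebesgue" and mD: "D \<in> borel_measurable unit_lebesgue"
    and mE: "E \<in> borel_measurable unit_lebesgue"
    using cont by (auto intro: continuous_measurable_unit)
  have mg: "?g \<in> borel_measurable unit_lebesgue" "v \<in> borel_measurable unit_lebesgue" "?G \<in> borel_measurable unit_lebesgue"
    using wv w\<psi> by (auto simp: L2_radial)
  have mcnj: "(\<lambda>r. cnj (v r)) \<in> borel_measurable unit_lebesgue" "(\<lambda>r. cnj (?g r)) \<in> borel_measurable unit_lebesgue"
    by (rule measurable_compose[OF mg(2) borel_measurable_continuous_onI[OF continuous_on_cnj[OF continuous_on_id]]]
             measurable_compose[OF mg(1) borel_measurable_continuous_onI[OF continuous_on_cnj[OF continuous_on_id]]])+
  note [measurable] = mp mD mE mg f mcnj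
  have ae: "AE r in unit_lebesgue. ?G r = of_real (D r)"
    using weak_deriv_unique[OF w\<psi>(1) dom(1)] .
  have P1: "integrable unit_lebesgue (\<lambda>r. of_real (r * D r) * cnj (?g r))"
    using integrable_cnj[OF parts(2)] by (simp add: mult.commute)
  have P2: "integrable unit_lebesgue (\<lambda>r. of_real (E r) * cnj (v r))"
    using integrable_cnj[OF parts(1)] by (simp add: mult.commute)
  have P12: "(LINT r|unit_lebesgue. of_real (r * D r) * cnj (?g r)) = - (LINT r|unit_lebesgue. of_real (E r) * cnj (v r))"
  proof -
    have c: "(LINT r|unit_lebesgue. of_real (p r) * cnj (q r)) = cnj (LINT r|unit_lebesgue. q r * of_real (p r))" for p :: "real \<Rightarrow> real" and q
      by (subst Bochner_Integration.integral_cnj[symmetric]) (simp add: mult.commute)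
    show ?thesis unfolding c parts(3) by simp
  qed
  have P3: "integrable unit_lebesgue (\<lambda>r. of_real (r * radial_potential n b r * \<psi> r) * cnj (v r))"
  proof (rule Bochner_Integration.integrable_bound)
    show "integrable unit_lebesgue (\<lambda>r. C * norm (r ^ (1 - n) *\<^sub>R v r))"
      by (intro integrable_mult_right integrable_norm form_domain_weighted_integrable[OF v])
    show "AE r in unit_lebesgue. norm (of_real (r * radial_potential n b r * \<psi> r) * cnj (v r)) \<le> norm (C * norm (r ^ (1 - n) *\<^sub>R v r))"
    proof (rule AE_I2)
      fix r assume "r \<in> space unit_lebesgue"
      then have r: "r \<in> {0<..<1}" by simp
      have "\<bar>r * radial_potential n b r * \<psi> r\<bar> * cmod (v r) \<le> (C * r ^ (1 - n)) * cmod (v r)"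
        by (rule mult_right_mono[OF C[OF r]]) simp
      also have "\<dots> = C * norm (r ^ (1 - n) *\<^sub>R v r)" using r by simp
      also have "\<dots> \<le> norm (C * norm (r ^ (1 - n) *\<^sub>R v r))" by simp
      finally show "norm (of_real (r * radial_potential n b r * \<psi> r) * cnj (v r)) \<le> norm (C * norm (r ^ (1 - n) *\<^sub>R v r))"
        by (simp only: norm_mult norm_of_real complex_mod_cnj)
    qed
    show "(\<lambda>r. of_real (r * radial_potential n b r * \<psi> r) * cnj (v r)) \<in> borel_measurable unit_lebesgue"
      by (intro borel_measurable_times ident_measurable_unit potential_measurable mp mcnj
            measurable_compose[OF _ borel_measurable_of_real])
  qed
  have feq: "of_real (r * radial_potential n b r * \<psi> r) * cnj (v r) - of_real (E r) * cnj (v r) = of_real (r * f r) * cnj (v r)"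
    if "r \<in> space unit_lebesgue" for r
  proof -
    have e: "r * f r = r * radial_potential n b r * \<psi> r - E r" using eqn[of r] that by simp
    show ?thesis by (simp only: e of_real_diff left_diff_distrib)
  qed
  have "integrable unit_lebesgue (\<lambda>r. of_real (r * radial_potential n b r * \<psi> r) * cnj (v r) - of_real (E r) * cnj (v r))"
    by (rule Bochner_Integration.integrable_diff[OF P3 P2])
  then show "integrable unit_lebesgue (\<lambda>r. of_real (r * f r) * cnj (v r))"
    by (rule iffD1[OF Bochner_Integration.integrable_cong[OF refl], rotated]) (rule feq)
  have "radial_form n b ?\<psi> v = (LINT r|unit_lebesgue. r *\<^sub>R (?G r * cnj (?g r) + of_real (radial_potential n b r) * (?\<psi> r * cnj (v r))))"
    unfolding radial_form_def by (rule integral_radial) measurable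
  also have "\<dots> = (LINT r|unit_lebesgue. of_real (r * D r) * cnj (?g r) + of_real (r * radial_potential n b r * \<psi> r) * cnj (v r))"
  proof (rule integral_cong_AE)
    show "AE r in unit_lebesgue. r *\<^sub>R (?G r * cnj (?g r) + of_real (radial_potential n b r) * (?\<psi> r * cnj (v r)))
        = of_real (r * D r) * cnj (?g r) + of_real (r * radial_potential n b r * \<psi> r) * cnj (v r)"
      using ae by eventually_elim (simp add: scaleR_conv_of_real algebra_simps)
  qed measurable
  also have "\<dots> = (LINT r|unit_lebesgue. of_real (r * D r) * cnj (?g r)) + (LINT r|unit_lebesgue. of_real (r * radial_potential n b r * \<psi> r) * cnj (v r))"
    by (rule Bochner_Integration.integral_add[OF P1 P3])
  also have "\<dots> = (LINT r|unit_lebesgue. of_real (r * radial_potential n b r * \<psi> r) * cnj (v r) - of_real (E r) * cnj (v r))"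
    unfolding P12 Bochner_Integration.integral_diff[OF P3 P2] by simp
  also have "\<dots> = (LINT r|unit_lebesgue. of_real (r * f r) * cnj (v r))"
    by (rule Bochner_Integration.integral_cong[OF refl feq])
  finally show "radial_form n b ?\<psi> v = (LINT r|unit_lebesgue. of_real (r * f r) * cnj (v r))" .
qed

lemma radial_form_cnj: "radial_form n b u v = cnj (radial_form n b v u)"
  unfolding radial_form_def
  by (subst Bochner_Integration.integral_cnj[symmetric], rule Bochner_Integration.integral_cong[OF refl]) (simp add: mult.commute)

lemma neumann_solution_eigenvalue:
  assumes reg: "neumann_regular n \<theta> D E"
    and eqn: "\<And>r. r \<in> {0<..<1} \<Longrightarrow> E r = r * radial_potential n b r * \<theta> r - r * (t * \<theta> r)"
    and pos: "\<And>r. r \<in> {0<..<1} \<Longrightarrow> \<theta> r > 0"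
  shows "is_eigenvalue radial_measure (radial_operator n b) (of_real t)"
proof -
  let ?u = "\<lambda>r. complex_of_real (\<theta> r)" and ?w = "\<lambda>r. complex_of_real (t * \<theta> r)"
  note dom = neumann_regular_domain(2)[OF reg, of b]
  have mt: "\<theta> \<in> borel_measurable unit_lebesgue"
    by (rule continuous_measurable_unit[OF neumann_regular_continuous(1)[OF reg]])
  note [measurable] = mt
  have uL: "?u \<in> L2 radial_measure" using dom by (simp add: radial_form_domain_def)
  have wL: "?w \<in> L2 radial_measure"
  proof -
    have "integrable unit_lebesgue (\<lambda>r. t\<^sup>2 * (r * (cmod (?u r))\<^sup>2))"
      using uL by (intro integrable_mult_right) (auto simp: L2_radial)
    moreover have "(\<lambda>r. t\<^sup>2 * (r * (cmod (?u r))\<^sup>2)) = (\<lambda>r. r * (cmod (?w r))\<^sup>2)"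
      by (auto simp: norm_mult power_mult_distrib abs_mult)
    ultimately have "integrable unit_lebesgue (\<lambda>r. r * (cmod (?w r))\<^sup>2)" by (simp only:)
    moreover have "?w \<in> borel_measurable unit_lebesgue" by measurable
    ultimately show ?thesis unfolding L2_radial by blast
  qed
  have "radial_form n b ?u v = L2_inner radial_measure ?w v" if v: "v \<in> radial_form_domain n b" for v
  proof -
    have [measurable]: "v \<in> borel_measurable unit_lebesgue"
      using form_domain_weak_deriv(3)[OF v] by (simp add: L2_radial)
    have [measurable]: "(\<lambda>r. cnj (v r)) \<in> borel_measurable unit_lebesgue"
      by (rule measurable_compose[OF _ borel_measurable_continuous_onI[OF continuous_on_cnj[OF continuous_on_id]]]) measurable
    have "radial_form n b ?u v = (LINT r|unit_lebesgue. of_real (r * (t * \<theta> r)) * cnj (v r))"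
      by (rule radial_form_Green(2)[OF reg v eqn]) measurable
    also have "\<dots> = L2_inner radial_measure ?w v"
      unfolding L2_inner_def
      by (subst integral_radial) (auto simp: scaleR_conv_of_real mult.assoc)
    finally show ?thesis .
  qed
  then have "(?u, ?w) \<in> radial_operator n b"
    using dom wL by (auto simp: radial_operator_def form_operator_def)
  moreover have "\<not> (AE r in radial_measure. ?u r = 0)"
  proof
    assume "AE r in radial_measure. ?u r = 0"
    then have "AE r in unit_lebesgue. ?u r = 0" by (simp only: AE_radial)
    then have "AE r in unit_lebesgue. False"
    proof (rule AE_mp, intro AE_I2 impI)
      fix r assume "r \<in> space unit_lebesgue" "?u r = 0"
      then show False using pos[of r] by simp
    qed
    then have "emeasure unit_lebesgue (space unit_lebesgue) = 0"
      by (metis ae_filter_eq_bot_iff trivial_limit_def)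
    then show False by (simp add: emeasure_restrict_space)
  qed
  ultimately show ?thesis unfolding is_eigenvalue_def by (intro bexI[of _ "(?u, ?w)"]) auto
qed

text \<open>
  If \<open>u\<close> is an eigenfunction for \<open>t\<close> and \<open>\<psi>\<close> solves the inhomogeneous equation with right-hand side \<open>h\<close>,
  then the form evaluated at \<open>u\<close> and \<open>\<psi>\<close> is \<open>t \<langle>u, \<psi>\<rangle>\<close> by the eigenvalue equation and
  \<open>\<langle>u, t \<psi> + h\<rangle>\<close> by Green's formula; so \<open>u\<close> is orthogonal to \<open>h\<close>. Bump functions suffice as
  right-hand sides to conclude \<open>u = 0\<close>.
\<close>

lemma not_eigenvalue_if_solvable:
  assumes solve: "\<And>k \<alpha> \<gamma>. 0 < \<alpha> \<Longrightarrow> \<alpha> < \<gamma> \<Longrightarrow> \<gamma> < 1 \<Longrightarrow>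
      \<exists>\<psi> D E. neumann_regular n \<psi> D E \<and>
        (\<forall>r\<in>{0<..<1}. E r = r * radial_potential n b r * \<psi> r - r * (t * \<psi> r + bump (Suc k) \<alpha> \<gamma> r))"
  shows "\<not> is_eigenvalue radial_measure (radial_operator n b) (of_real t)"
proof
  assume "is_eigenvalue radial_measure (radial_operator n b) (of_real t)"
  then obtain u w where uw: "(u, w) \<in> radial_operator n b"
    and nz: "\<not> (AE r in radial_measure. u r = 0)"
    and w: "AE r in radial_measure. w r = of_real t * u r"
    unfolding is_eigenvalue_def by auto
  then have u: "u \<in> radial_form_domain n b" and wL: "w \<in> L2 radial_measure"
    and form: "\<And>v. v \<in> radial_form_domain n b \<Longrightarrow> radial_form n b u v = L2_inner radial_measure w v"
    by (auto simp: radial_operator_def form_operator_def)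
  have mu: "u \<in> borel_measurable unit_lebesgue" and mw: "w \<in> borel_measurable unit_lebesgue"
    using form_domain_weak_deriv(3)[OF u] wL by (auto simp: L2_radial)
  note [measurable] = mu mw
  have w': "AE r in unit_lebesgue. w r = of_real t * u r" using w by (simp only: AE_radial)
  have iru: "integrable unit_lebesgue (\<lambda>r. r *\<^sub>R u r)"
    by (rule L2_radial_integrable[OF form_domain_weak_deriv(3)[OF u]])
  have orth: "(LINT r|unit_lebesgue. (r *\<^sub>R u r) * of_real (bump (Suc k) \<alpha> \<gamma> r)) = 0"
    if ag: "0 < \<alpha>" "\<alpha> < \<gamma>" "\<gamma> < 1" for k \<alpha> \<gamma>
  proof -
    obtain \<psi> D E where reg: "neumann_regular n \<psi> D E" and
      eqn: "\<And>r. r \<in> {0<..<1} \<Longrightarrow> E r = r * radial_potential n b r * \<psi> r - r * (t * \<psi> r + bump (Suc k) \<alpha> \<gamma> r)"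
      using solve[OF ag, of k] by blast
    let ?h = "bump (Suc k) \<alpha> \<gamma>"
    have mp: "\<psi> \<in> borel_measurable unit_lebesgue"
      by (rule continuous_measurable_unit[OF neumann_regular_continuous(1)[OF reg]])
    have mh: "?h \<in> borel_measurable unit_lebesgue"
      by (rule continuous_measurable_unit[OF continuous_on_bump])
    note [measurable] = mp mh
    note dom = neumann_regular_domain(2)[OF reg, of b]
    have mf: "(\<lambda>r. t * \<psi> r + ?h r) \<in> borel_measurable unit_lebesgue" by measurable
    note G = radial_form_Green[OF reg u eqn mf]
    have "radial_form n b u (\<lambda>r. of_real (\<psi> r)) = cnj (LINT r|unit_lebesgue. of_real (r * (t * \<psi> r + ?h r)) * cnj (u r))"
      by (subst radial_form_cnj) (simp only: G(2))
    also have "\<dots> = (LINT r|unit_lebesgue. of_real (r * (t * \<psi> r + ?h r)) * u r)"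
      by (subst Bochner_Integration.integral_cnj[symmetric]) simp
    finally have 1: "radial_form n b u (\<lambda>r. of_real (\<psi> r)) = (LINT r|unit_lebesgue. of_real (r * (t * \<psi> r + ?h r)) * u r)" .
    have I1: "integrable unit_lebesgue (\<lambda>r. of_real (r * (t * \<psi> r + ?h r)) * u r)"
      using integrable_cnj[OF G(1)] by simp
    have Ih: "integrable unit_lebesgue (\<lambda>r. (r *\<^sub>R u r) * of_real (?h r))"
    proof (rule Bochner_Integration.integrable_bound[OF iru])
      show "AE r in unit_lebesgue. norm ((r *\<^sub>R u r) * of_real (?h r)) \<le> norm (r *\<^sub>R u r)"
        unfolding norm_mult
        by (intro AE_I2 mult_right_le_one_le) (use flat_bounds in \<open>auto simp: bump_def\<close>)
    qed measurable
    have "radial_form n b u (\<lambda>r. of_real (\<psi> r)) = (LINT r|radial_measure. w r * cnj (of_real (\<psi> r)))"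
      using form[OF dom] by (simp add: L2_inner_def)
    also have "\<dots> = (LINT r|unit_lebesgue. r *\<^sub>R (w r * of_real (\<psi> r)))"
      by (subst integral_radial) auto
    also have "\<dots> = (LINT r|unit_lebesgue. of_real (r * (t * \<psi> r)) * u r)"
    proof (rule integral_cong_AE)
      show "AE r in unit_lebesgue. r *\<^sub>R (w r * of_real (\<psi> r)) = of_real (r * (t * \<psi> r)) * u r"
        using w' by eventually_elim (simp add: scaleR_conv_of_real)
    qed measurable
    also have "\<dots> = (LINT r|unit_lebesgue. of_real (r * (t * \<psi> r + ?h r)) * u r - (r *\<^sub>R u r) * of_real (?h r))"
      by (rule Bochner_Integration.integral_cong[OF refl]) (simp add: scaleR_conv_of_real algebra_simps)
    also have "\<dots> = (LINT r|unit_lebesgue. of_real (r * (t * \<psi> r + ?h r)) * u r) - (LINT r|unit_lebesgue. (r *\<^sub>R u r) * of_real (?h r))"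
      by (rule Bochner_Integration.integral_diff[OF I1 Ih])
    finally show ?thesis using 1 by simp
  qed
  have li: "locally_integrable {0<..<1} (\<lambda>r. r *\<^sub>R u r)"
    unfolding locally_integrable_def
  proof (intro allI impI)
    fix K :: "real set" assume K: "compact K \<and> K \<subseteq> {0<..<1}"
    have "(\<lambda>r. r *\<^sub>R u r) absolutely_integrable_on {0<..<1}"
      using iru unfolding set_integrable_def by (subst (asm) integrable_restrict_space) auto
    then show "(\<lambda>r. r *\<^sub>R u r) absolutely_integrable_on K"
      by (rule set_integrable_subset) (use K in \<open>auto simp: lmeasurable_compact fmeasurableD\<close>)
  qed
  have "AE r in unit_lebesgue. r *\<^sub>R u r = 0"
    by (rule AE_zero_if_bump_integrals_zero[OF li orth])
  then have "AE r in unit_lebesgue. u r = 0"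
    by (rule AE_mp, intro AE_I2 impI) auto
  then show False using nz unfolding AE_radial by blast
qed

section \<open>The lowest radial eigenvalue\<close>

text \<open>
  For solutions of the (inhomogeneous) radial equation the bounds on \<open>E\<close> come from the equation
  itself, and the vanishing of order \<open>1 - r\<close> comes from \<open>D 1 = 0\<close> and the mean value theorem for the
  flux.
\<close>

lemma neumann_regularI:
  assumes der: "\<And>r. r \<in> {0<..1} \<Longrightarrow> (\<psi> has_real_derivative D r) (at r)"
      "\<And>r. r \<in> {0<..1} \<Longrightarrow> ((\<lambda>s. s * D s) has_real_derivative E r) (at r)"
    and E: "\<And>r. r \<in> {0<..1} \<Longrightarrow> E r = r * radial_potential n b r * \<psi> r - r * (t * \<psi> r + h r)"
    and h: "continuous_on {0<..<1} h" "\<And>r. r \<in> {0<..<1} \<Longrightarrow> \<bar>h r\<bar> \<le> B"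
    and b\<psi>: "\<And>r. r \<in> {0<..<1} \<Longrightarrow> \<bar>\<psi> r\<bar> \<le> Cv * r ^ min n 1"
    and bD: "\<And>r. r \<in> {0<..<1} \<Longrightarrow> \<bar>D r\<bar> \<le> Cd * r ^ (1 - n)"
    and end1: "D 1 = 0"
  shows "neumann_regular n \<psi> D E"
proof -
  have Cv0: "Cv \<ge> 0"
  proof -
    have "0 \<le> Cv * (1/2) ^ min n 1" using b\<psi>[of "1/2"] order_trans[OF abs_ge_zero] by simp
    then show ?thesis by (simp add: zero_le_mult_iff) (metis not_le zero_less_divide_1_iff zero_less_numeral zero_less_power)
  qed
  have Cd0: "Cd \<ge> 0"
  proof -
    have "0 \<le> Cd * (1/2) ^ (1 - n)" using bD[of "1/2"] order_trans[OF abs_ge_zero] by simp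
    then show ?thesis by (simp add: zero_le_mult_iff) (metis not_le zero_less_divide_1_iff zero_less_numeral zero_less_power)
  qed
  have B0: "B \<ge> 0" using h(2)[of "1/2"] by simp
  define A where "A = (real n + \<bar>b\<bar>)\<^sup>2"
  have k: "r \<le> r ^ (1 - n)" "r ^ (1 - n) \<le> 1" if "r \<in> {0<..<1}" for r :: real
    using that by (cases n; simp)+
  have pot: "r ^ min n 1 * (r * radial_potential n b r) \<le> A * r ^ (1 - n)" if "r \<in> {0<..<1}" for r
    unfolding A_def by (rule radial_potential_weight_bound[OF that])
  have V0: "radial_potential n b r \<ge> 0" for r by (simp add: radial_potential_def)
  define C3 where "C3 = Cv * A + \<bar>t\<bar> * Cv + B"
  have A0: "A \<ge> 0" by (simp add: A_def)
  have C30: "C3 \<ge> 0" using Cv0 A0 B0 by (simp add: C3_def)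
  have bE: "\<bar>E r\<bar> \<le> C3 * r ^ (1 - n)" if r: "r \<in> {0<..<1}" for r
  proof -
    have r': "r \<in> {0<..1}" using r by auto
    have "r * radial_potential n b r * \<bar>\<psi> r\<bar> \<le> r * radial_potential n b r * (Cv * r ^ min n 1)"
      using b\<psi>[OF r] r V0[of r] by (intro mult_left_mono) auto
    also have "\<dots> = Cv * (r ^ min n 1 * (r * radial_potential n b r))" by (simp add: mult_ac)
    also have "\<dots> \<le> Cv * (A * r ^ (1 - n))" by (rule mult_left_mono[OF pot[OF r] Cv0])
    finally have 1: "\<bar>r * radial_potential n b r * \<psi> r\<bar> \<le> Cv * A * r ^ (1 - n)"
      using r V0[of r] by (simp add: abs_mult mult.assoc)
    have p1: "\<bar>\<psi> r\<bar> \<le> Cv * 1"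
      using b\<psi>[OF r] mult_left_mono[OF power_le_one[of r "min n 1"] Cv0] r by simp
    have "\<bar>r * (t * \<psi> r)\<bar> \<le> r ^ (1 - n) * (\<bar>t\<bar> * Cv)"
      unfolding abs_mult using k[OF r] r p1 by (intro mult_mono) auto
    moreover have "\<bar>r * h r\<bar> \<le> r ^ (1 - n) * B"
      unfolding abs_mult using k[OF r] r h(2)[OF r] by (intro mult_mono) auto
    moreover have "E r = r * radial_potential n b r * \<psi> r - (r * (t * \<psi> r) + r * h r)"
      unfolding E[OF r'] by (simp add: algebra_simps)
    ultimately show ?thesis using 1 unfolding C3_def by (simp add: algebra_simps) linarith
  qed
  have bE1: "\<bar>E r\<bar> \<le> C3" if r: "r \<in> {0<..<1}" for r
    using bE[OF r] mult_left_mono[OF k(2)[OF r] C30] by simp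
  have bP: "r * \<bar>D r\<bar> \<le> C3 * (1 - r)" if r: "r \<in> {0<..<1}" for r
  proof -
    have r1: "r < 1" using r by simp
    have "\<exists>z>r. z < 1 \<and> 1 * D 1 - r * D r = (1 - r) * E z"
      by (rule MVT2[OF r1]) (use der(2) r in auto)
    then obtain z where z: "r < z" "z < 1" "- (r * D r) = (1 - r) * E z" using end1 by auto
    have "\<bar>- (r * D r)\<bar> \<le> (1 - r) * C3"
      unfolding z(3) abs_mult using bE1[of z] z r by (intro mult_mono) auto
    then show ?thesis using r by (simp add: abs_mult mult.commute)
  qed
  have bD1: "\<bar>D r\<bar> \<le> (2 * Cd + 2 * C3) * (1 - r)" if r: "r \<in> {0<..<1}" for r
  proof (cases "r \<le> 1/2")
    case True
    have "\<bar>D r\<bar> \<le> Cd * 1" using bD[OF r] mult_left_mono[OF k(2)[OF r] Cd0] by simp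
    also have "\<dots> \<le> Cd * (2 * (1 - r))" using True Cd0 by (intro mult_left_mono) auto
    also have "\<dots> \<le> (2 * Cd + 2 * C3) * (1 - r)"
      using C30 r by (simp add: algebra_simps) (simp add: mult_left_le)
    finally show ?thesis .
  next
    case False
    have "1/2 * \<bar>D r\<bar> \<le> r * \<bar>D r\<bar>" using False by (intro mult_right_mono) auto
    then have "\<bar>D r\<bar> \<le> 2 * (C3 * (1 - r))" using bP[OF r] by simp
    moreover have "0 \<le> Cd * (1 - r)" using Cd0 r by simp
    ultimately show ?thesis by (simp add: algebra_simps)
  qed
  have cE: "continuous_on {0<..<1} E"
  proof -
    have c\<psi>: "continuous_on {0<..<1} \<psi>"
      by (intro continuous_at_imp_continuous_on ballI DERIV_isCont[OF der(1)]) auto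
    have "continuous_on {0<..<1} (\<lambda>r. r * radial_potential n b r * \<psi> r - r * (t * \<psi> r + h r))"
      unfolding radial_potential_def by (intro continuous_intros c\<psi> h) auto
    then show ?thesis by (rule continuous_on_eq) (simp add: E)
  qed
  define C where "C = Cv + 2 * Cd + 2 * C3"
  have "\<bar>\<psi> r\<bar> \<le> C * r ^ min n 1 \<and> \<bar>D r\<bar> \<le> C * r ^ (1 - n) \<and> \<bar>D r\<bar> \<le> C * (1 - r) \<and> \<bar>E r\<bar> \<le> C * r ^ (1 - n)"
    if r: "r \<in> {0<..<1}" for r
  proof -
    have le: "Cv * x \<le> C * x" "Cd * x \<le> C * x" "C3 * x \<le> C * x" "(2 * Cd + 2 * C3) * x \<le> C * x" if "x \<ge> 0" for x
      using Cv0 Cd0 C30 that unfolding C_def by (auto intro!: mult_right_mono)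
    show ?thesis
      using r order_trans[OF b\<psi>[OF r] le(1)] order_trans[OF bD[OF r] le(2)]
        order_trans[OF bD1[OF r] le(4)] order_trans[OF bE[OF r] le(3)] by auto
  qed
  then show ?thesis
    unfolding neumann_regular_def using der cE by (intro conjI ballI exI[of _ C]) auto
qed

text \<open>
  The solution of the radial equation with eigenvalue parameter \<open>t\<close> that is regular at \<open>0\<close>; the
  function \<open>regular_flux\<close> below is \<open>r\<close> times its derivative.
\<close>

definition regular_sol :: "nat \<Rightarrow> real \<Rightarrow> real \<Rightarrow> real \<Rightarrow> real" where
  "regular_sol n b t r = r ^ n * exp (- (b * r\<^sup>2 / 4)) * branch n (t / b) (b * r\<^sup>2 / 2)"

definition regular_flux :: "nat \<Rightarrow> real \<Rightarrow> real \<Rightarrow> real \<Rightarrow> real" where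
  "regular_flux n b t r = r ^ n * exp (- (b * r\<^sup>2 / 4)) * neumann_defect n (t / b) (b * r\<^sup>2 / 2)"

lemma regular_sol_pos: "b > 0 \<Longrightarrow> t \<le> b \<Longrightarrow> r > 0 \<Longrightarrow> regular_sol n b t r > 0"
  by (auto simp: regular_sol_def intro!: mult_pos_pos branch_pos)

lemma weight_deriv:
  assumes "r > 0"
  shows "((\<lambda>r. r ^ n * exp (- (b * r\<^sup>2 / 4))) has_real_derivative
     (r ^ n * exp (- (b * r\<^sup>2 / 4))) * (real n / r - b / 2 * r)) (at r)"
proof -
  have "((\<lambda>r. r ^ n) has_real_derivative real n * r ^ n / r) (at r)"
    using assms DERIV_pow[of n r UNIV] by (cases n) auto
  moreover have "((\<lambda>r. exp (- (b * r\<^sup>2 / 4))) has_real_derivative exp (- (b * r\<^sup>2 / 4)) * - (b / 2 * r)) (at r)"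
    by (auto intro!: derivative_eq_intros)
  ultimately show ?thesis
    by (rule DERIV_cong[OF DERIV_mult]) (simp add: algebra_simps)
qed

lemma regular_sol_deriv:
  assumes "r > 0"
  shows "(regular_sol n b t has_real_derivative regular_flux n b t r / r) (at r)"
proof -
  let ?x = "b * r\<^sup>2 / 2"
  have x: "((\<lambda>r. b * r\<^sup>2 / 2) has_real_derivative b * r) (at r)"
    by (auto intro!: derivative_eq_intros)
  have "((\<lambda>r. branch n (t / b) (b * r\<^sup>2 / 2)) has_real_derivative branch' n (t / b) ?x * (b * r)) (at r)"
    by (rule DERIV_chain2[OF branch_deriv x])
  from DERIV_mult[OF weight_deriv[OF assms] this] show ?thesis
    unfolding regular_sol_def[abs_def] regular_flux_def neumann_defect_def
    by (rule DERIV_cong) (use assms in \<open>simp add: field_simps power2_eq_square\<close>)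
qed

lemma regular_flux_deriv:
  assumes "r > 0" "b > 0"
  shows "(regular_flux n b t has_real_derivative r * radial_potential n b r * regular_sol n b t r - r * (t * regular_sol n b t r)) (at r)"
proof -
  let ?x = "b * r\<^sup>2 / 2" and ?\<eta> = "t / b"
  let ?K = "branch n ?\<eta> ?x" and ?K' = "branch' n ?\<eta> ?x" and ?e = "r ^ n * exp (- (b * r\<^sup>2 / 4))"
  have x: "((\<lambda>r. b * r\<^sup>2 / 2) has_real_derivative b * r) (at r)"
    by (auto intro!: derivative_eq_intros)
  have "((\<lambda>r. neumann_defect n ?\<eta> (b * r\<^sup>2 / 2)) has_real_derivative ((?x - n) * ?K' - ?\<eta> * ?K) * (b * r)) (at r)"
    by (rule DERIV_chain2[OF neumann_defect_deriv x])
  from DERIV_mult[OF weight_deriv[OF assms(1)] this] show ?thesis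
    unfolding regular_flux_def[abs_def]
  proof (rule DERIV_cong)
    have e1: "real n / r - b / 2 * r = (real n - ?x) / r" using assms by (simp add: field_simps power2_eq_square)
    have e2: "b * r = 2 * ?x / r" using assms by (simp add: power2_eq_square)
    have e3: "r * t = 2 * ?x * ?\<eta> / r" using assms by (simp add: power2_eq_square)
    have "(real n - ?x) / r * neumann_defect n ?\<eta> ?x + ((?x - n) * ?K' - ?\<eta> * ?K) * (2 * ?x / r)
       = ((real n - ?x)\<^sup>2 / r - 2 * ?x * ?\<eta> / r) * ?K"
      using assms unfolding neumann_defect_def by (simp add: divide_simps power2_eq_square) (simp add: algebra_simps)
    moreover have "(real n - ?x)\<^sup>2 / r = r * radial_potential n b r"
      unfolding radial_potential_def e1 using assms by (simp add: power2_eq_square)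
    ultimately have "(real n / r - b / 2 * r) * neumann_defect n ?\<eta> ?x + ((?x - n) * ?K' - ?\<eta> * ?K) * (b * r)
       = (r * radial_potential n b r - r * t) * ?K"
      unfolding e1 e2 e3 by simp
    then have "?e * ((real n / r - b / 2 * r) * neumann_defect n ?\<eta> ?x + ((?x - n) * ?K' - ?\<eta> * ?K) * (b * r))
       = ?e * ((r * radial_potential n b r - r * t) * ?K)" by (rule arg_cong)
    then show "?e * (real n / r - b / 2 * r) * neumann_defect n ?\<eta> ?x + ((?x - n) * ?K' - ?\<eta> * ?K) * (b * r) * ?e
       = r * radial_potential n b r * regular_sol n b t r - r * (t * regular_sol n b t r)"
      unfolding regular_sol_def by (simp add: algebra_simps)
  qed
qed

lemma continuous_on_branch: "continuous_on S (branch n \<eta>)"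
  using DERIV_isCont[OF branch_deriv] by (simp add: continuous_at_imp_continuous_on)

lemma continuous_on_branch': "continuous_on S (branch' n \<eta>)"
proof -
  have "\<exists>d. (branch' n \<eta> has_real_derivative d) (at x)" for x
    using kummer'_has_deriv[of "real n + 1" "(1 - \<eta>) / 2" x] unfolding branch'_def by auto
  then show ?thesis by (meson DERIV_isCont continuous_at_imp_continuous_on)
qed

lemma continuous_on_regular_sol: "continuous_on S (regular_sol n b t)"
  unfolding regular_sol_def[abs_def]
  by (intro continuous_intros continuous_on_compose2[OF continuous_on_branch[of UNIV]]) auto

lemma regular_sol_bounds:
  "\<exists>C1 C2. \<forall>r\<in>{0<..<1}. \<bar>regular_sol n b t r\<bar> \<le> C1 * r ^ min n 1 \<and> \<bar>regular_flux n b t r / r\<bar> \<le> C2 * r ^ (1 - n)"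
proof -
  let ?e = "\<lambda>r. exp (- (b * r\<^sup>2 / 4))"
  define f where "f = (\<lambda>r. r ^ (n - min n 1) * ?e r * branch n (t / b) (b * r\<^sup>2 / 2))"
  have cf: "continuous_on {0..1} f" unfolding f_def
    by (intro continuous_intros continuous_on_compose2[OF continuous_on_branch[of UNIV]]) auto
  obtain C1 where C1: "\<And>r. r \<in> {0..1} \<Longrightarrow> \<bar>f r\<bar> \<le> C1"
    using continuous_on_Icc_bounded[OF cf] by blast
  have s: "regular_sol n b t r = f r * r ^ min n 1" for r
    unfolding regular_sol_def f_def by (simp add: mult_ac flip: power_add)
  define g where "g = (\<lambda>r. r ^ (n - 1) * ?e r * (if n = 0 then b / 2 * (2 * branch' n (t / b) (b * r\<^sup>2 / 2) - branch n (t / b) (b * r\<^sup>2 / 2))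
       else (real n - b * r\<^sup>2 / 2) * branch n (t / b) (b * r\<^sup>2 / 2) + b * r\<^sup>2 * branch' n (t / b) (b * r\<^sup>2 / 2)))"
  have cg: "continuous_on {0..1} g" unfolding g_def
    by (cases "n = 0")
       (auto intro!: continuous_intros continuous_on_compose2[OF continuous_on_branch[of UNIV]]
         continuous_on_compose2[OF continuous_on_branch'[of UNIV]])
  obtain C2 where C2: "\<And>r. r \<in> {0..1} \<Longrightarrow> \<bar>g r\<bar> \<le> C2"
    using continuous_on_Icc_bounded[OF cg] by blast
  have d: "regular_flux n b t r / r = g r * r ^ (1 - n)" if "r > 0" for r
    unfolding regular_flux_def g_def neumann_defect_def using that
    by (cases n) (simp_all add: field_simps power2_eq_square)
  show ?thesis
  proof (rule exI[of _ C1], rule exI[of _ C2], intro ballI conjI)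
    fix r :: real assume r: "r \<in> {0<..<1}"
    show "\<bar>regular_sol n b t r\<bar> \<le> C1 * r ^ min n 1"
      unfolding s abs_mult using C1[of r] r by (intro mult_mono) auto
    have "\<bar>g r\<bar> * \<bar>r ^ (1 - n)\<bar> \<le> C2 * r ^ (1 - n)" using C2[of r] r by (intro mult_mono) auto
    then show "\<bar>regular_flux n b t r / r\<bar> \<le> C2 * r ^ (1 - n)" using d[of r] r by (simp add: abs_mult)
  qed
qed

lemma regular_sol_neumann_regular:
  assumes b: "b > 0" and z: "neumann_defect n (t / b) (b / 2) = 0"
  shows "neumann_regular n (regular_sol n b t) (\<lambda>r. regular_flux n b t r / r)
    (\<lambda>r. r * radial_potential n b r * regular_sol n b t r - r * (t * regular_sol n b t r))"
proof -
  obtain C1 C2 where C: "\<And>r. r \<in> {0<..<1} \<Longrightarrow> \<bar>regular_sol n b t r\<bar> \<le> C1 * r ^ min n 1"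
     "\<And>r. r \<in> {0<..<1} \<Longrightarrow> \<bar>regular_flux n b t r / r\<bar> \<le> C2 * r ^ (1 - n)"
    using regular_sol_bounds[of n b t] by blast
  show ?thesis
  proof (rule neumann_regularI[where h = "\<lambda>_. 0" and B = 0 and t = t and b = b, OF _ _ _ _ _ C])
    fix r :: real assume r: "r \<in> {0<..1}"
    show "(regular_sol n b t has_real_derivative regular_flux n b t r / r) (at r)" by (rule regular_sol_deriv) (use r in simp)
    have r0: "r \<in> {0<..}" using r by simp
    show "((\<lambda>s. s * (regular_flux n b t s / s)) has_real_derivative
       r * radial_potential n b r * regular_sol n b t r - r * (t * regular_sol n b t r)) (at r)"
      by (rule has_field_derivative_transform_within_open[OF regular_flux_deriv[OF _ b] open_greaterThan r0]) (use r in auto)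
  qed (use z in \<open>auto simp: regular_flux_def\<close>)
qed

text \<open>
  Sturm comparison: the Wronskian of the regular solutions for \<open>t\<close> and \<open>\<tau>\<close> vanishes at \<open>0\<close> and has
  the positive derivative \<open>r (\<tau> - t) f g\<close>, as both solutions are positive.
\<close>

lemma regular_flux_1_pos:
  assumes b: "b > 0" and t: "t < \<tau>" "\<tau> \<le> b" and z: "regular_flux n b \<tau> 1 = 0"
  shows "regular_flux n b t 1 > 0"
proof -
  define W where "W = (\<lambda>r. regular_flux n b t r * regular_sol n b \<tau> r - regular_flux n b \<tau> r * regular_sol n b t r)"
  have dW: "(W has_real_derivative r * (\<tau> - t) * regular_sol n b t r * regular_sol n b \<tau> r) (at r)" if r: "r > 0" for r
  proof -
    note d = DERIV_diff[OF DERIV_mult[OF regular_flux_deriv[OF r b, of n t] regular_sol_deriv[OF r, of n b \<tau>]]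
         DERIV_mult[OF regular_flux_deriv[OF r b, of n \<tau>] regular_sol_deriv[OF r, of n b t]]]
    show ?thesis unfolding W_def by (rule DERIV_cong[OF d]) (simp add: algebra_simps)
  qed
  have cW: "continuous_on {0..1} W"
    unfolding W_def regular_flux_def neumann_defect_def
    by (intro continuous_intros continuous_on_regular_sol continuous_on_compose2[OF continuous_on_branch[of UNIV]]
         continuous_on_compose2[OF continuous_on_branch'[of UNIV]]) auto
  have W0: "W 0 = 0"
    by (cases n) (simp_all add: W_def regular_flux_def regular_sol_def neumann_defect_def)
  have "W 0 < W 1"
  proof (rule DERIV_pos_imp_increasing_open[of 0 1 W])
    fix r :: real assume r: "0 < r" "r < 1"
    have "r * (\<tau> - t) * regular_sol n b t r * regular_sol n b \<tau> r > 0"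
      using regular_sol_pos[of b t r n] regular_sol_pos[of b \<tau> r n] b t r by simp
    then show "\<exists>y. (W has_real_derivative y) (at r) \<and> 0 < y" using dW[OF r(1)] by blast
  qed (use cW in auto)
  then have "regular_flux n b t 1 * regular_sol n b \<tau> 1 > 0" using W0 z by (simp add: W_def)
  then show ?thesis using regular_sol_pos[of b \<tau> 1 n] b t by (simp add: zero_less_mult_iff)
qed

lemma antiderivative_from_zero:
  fixes f :: "real \<Rightarrow> real"
  assumes c: "continuous_on {0..2} f" and z: "\<And>x. x \<le> \<alpha> \<Longrightarrow> f x = 0"
  obtains F where "\<And>x. x \<in> {0<..<2} \<Longrightarrow> (F has_real_derivative f x) (at x)"
    "\<And>x. 0 \<le> x \<Longrightarrow> x \<le> \<alpha> \<Longrightarrow> F x = 0" "continuous_on {0..2} F"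
proof
  let ?F = "\<lambda>x. integral {0..x} f"
  have d: "(?F has_real_derivative f x) (at x within {0..2})" if "x \<in> {0..2}" for x
    by (rule integral_has_real_derivative[OF c that])
  show "(?F has_real_derivative f x) (at x)" if x: "x \<in> {0<..<2}" for x
    using d[of x] x by (simp add: at_within_Icc_at)
  show "?F x = 0" if "0 \<le> x" "x \<le> \<alpha>" for x
  proof -
    have "integral {0..x} f = integral {0..x} (\<lambda>_. 0)"
      using that z by (intro Henstock_Kurzweil_Integration.integral_cong) auto
    then show ?thesis by simp
  qed
  show "continuous_on {0..2} ?F" using d by (rule DERIV_continuous_on)
qed

text \<open>
  Variation of parameters: \<open>\<psi> = \<theta> p\<close> with the regular solution \<open>\<theta>\<close> and
  \<open>p' = -(1 / (r \<theta>\<^sup>2)) \<integral>\<^sub>0\<^sup>r s h \<theta> ds\<close>. As \<open>h\<close> vanishes near \<open>0\<close>, so does \<open>p'\<close>, and \<open>\<psi>\<close> is there a multiple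
  of \<open>\<theta>\<close>. The constant in \<open>p\<close> is fixed by the Neumann condition, which is possible because the flux of
  \<open>\<theta>\<close> at \<open>1\<close> is not zero.
\<close>

lemma inhomogeneous_solution:
  assumes b: "b > 0" and t: "t \<le> b" and nz: "regular_flux n b t 1 \<noteq> 0"
    and h: "continuous_on UNIV h" and al: "0 < \<alpha>" "\<alpha> < 1" and hz: "\<And>x. x \<le> \<alpha> \<Longrightarrow> h x = 0"
  shows "\<exists>\<psi> D E. neumann_regular n \<psi> D E \<and>
      (\<forall>r\<in>{0<..<1}. E r = r * radial_potential n b r * \<psi> r - r * (t * \<psi> r + h r))"
proof -
  let ?\<theta> = "regular_sol n b t" and ?P = "regular_flux n b t"
  have \<theta>: "?\<theta> r > 0" if "r > 0" for r using regular_sol_pos[OF b t that] .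
  have c1: "continuous_on {0..2} (\<lambda>s. s * h s * ?\<theta> s)"
    by (intro continuous_intros continuous_on_regular_sol continuous_on_subset[OF h]) auto
  obtain I where I: "\<And>x. x \<in> {0<..<2} \<Longrightarrow> (I has_real_derivative x * h x * ?\<theta> x) (at x)"
     "\<And>x. 0 \<le> x \<Longrightarrow> x \<le> \<alpha> \<Longrightarrow> I x = 0" "continuous_on {0..2} I"
    using antiderivative_from_zero[OF c1, of \<alpha>] hz by auto
  \<comment> \<open>The maximum only keeps the denominator away from zero; the values for \<open>s > \<alpha>\<close> are
    \<open>I s / (s \<theta>\<^sup>2)\<close>.\<close>
  define J where "J = (\<lambda>s. if s \<le> \<alpha> then 0 else I s / (max s \<alpha> * (?\<theta> (max s \<alpha>))\<^sup>2))"
  have cJ: "continuous_on {0..2} J"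
  proof -
    have "continuous_on {0..2} (\<lambda>s. I s / (max s \<alpha> * (?\<theta> (max s \<alpha>))\<^sup>2))"
    proof (intro continuous_intros I continuous_on_compose2[OF continuous_on_regular_sol[of UNIV]] ballI)
      fix s :: real
      have "max s \<alpha> > 0" using al by simp
      then show "max s \<alpha> * (?\<theta> (max s \<alpha>))\<^sup>2 \<noteq> 0" using \<theta>[of "max s \<alpha>"] by (simp add: less_imp_neq[symmetric])
    qed auto
    then show ?thesis by (rule continuous_on_eq) (auto simp: J_def I(2))
  qed
  have Jeq: "J s = I s / (s * (?\<theta> s)\<^sup>2)" if "s > 0" for s
    using that I(2)[of s] by (simp add: J_def max_def)
  have Jz: "J x = 0" if "x \<le> \<alpha>" for x using that by (simp add: J_def)
  obtain G where G: "\<And>x. x \<in> {0<..<2} \<Longrightarrow> (G has_real_derivative J x) (at x)"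
    "\<And>x. 0 \<le> x \<Longrightarrow> x \<le> \<alpha> \<Longrightarrow> G x = 0" "continuous_on {0..2} G"
  proof (rule antiderivative_from_zero[OF cJ Jz])
    fix F assume "\<And>x. x \<in> {0<..<2} \<Longrightarrow> (F has_real_derivative J x) (at x)"
      "\<And>x. 0 \<le> x \<Longrightarrow> x \<le> \<alpha> \<Longrightarrow> F x = 0" "continuous_on {0..2} F"
    then show thesis by (rule that)
  qed
  define p where "p = (\<lambda>r. I 1 / (?\<theta> 1 * ?P 1) + G 1 - G r)"
  have dp: "(p has_real_derivative - J r) (at r)" if "r \<in> {0<..<2}" for r
    unfolding p_def using G(1)[OF that] by (auto intro!: derivative_eq_intros)
  have cp: "continuous_on {0..1} p" unfolding p_def
    by (intro continuous_intros continuous_on_subset[OF G(3)]) auto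
  define \<psi> where "\<psi> = (\<lambda>r. ?\<theta> r * p r)"
  define D where "D = (\<lambda>r. ?P r / r * p r - ?\<theta> r * J r)"
  define E where "E = (\<lambda>r. r * radial_potential n b r * \<psi> r - r * (t * \<psi> r + h r))"
  obtain Bp where Bp: "\<And>r. r \<in> {0..1} \<Longrightarrow> \<bar>p r\<bar> \<le> Bp" using continuous_on_Icc_bounded[OF cp] by blast
  have cTJ: "continuous_on {0..1} (\<lambda>r. ?\<theta> r * J r)"
    by (intro continuous_intros continuous_on_regular_sol continuous_on_subset[OF cJ]) auto
  obtain BJ where BJ: "\<And>r. r \<in> {0..1} \<Longrightarrow> \<bar>?\<theta> r * J r\<bar> \<le> BJ" using continuous_on_Icc_bounded[OF cTJ] by blast
  obtain Bh where Bh: "\<And>r. r \<in> {0..1} \<Longrightarrow> \<bar>h r\<bar> \<le> Bh" using continuous_on_Icc_bounded[OF continuous_on_subset[OF h]] by blast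
  obtain C1 C2 where C: "\<And>r. r \<in> {0<..<1} \<Longrightarrow> \<bar>?\<theta> r\<bar> \<le> C1 * r ^ min n 1"
     "\<And>r. r \<in> {0<..<1} \<Longrightarrow> \<bar>?P r / r\<bar> \<le> C2 * r ^ (1 - n)"
    using regular_sol_bounds[of n b t] by blast
  have Bp0: "Bp \<ge> 0" and BJ0: "BJ \<ge> 0" using Bp[of 0] BJ[of 0] by auto
  have "neumann_regular n \<psi> D E"
  proof (rule neumann_regularI[where h = h and B = Bh and t = t and Cv = "C1 * Bp" and Cd = "C2 * Bp + BJ / \<alpha>" and b = b])
    fix r :: real assume r1: "r \<in> {0<..1}"
    then have r: "r > 0" "r \<in> {0<..<2}" by auto
    show "(\<psi> has_real_derivative D r) (at r)"
      unfolding \<psi>_def D_def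
      by (rule DERIV_cong[OF DERIV_mult[OF regular_sol_deriv[OF r(1)] dp[OF r(2)]]]) (simp add: algebra_simps)
    have "((\<lambda>s. ?P s * p s - I s / ?\<theta> s) has_real_derivative
       (r * radial_potential n b r * ?\<theta> r - r * (t * ?\<theta> r)) * p r + - J r * ?P r
        - ((r * h r * ?\<theta> r) * ?\<theta> r - I r * (?P r / r)) / (?\<theta> r * ?\<theta> r)) (at r)"
      using \<theta>[OF r(1)]
      by (intro DERIV_diff DERIV_mult DERIV_divide regular_flux_deriv regular_sol_deriv dp I r b) auto
    then have "((\<lambda>s. ?P s * p s - I s / ?\<theta> s) has_real_derivative E r) (at r)"
      by (rule DERIV_cong)
         (use \<theta>[OF r(1)] r in \<open>simp add: E_def \<psi>_def Jeq[OF r(1)] field_simps power2_eq_square\<close>)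
    then show "((\<lambda>s. s * D s) has_real_derivative E r) (at r)"
    proof (rule has_field_derivative_transform_within_open[OF _ open_greaterThan[of 0]])
      fix s :: real assume "s \<in> {0<..}"
      then have s: "s > 0" by simp
      show "?P s * p s - I s / ?\<theta> s = s * D s"
        unfolding D_def Jeq[OF s] using s \<theta>[OF s] by (simp add: field_simps power2_eq_square)
    qed (use r in simp)
  next
    fix r :: real assume r: "r \<in> {0<..<1}"
    have r01: "r \<in> {0..1}" using r by auto
    have "\<bar>\<psi> r\<bar> \<le> (C1 * r ^ min n 1) * Bp"
      unfolding \<psi>_def using mult_mono[OF C(1)[OF r] Bp[OF r01] order_trans[OF abs_ge_zero C(1)[OF r]]]
      by (simp only: abs_mult abs_ge_zero)
    then show "\<bar>\<psi> r\<bar> \<le> C1 * Bp * r ^ min n 1" by (simp add: mult_ac)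
    have 1: "\<bar>?P r / r * p r\<bar> \<le> (C2 * r ^ (1 - n)) * Bp"
      using mult_mono[OF C(2)[OF r] Bp[OF r01] order_trans[OF abs_ge_zero C(2)[OF r]]] by (simp only: abs_mult abs_ge_zero)
    have k: "r \<le> r ^ (1 - n)" "0 \<le> r ^ (1 - n)" using r by (cases n; simp)+
    have 2: "\<bar>?\<theta> r * J r\<bar> \<le> BJ / \<alpha> * r ^ (1 - n)"
    proof (cases "r \<le> \<alpha>")
      case True
      then show ?thesis using BJ0 al k by (simp add: J_def)
    next
      case False
      have "BJ * 1 \<le> BJ * (r ^ (1 - n) / \<alpha>)" using False k al BJ0 by (intro mult_left_mono) auto
      then show ?thesis using BJ[OF r01] by simp
    qed
    show "\<bar>D r\<bar> \<le> (C2 * Bp + BJ / \<alpha>) * r ^ (1 - n)"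
      using order_trans[OF abs_triangle_ineq4 add_mono[OF 1 2]] unfolding D_def by (simp add: algebra_simps)
  next
    have p1: "p 1 = I 1 / (?\<theta> 1 * ?P 1)" by (simp add: p_def)
    show "D 1 = 0"
      unfolding D_def p1 using Jeq[of 1] \<theta>[of 1] nz by (simp add: power2_eq_square)
  qed (use Bh in \<open>auto simp: E_def intro: continuous_on_subset[OF h]\<close>)
  then show ?thesis by (intro exI conjI ballI) (auto simp: E_def)
qed

text \<open>
  A positive regular solution that satisfies the Neumann condition belongs to the lowest
  eigenvalue: at any smaller parameter its flux at \<open>1\<close> is positive, so the inhomogeneous problem is
  solvable there.
\<close>

lemma radial_eigenvalue_eqI:
  assumes b: "b > 0" and t: "t \<le> b" and z: "neumann_defect n (t / b) (b / 2) = 0"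
  shows "radial_eigenvalue n b = t"
  unfolding radial_eigenvalue_def
proof (rule Least_equality)
  show "is_eigenvalue radial_measure (radial_operator n b) (of_real t)"
    by (rule neumann_solution_eigenvalue[OF regular_sol_neumann_regular[OF b z]])
       (auto intro: regular_sol_pos[OF b t])
  fix s assume s: "is_eigenvalue radial_measure (radial_operator n b) (of_real s)"
  show "t \<le> s"
  proof (rule ccontr)
    assume "\<not> t \<le> s"
    then have st: "s < t" by simp
    have "regular_flux n b t 1 = 0" using z by (simp add: regular_flux_def)
    then have nz: "regular_flux n b s 1 \<noteq> 0" using regular_flux_1_pos[OF b st t, of n] by simp
    have "\<not> is_eigenvalue radial_measure (radial_operator n b) (of_real s)"
    proof (rule not_eigenvalue_if_solvable)
      fix k \<alpha> \<gamma> assume a: "0 < \<alpha>" "\<alpha> < \<gamma>" "\<gamma> < (1::real)"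
      show "\<exists>\<psi> D E. neumann_regular n \<psi> D E \<and>
        (\<forall>r\<in>{0<..<1}. E r = r * radial_potential n b r * \<psi> r - r * (s * \<psi> r + bump (Suc k) \<alpha> \<gamma> r))"
      proof (rule inhomogeneous_solution[OF b _ nz _ a(1)])
        show "continuous_on UNIV (bump (Suc k) \<alpha> \<gamma>)"
          by (rule continuous_on_bump)
        show "bump (Suc k) \<alpha> \<gamma> x = 0" if "x \<le> \<alpha>" for x
          by (rule bump_outside) (use that a in auto)
      qed (use st t a in auto)
    qed
    with s show False by simp
  qed
qed

section \<open>The crossing values increase\<close>

theorem theorem1p3:
  fixes \<beta> :: "nat \<Rightarrow> real"
  assumes "strict_mono \<beta>"
    and "\<And>n. \<beta> n > 2 * (real n + 1)"
    and "\<And>n b. b > 0 \<Longrightarrow> radial_eigenvalue n b = radial_eigenvalue (n + 1) b \<longleftrightarrow> b = \<beta> n"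
    and "\<And>b. 0 \<le> b \<Longrightarrow> b \<le> \<beta> 0 \<Longrightarrow> ground_energy b = radial_eigenvalue 0 b"
    and "\<And>n b. n \<ge> 1 \<Longrightarrow> \<beta> (n - 1) \<le> b \<Longrightarrow> b \<le> \<beta> n \<Longrightarrow> ground_energy b = radial_eigenvalue n b"
  shows "strict_mono (\<lambda>n. ground_energy (\<beta> n) / \<beta> n)"
proof -
  \<comment> \<open>A zero of the defect on the curve produces a common value of two consecutive branches, and
    hence is the crossing at \<open>\<beta> n\<close>.\<close>
  have key: "ground_energy (\<beta> n) / \<beta> n = \<eta>"
    if \<eta>: "0 \<le> \<eta>" "\<eta> < 1" "neumann_defect n \<eta> (crossing n \<eta>) = 0" for n \<eta>
  proof -
    define b where "b = 2 * crossing n \<eta>"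
    have c: "crossing n \<eta> \<ge> real n + 1 + 2 * \<eta>" by (rule crossing_ge[OF \<eta>(1)])
    have b: "b > 0" using c \<eta> by (simp add: b_def)
    have z: "neumann_defect (Suc n) \<eta> (crossing n \<eta>) = 0"
      by (rule neumann_defect_ladder[OF \<eta>(3) crossing_eq[OF \<eta>(1)]]) (use c \<eta> in auto)
    have e: "radial_eigenvalue m b = b * \<eta>" if "neumann_defect m \<eta> (crossing n \<eta>) = 0" for m
      by (rule radial_eigenvalue_eqI) (use b that \<eta> in \<open>auto simp: b_def\<close>)
    have "b = \<beta> n" using assms(3)[OF b, of n] e[OF \<eta>(3)] e[OF z] by simp
    moreover have "ground_energy (\<beta> n) = radial_eigenvalue n (\<beta> n)"
    proof (cases n)
      case 0
      then show ?thesis using assms(4)[of "\<beta> 0"] assms(2)[of 0] by simp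
    next
      case (Suc m)
      then show ?thesis
        using assms(5)[of n "\<beta> n"] strict_mono_mono[OF assms(1)] by (simp add: monoD)
    qed
    ultimately show ?thesis using e[OF \<eta>(3)] b by simp
  qed
  show ?thesis
  proof (rule strict_mono_Suc_iff[THEN iffD2], rule allI)
    fix n
    obtain \<eta> where \<eta>: "0 \<le> \<eta>" "\<eta> < 1" "neumann_defect n \<eta> (crossing n \<eta>) = 0"
      using crossing_root_exists by blast
    obtain \<eta>' where \<eta>': "\<eta> < \<eta>'" "\<eta>' < 1" "neumann_defect (Suc n) \<eta>' (crossing (Suc n) \<eta>') = 0"
      using crossing_root_increase[OF \<eta>] by blast
    show "ground_energy (\<beta> n) / \<beta> n < ground_energy (\<beta> (Suc n)) / \<beta> (Suc n)"
      using key[OF \<eta>] key[OF _ \<eta>'(2,3)] \<eta> \<eta>' by simp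
  qed
qed

end
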